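(* For each $n\ge 1$ let $\{x_i=x_{i,n};\,0\le i\le n-1\}$ be independent real random variables, and suppose that the array satisfies Assumption A (stated in the context) with truncation levels $t_n$ and limit functions $g_{2k}$. Let $SC_n$ be the $n\times n$ symmetric circulant matrix whose $(i,j)$-th entry ($1\le i,j\le n$) is $x_{\frac n2-|\frac n2-|i-j||}$, and let $Z_n$ be the $n\times n$ symmetric circulant matrix built in the same way from the variables $y_i=x_i\mathbf 1_{\{|x_i|\le t_n\}}$. Then: (a) The EESD of $Z_n$ converges weakly, as $n\to\infty$, to a symmetric probability measure $\mu$ on $\mathbb R$, whose moments are $$\beta_k(\mu)=\begin{cases}\displaystyle\sum_{\sigma\in E(k)}a_\sigma C_\sigma & \text{if } k \text{ is even},\\ 0&\text{if } k\text{ is odd},\end{cases}$$ where $C_{2m}=2\int_0^{1/2} g_{2m}(t)\,dt$ for $m\ge1$ and $a_{2m}=\frac12\binom{2m}{m}$ for $m\ge 1$. In particular, if for every $n$ the variables $\{x_{i,n};\,0\le i\le n-1\}$ are i.i.d., then the EESD of $Z_n$ converges weakly to a symmetric probability measure $\mu$ on $\mathbb R$ with moments $\beta_k(\mu)=\sum_{\sigma\in E(k)}a_\sigma C_\sigma$ for $k$ even and $\beta_k(\mu)=0$ for $k$ odd, where $a_{2m}=\frac12\binom{2m}{m}$ and $C_{2m}=\lim_{n\to\infty} g_{2m,n}$ for $m\ge1$ (the $g_{2m,n}$ being constant functions in that case). (b) If, in addition, $$\sum_{i=0}^{n-1}\mathbb E\big[x_i^2\mathbf 1_{\{|x_i|>t_n\}}\big]\to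 0\quad (n\to\infty),$$ then the EESD of $SC_n$ converges weakly to $\mu$.
   Context: **EESD.** For an $n\times n$ real symmetric random matrix $A$ with eigenvalues $\lambda_1,\dots,\lambda_n$, the empirical spectral distribution (ESD) is the distribution of the random measure $\mu_A=\frac1n\sum_{i=1}^n\delta_{\lambda_i}$; the expected empirical spectral distribution (EESD) is the non-random probability distribution with measure $\mathbb E\mu_A$. **Partitions.** $[k]=\{1,\dots,k\}$ and $\mathcal P(k)$ is the set of all partitions of $[k]$. For a real sequence $\{c_n\}_{n\ge1}$, its multiplicative extension is $c_\sigma=\prod_{V\in\sigma}c_{|V|}$, the product being over the blocks $V$ of $\sigma\in\mathcal P(k)$. $E(k)$ denotes the set of even partitions of $[k]$: those in which every block has an even number of elements (so only even-indexed $a_{2m}$, $C_{2m}$ enter $a_\sigma$, $C_\sigma$). **Assumption A.** For $k,n\ge1$, $g_{2k,n}$ are bounded Riemann integrable functions on $[0,1]$, and there is a sequence $t_n\in[0,\infty]$ such that: (i) for each $k\in\mathbb N=\{1,2,\dots\}$, $$n\,\mathbb E\big[x_i^{2k}\mathbf 1_{\{|x_i|\le t_n\}}\big]=g_{2k,n}\big(\tfrac in\big)\quad\text{for }0\le i\le n-1,$$ $$\lim_{n\to\infty}n^{\alpha}\sup_{0\le i\le n-1}\Big|\mathbb E\big[x_i^{2k-1}\mathbf 1_{\{|x_i|\le t_n\}}\big]\Big|=0\quad\text{for every }\alpha<1;$$ (ii) for every $k\ge1$, $g_{2k,n}$ converges uniformly on $[0,1]$ to a function $g_{2k}$ as $n\to\infty$;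 (iii) with $M_{2k}=\|g_{2k}\|$ (sup norm) and $M_{2k-1}=0$ for $k\ge1$, the numbers $\alpha_{2k}=\sum_{\sigma\in\mathcal P(2k)}M_\sigma$ satisfy Carleman's condition $\sum_{k=1}^\infty\alpha_{2k}^{-1/(2k)}=\infty$ (with $0^{-1/(2k)}=+\infty$). *)

theory Defs
  imports "HOL-Probability.Probability" "Jordan_Normal_Form.Char_Poly"
begin

text \<open>For a real symmetric matrix all roots of the characteristic polynomial are real, so the
  algebraic multiplicities below add up to the dimension and \<open>esd A\<close> is
  \<open>1/n \<Sum> \<delta>(\<lambda>\<^sub>i)\<close> with the eigenvalues listed with multiplicity.\<close>

definition esd :: "real mat \<Rightarrow> real measure" where
  "esd A = measure_of UNIV (sets borel)
     (\<lambda>B. (\<Sum>l | eigenvalue A l. of_nat (order l (char_poly A)) * indicator B l) /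
           of_nat (dim_row A))"

definition eesd :: "'a measure \<Rightarrow> ('a \<Rightarrow> real mat) \<Rightarrow> real measure" where
  "eesd M A = measure_of UNIV (sets borel) (\<lambda>B. \<integral>\<^sup>+\<omega>. emeasure (esd (A \<omega>)) B \<partial>M)"

text \<open>Rows and columns are numbered from 0; the entry depends on \<open>i - j\<close> only. The argument of
  the floor is the integer \<open>min \<bar>i - j\<bar> (n - \<bar>i - j\<bar>)\<close>.\<close>

definition sym_circulant :: "nat \<Rightarrow> (nat \<Rightarrow> real) \<Rightarrow> real mat" where
  "sym_circulant n x =
     mat n n (\<lambda>(i, j). x (nat \<lfloor>real n / 2 - \<bar>real n / 2 - \<bar>real i - real j\<bar>\<bar>\<rfloor>))"

definition partitions :: "nat \<Rightarrow> nat set set set" where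
  "partitions k = {\<sigma>. partition_on {1..k} \<sigma>}"

definition even_partitions :: "nat \<Rightarrow> nat set set set" where
  "even_partitions k = {\<sigma> \<in> partitions k. \<forall>V\<in>\<sigma>. even (card V)}"

definition mult_ext :: "(nat \<Rightarrow> real) \<Rightarrow> nat set set \<Rightarrow> real" where
  "mult_ext c \<sigma> = (\<Prod>V\<in>\<sigma>. c (card V))"

text \<open>Compared with the Henstock-Kurzweil integral, the gauge has constant radius; this is the
  usual condition that the mesh of the tagged partition tends to 0.\<close>

definition Riemann_integrable_on :: "(real \<Rightarrow> real) \<Rightarrow> real \<Rightarrow> real \<Rightarrow> bool" where
  "Riemann_integrable_on f a b \<longleftrightarrow>
     (\<exists>I. \<forall>e>0. \<exists>d>0. \<forall>p. p tagged_division_of {a..b} \<and> (\<lambda>x. ball x d) fine p \<longrightarrow>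
        \<bar>(\<Sum>(x, K)\<in>p. measure lborel K * f x) - I\<bar> < e)"

text \<open>The truncation levels have type \<^typ>\<open>ennreal\<close>, i.e. they range over \<open>[0, \<infinity>]\<close>.\<close>

definition trunc :: "ennreal \<Rightarrow> real \<Rightarrow> real" where
  "trunc t u = u * of_bool (ennreal \<bar>u\<bar> \<le> t)"

definition sup_norm_seq :: "(nat \<Rightarrow> real \<Rightarrow> real) \<Rightarrow> nat \<Rightarrow> real" where
  "sup_norm_seq g j = (if even j then (SUP s\<in>{0..1}. \<bar>g j s\<bar>) else 0)"

definition carleman_alpha :: "(nat \<Rightarrow> real \<Rightarrow> real) \<Rightarrow> nat \<Rightarrow> real" where
  "carleman_alpha g j = (\<Sum>\<sigma>\<in>partitions j. mult_ext (sup_norm_seq g) \<sigma>)"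

text \<open>\<open>gn (2 * k) n\<close> and \<open>g (2 * k)\<close> stand for \<open>g\<^bsub>2k,n\<^esub>\<close> and \<open>g\<^bsub>2k\<^esub>\<close>; odd indices and
  \<open>n = 0\<close> are unconstrained. Integrability is stated because the Bochner integral of a
  non-integrable function is 0; that of the odd truncated moments follows from it. In Carleman's
  condition the inverse is taken in \<^typ>\<open>ennreal\<close>, where the inverse of 0 is \<open>\<infinity>\<close>.\<close>

definition assumption_A ::
  "(nat \<Rightarrow> 'a measure) \<Rightarrow> (nat \<Rightarrow> nat \<Rightarrow> 'a \<Rightarrow> real) \<Rightarrow> (nat \<Rightarrow> ennreal) \<Rightarrow>
   (nat \<Rightarrow> nat \<Rightarrow> real \<Rightarrow> real) \<Rightarrow> (nat \<Rightarrow> real \<Rightarrow> real) \<Rightarrow> bool" where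
  "assumption_A M x t gn g \<longleftrightarrow>
     (\<forall>k\<ge>1. \<forall>n\<ge>1. bounded (gn (2 * k) n ` {0..1}) \<and> Riemann_integrable_on (gn (2 * k) n) 0 1) \<and>
     (\<forall>k\<ge>1. \<forall>n\<ge>1. \<forall>i<n.
        integrable (M n) (\<lambda>\<omega>. x n i \<omega> ^ (2 * k) * of_bool (ennreal \<bar>x n i \<omega>\<bar> \<le> t n)) \<and>
        real n * (\<integral>\<omega>. x n i \<omega> ^ (2 * k) * of_bool (ennreal \<bar>x n i \<omega>\<bar> \<le> t n) \<partial>M n) =
          gn (2 * k) n (real i / real n)) \<and>
     (\<forall>k\<ge>1. \<forall>\<alpha><1.
        (\<lambda>n. real n powr \<alpha> *
          (SUP i\<in>{..<n}.
             \<bar>\<integral>\<omega>. x n i \<omega> ^ (2 * k - 1) * of_bool (ennreal \<bar>x n i \<omega>\<bar> \<le> t n) \<partial>M n\<bar>))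
        \<longlonglongrightarrow> 0) \<and>
     (\<forall>k\<ge>1. uniform_limit {0..1} (gn (2 * k)) (g (2 * k)) sequentially) \<and>
     (\<Sum>k. inverse (ennreal (carleman_alpha g (2 * Suc k) powr (1 / real (2 * Suc k))))) = \<infinity>"

definition symmetric_measure :: "real measure \<Rightarrow> bool" where
  "symmetric_measure \<mu> \<longleftrightarrow> distr \<mu> borel uminus = \<mu>"

definition has_moments :: "real measure \<Rightarrow> (nat \<Rightarrow> real) \<Rightarrow> bool" where
  "has_moments \<mu> \<beta> \<longleftrightarrow> (\<forall>k. integrable \<mu> (\<lambda>u. u ^ k) \<and> (\<integral>u. u ^ k \<partial>\<mu>) = \<beta> k)"

text \<open>Only the even-indexed values \<open>a\<^bsub>2m\<^esub>\<close> matter.\<close>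

definition a_seq :: "nat \<Rightarrow> real" where
  "a_seq j = 1 / 2 * real (j choose (j div 2))"

definition limit_moment :: "(nat \<Rightarrow> real) \<Rightarrow> nat \<Rightarrow> real" where
  "limit_moment C k =
     (if even k then \<Sum>\<sigma>\<in>even_partitions k. mult_ext a_seq \<sigma> * mult_ext C \<sigma> else 0)"

end

theory Submission
  imports Defs
begin

text \<open>Why the theorem holds. All symmetric circulants of order \<open>n\<close> are diagonalised by one and the same
matrix, and the eigenvalue with frequency \<open>j\<close> is the linear form
\<open>\<lambda>\<^sub>j = \<Sum>\<^bsub>l \<le> n/2\<^esub> w\<^sub>j\<^sub>l x\<^sub>l\<close> with \<open>w\<^sub>j\<^sub>l = 2 cos (2\<pi>jl/n)\<close>, halved for \<open>l = 0\<close> and \<open>2l = n\<close>. Hence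
the expected empirical spectral distribution is the law of \<open>\<lambda>\<^sub>J\<close>, where \<open>J\<close> is uniform on the
frequencies and independent of the entries (\<open>eesd_sym_circulant\<close>), and the matrix disappears from the
problem: what remains is a sum of independent variables with deterministic weights.

For fixed \<open>j\<close> the exponential generating series of the moments of \<open>\<lambda>\<^sub>j\<close> is a product
\<open>\<Prod>\<^sub>l (1 + u\<^sub>l)\<close> in which every coefficient of \<open>u\<^sub>l\<close> is small. Its logarithmic derivative
is \<open>\<Sum>\<^sub>l u\<^sub>l' / (1 + u\<^sub>l)\<close>, which equals \<open>\<Sum>\<^sub>l u\<^sub>l'\<close> up to products of two small factors, so that
the moments of \<open>\<lambda>\<^sub>j\<close> are asymptotically determined by the sums
\<open>S\<^sub>p(j) = \<Sum>\<^sub>l E[y\<^sub>l\<^sup>p] w\<^sub>j\<^sub>l\<^sup>p\<close>: if \<open>S\<^sub>p(j) \<rightarrow> \<kappa>\<^sub>p\<close> for every \<open>p\<close>, they converge to the moments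
with cumulants \<open>\<kappa>\<^sub>p\<close> (\<open>fps_prod_tendsto_cumulant_moment\<close>). Written out over set partitions, these
moments are the ones in the theorem, with \<open>\<kappa>\<^sub>p = a\<^sub>p C\<^sub>p\<close> for even \<open>p\<close> and \<open>\<kappa>\<^sub>p = 0\<close> for odd \<open>p\<close>.

The numbers \<open>S\<^sub>p(j)\<close> do converge in this way for all but a vanishing proportion of the frequencies
(\<open>circ_weight_power_mean_square\<close>). Expanding \<open>(2 cos \<theta>)\<^sup>p\<close> into cosines, the constant term is the
central binomial coefficient when \<open>p\<close> is even and is absent when \<open>p\<close> is odd, and by orthogonality the
other terms contribute at most a constant times \<open>\<Sum>\<^sub>l E[y\<^sub>l\<^sup>p]\<^sup>2\<close> to the mean square over \<open>j\<close>.
For even \<open>p\<close> the constant term is a Riemann sum, which yields \<open>a\<^sub>p C\<^sub>p\<close>. For odd \<open>p\<close> the individual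
sums \<open>\<Sum>\<^sub>l E[y\<^sub>l\<^sup>p]\<close> need not be bounded; it is the averaging over \<open>j\<close> that removes them.

Passing from moments to weak convergence requires that the limiting moments determine the measure.
By hypothesis they satisfy Carleman's condition, and Carleman's criterion is proved here by Bang's
quasi-analytic argument: the derivatives of the difference of two characteristic functions all vanish at
\<open>0\<close>, and Taylor's formula propagates their smallness over an interval whose length is a divergent sum
(\<open>bang_vanishing\<close>). The divergence comes from Carleman's condition through Carleman's inequality. The
same criterion gives the symmetry of the limit, because its odd moments vanish.

For the untruncated matrix, replacing the entries by their truncations changes \<open>\<lambda>\<^sub>J\<close> in mean square by at most
\<open>4 \<Sum>\<^sub>l E[(x\<^sub>l - y\<^sub>l)\<^sup>2]\<close>, again by orthogonality, which is enough for the characteristic functions.\<close>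

section \<open>Carleman's inequality for geometric means\<close>

text \<open>Carleman's inequality, without its sharp constant. The geometric mean of \<open>a\<^sub>0, \<dots>, a\<^sub>k\<close> is
compared with the arithmetic mean of the weighted terms \<open>(i + 1) a\<^sub>i\<close>; the weights contribute
\<open>(k + 1)!\<close>, which is at least \<open>((k + 1) / e)\<^bsup>k + 1\<^esup>\<close>, and this produces a summable factor
\<open>e / (k + 1)\<^sup>2\<close>. Unweighted means would lead to the divergent \<open>\<Sum> 1 / k\<close>.\<close>

lemma carleman_inequality_summable:
  fixes a :: "nat \<Rightarrow> real"
  assumes a: "\<And>i. a i > 0" and sm: "summable a"
  shows "summable (\<lambda>k. (\<Prod>i<Suc k. a i) powr (1 / real (Suc k)))"
proof -
  define b where "b k i = (if i \<le> k then real (Suc i) * a i else 0)" for k i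
  have gm: "(\<Prod>i<Suc k. a i) powr (1 / real (Suc k)) \<le>
      exp 1 / real (Suc k)^2 * (\<Sum>i\<le>k. real (Suc i) * a i)" for k
  proof -
    let ?N = "real (Suc k)"
    have f: "?N powr ?N \<le> exp ?N * fact (Suc k)"
    proof -
      have s: "(\<lambda>m. ?N ^ m /\<^sub>R fact m) sums exp ?N" by (rule exp_converges)
      have "(\<Sum>m\<in>{Suc k}. ?N ^ m /\<^sub>R fact m) \<le> exp ?N"
        using sum_le_suminf[of "\<lambda>m. ?N ^ m /\<^sub>R fact m" "{Suc k}"] s
        by (auto simp: sums_iff simp del: of_nat_Suc)
      then have "?N ^ Suc k \<le> exp ?N * fact (Suc k)"
        by (simp add: field_simps del: power_Suc fact_Suc of_nat_Suc)
      then show ?thesis by (simp add: powr_realpow[symmetric] del: of_nat_Suc power_Suc fact_Suc)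
    qed
    have P: "(\<Prod>i<Suc k. real (Suc i) * a i) = fact (Suc k) * (\<Prod>i<Suc k. a i)"
      by (simp only: prod.distrib fact_prod_Suc of_nat_prod atLeast0LessThan)
    have pos: "(\<Prod>i<Suc k. a i) > 0" using a by (intro prod_pos) auto
    define l where "l i = ln (real (Suc i) * a i)" for i
    define S where "S = (\<Sum>i<Suc k. real (Suc i) * a i)"
    have Spos: "S > 0" unfolding S_def using a by (intro sum_pos) auto
    have el: "exp (l i) = real (Suc i) * a i" for i using a[of i] by (simp add: l_def)
    define c where "c = ln (S / ?N)"
    have ec: "exp c = S / ?N" using Spos by (simp add: c_def)
    have "(\<Sum>i<Suc k. l i) \<le> ?N * c"
    proof -
      \<comment> \<open>The inequality of arithmetic and geometric means, by the tangent of \<open>exp\<close> at the logarithm \<open>c\<close>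
        of the arithmetic mean.\<close>
      have "exp (l i) \<ge> exp c * (1 + (l i - c))" for i
      proof -
        have "1 + (l i - c) \<le> exp (l i - c)" by (rule exp_ge_add_one_self)
        then have "exp c * (1 + (l i - c)) \<le> exp c * exp (l i - c)" by (intro mult_left_mono) auto
        then show ?thesis by (simp flip: exp_add)
      qed
      then have "(\<Sum>i<Suc k. exp c * (1 + (l i - c))) \<le> S" unfolding S_def el[symmetric]
        by (intro sum_mono) blast
      moreover have "(\<Sum>i<Suc k. exp c * (1 + (l i - c))) = exp c * (?N + (\<Sum>i<Suc k. l i) - ?N * c)"
        by (simp add: sum_distrib_left[symmetric] sum.distrib sum_subtractf algebra_simps)
      moreover have "S = exp c * ?N" using ec by (simp add: field_simps del: of_nat_Suc)
      ultimately have "exp c * (?N + (\<Sum>i<Suc k. l i) - ?N * c) \<le> exp c * ?N" by simp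
      then show ?thesis by simp
    qed
    moreover have "(\<Sum>i<Suc k. l i) = ln (\<Prod>i<Suc k. real (Suc i) * a i)"
      unfolding l_def using a by (intro ln_prod[symmetric]) (auto simp: less_imp_neq[symmetric] intro!: mult_pos_pos)
    ultimately have "ln (fact (Suc k) * (\<Prod>i<Suc k. a i)) \<le> ?N * c" by (simp only: P)
    moreover have "ln (fact (Suc k) * (\<Prod>i<Suc k. a i)) = ln (fact (Suc k)) + ln (\<Prod>i<Suc k. a i)"
      by (rule ln_mult_pos) (use pos in auto)
    moreover have "?N * ln ?N \<le> ?N + ln (fact (Suc k))"
    proof -
      have "ln (?N powr ?N) \<le> ln (exp ?N * fact (Suc k))" using f by (subst ln_le_cancel_iff) auto
      then show ?thesis by (simp add: ln_powr ln_mult del: of_nat_Suc fact_Suc)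
    qed
    ultimately have "ln (\<Prod>i<Suc k. a i) \<le> ?N * (c + 1 - ln ?N)" by (simp add: algebra_simps)
    then have "(1 / ?N) * ln (\<Prod>i<Suc k. a i) \<le> c + 1 - ln ?N" by (simp add: field_simps)
    then have "exp ((1 / ?N) * ln (\<Prod>i<Suc k. a i)) \<le> exp (c + 1 - ln ?N)" by simp
    also have "exp (c + 1 - ln ?N) = exp 1 / ?N^2 * S"
      by (simp add: exp_add exp_diff ec power2_eq_square field_simps del: of_nat_Suc)
    finally show ?thesis using less_imp_neq[OF pos, symmetric] unfolding powr_def S_def lessThan_Suc_atMost
      by (simp only: if_False)
  qed
  have tele: "(\<Sum>k<Suc d. 1 / real (i + Suc k)^2) \<le> 2 / real (Suc i) - 1 / real (i + Suc d)" for i d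
  proof (induction d)
    case 0
    have "1 / real (Suc i)^2 \<le> 1 / real (Suc i)" by (intro frac_le self_le_power) auto
    then show ?case by simp
  next
    case (Suc d)
    have "1 / (m + 1)^2 \<le> 1 / m - 1 / (m + 1)" if "m > 0" for m :: real
    proof -
      have "1 / m - 1 / (m + 1) = 1 / (m * (m + 1))" using that by (simp add: field_simps)
      moreover have "1 / (m + 1)^2 \<le> 1 / (m * (m + 1))"
        using that by (intro frac_le mult_pos_pos) (auto simp: power2_eq_square algebra_simps)
      ultimately show ?thesis by simp
    qed
    from this[of "real (i + Suc d)"] have "1 / real (i + Suc (Suc d))^2 \<le> 1 / real (i + Suc d) - 1 / real (i + Suc (Suc d))"
      by (simp add: add_ac)
    then show ?case using Suc by simp
  qed
  have tele': "(\<Sum>k<K. if i \<le> k then 1 / real (Suc k)^2 else 0) \<le> 2 / real (Suc i)" for i K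
  proof (cases "i < K")
    case True
    then obtain d where d: "K = i + Suc d" using less_iff_Suc_add by auto
    have "(\<Sum>k<K. if i \<le> k then 1 / real (Suc k)^2 else 0) = (\<Sum>k\<in>{i..<K}. 1 / real (Suc k)^2)"
      by (rule sum.mono_neutral_cong_right) auto
    also have "\<dots> = (\<Sum>k<Suc d. 1 / real (i + Suc k)^2)"
      by (rule sum.reindex_bij_witness[of _ "\<lambda>k. i + k" "\<lambda>k. k - i"]) (auto simp: d)
    also have "\<dots> \<le> 2 / real (Suc i)" using tele[where i=i
    and d=d] by (smt (verit) divide_nonneg_nonneg of_nat_0_le_iff)
    finally show ?thesis .
  qed (auto intro!: sum_nonpos)
  show ?thesis
  proof (rule summableI_nonneg_bounded)
    fix K
    have "(\<Sum>k<K. (\<Prod>i<Suc k. a i) powr (1 / real (Suc k))) \<le>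
        (\<Sum>k<K. exp 1 / real (Suc k)^2 * (\<Sum>i\<le>k. real (Suc i) * a i))"
      by (intro sum_mono gm)
    also have "\<dots> = (\<Sum>k<K. \<Sum>i<K. exp 1 * real (Suc i) * a i * (if i \<le> k then 1 / real (Suc k)^2 else 0))"
    proof (intro sum.cong refl)
      fix k assume "k \<in> {..<K}"
      then have "(\<Sum>i<K. if i \<le> k then real (Suc i) * a i else 0) = (\<Sum>i\<le>k. real (Suc i) * a i)"
        by (intro sum.mono_neutral_cong_right) auto
      then show "exp 1 / real (Suc k)^2 * (\<Sum>i\<le>k. real (Suc i) * a i) =
          (\<Sum>i<K. exp 1 * real (Suc i) * a i * (if i \<le> k then 1 / real (Suc k)^2 else 0))"
        by (simp only: sum_distrib_left flip: \<open>_ = (\<Sum>i\<le>k. real (Suc i) * a i)\<close>) (auto intro!: sum.cong)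
    qed
    also have "\<dots> = (\<Sum>i<K. exp 1 * real (Suc i) * a i * (\<Sum>k<K. if i \<le> k then 1 / real (Suc k)^2 else 0))"
      by (subst sum.swap) (simp only: sum_distrib_left)
    also have "\<dots> \<le> (\<Sum>i<K. exp 1 * real (Suc i) * a i * (2 / real (Suc i)))"
      using a by (intro sum_mono mult_left_mono tele') (auto intro: less_imp_le)
    also have "\<dots> = 2 * exp 1 * (\<Sum>i<K. a i)"
      by (simp add: sum_distrib_left field_simps del: of_nat_Suc)
    also have "\<dots> \<le> 2 * exp 1 * suminf a"
      using a by (intro mult_left_mono sum_le_suminf sm) (auto intro: less_imp_le)
    finally show "(\<Sum>k<K. (\<Prod>i<Suc k. a i) powr (1 / real (Suc k))) \<le> 2 * exp 1 * suminf a" .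
  qed (rule powr_ge_zero)
qed

section \<open>Bang's argument for quasi-analyticity\<close>

text \<open>The \<open>n\<close>-th derivative of the characteristic function. Defining it by the integral makes Taylor's
formula with remainder available directly from the pointwise estimate for \<open>e\<^sup>i\<^sup>x\<close>, so that nothing
ever has to be differentiated.\<close>

definition char_deriv :: "real measure \<Rightarrow> nat \<Rightarrow> real \<Rightarrow> complex" where
  "char_deriv \<mu> n t = (\<integral>x. (\<i> * of_real x) ^ n * iexp (t * x) \<partial>\<mu>)"

lemma (in real_distribution) integrable_abs_power:
  assumes "integrable M (\<lambda>x. x ^ n)"
  shows "integrable M (\<lambda>x. \<bar>x\<bar> ^ n)"
  using integrable_abs[OF assms] by (simp add: power_abs)

lemma (in real_distribution) integrable_char_deriv:
  assumes "integrable M (\<lambda>x. x ^ n)"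
  shows "integrable M (\<lambda>x. (\<i> * of_real x) ^ n * iexp (t * x))"
  by (rule Bochner_Integration.integrable_bound[OF integrable_abs_power[OF assms]])
     (auto simp: norm_mult norm_power)

lemma (in real_distribution) norm_char_deriv_le:
  assumes "integrable M (\<lambda>x. x ^ n)"
  shows "norm (char_deriv M n t) \<le> (\<integral>x. \<bar>x\<bar> ^ n \<partial>M)"
proof -
  have "norm (char_deriv M n t) \<le> (\<integral>x. norm ((\<i> * of_real x) ^ n * iexp (t * x)) \<partial>M)"
    unfolding char_deriv_def by (rule integral_norm_bound)
  then show ?thesis by (simp add: norm_mult norm_power)
qed

lemma (in real_distribution) char_deriv_taylor:
  assumes int: "\<And>k. integrable M (\<lambda>x. x ^ k)"
  shows "norm (char_deriv M n (t + h) - (\<Sum>j\<le>m. of_real (h ^ j / fact j) * char_deriv M (n + j) t))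
    \<le> \<bar>h\<bar> ^ Suc m / fact (Suc m) * (\<integral>x. \<bar>x\<bar> ^ (n + Suc m) \<partial>M)"
proof -
  let ?f = "\<lambda>x. (\<i> * of_real x) ^ n * iexp ((t + h) * x) -
    (\<Sum>j\<le>m. of_real (h ^ j / fact j) * ((\<i> * of_real x) ^ (n + j) * iexp (t * x)))"
  have eq: "char_deriv M n (t + h) - (\<Sum>j\<le>m. of_real (h ^ j / fact j) * char_deriv M (n + j) t) =
      (\<integral>x. ?f x \<partial>M)"
  proof -
    have "(\<integral>x. ?f x \<partial>M) = char_deriv M n (t + h) -
        (\<integral>x. (\<Sum>j\<le>m. of_real (h ^ j / fact j) * ((\<i> * of_real x) ^ (n + j) * iexp (t * x))) \<partial>M)"
      unfolding char_deriv_def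
      by (intro Bochner_Integration.integral_diff integrable_char_deriv int
          Bochner_Integration.integrable_sum integrable_mult_right)
    also have "(\<integral>x. (\<Sum>j\<le>m. of_real (h ^ j / fact j) * ((\<i> * of_real x) ^ (n +
        j) * iexp (t * x))) \<partial>M) =
        (\<Sum>j\<le>m. of_real (h ^ j / fact j) * char_deriv M (n + j) t)"
      unfolding char_deriv_def integral_mult_right_zero[symmetric]
      by (intro Bochner_Integration.integral_sum integrable_char_deriv int integrable_mult_right)
    finally show ?thesis by simp
  qed
  have "norm (\<integral>x. ?f x \<partial>M) \<le> (\<integral>x. norm (?f x) \<partial>M)" by (rule integral_norm_bound)
  also have "\<dots> \<le> (\<integral>x. \<bar>h\<bar> ^ Suc m / fact (Suc m) * \<bar>x\<bar> ^ (n + Suc m) \<partial>M)"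
  proof (rule integral_mono)
    have "integrable M ?f"
    proof (rule Bochner_Integration.integrable_diff)
      show "integrable M (\<lambda>x. (\<i> * of_real x) ^ n * iexp ((t + h) * x))"
        by (rule integrable_char_deriv[OF int])
      show "integrable M (\<lambda>x. \<Sum>j\<le>m. of_real (h ^ j / fact j) * ((\<i> * of_real x) ^ (n + j) * iexp (t * x)))"
        by (rule Bochner_Integration.integrable_sum, rule integrable_mult_right, rule integrable_char_deriv[OF int])
    qed
    then show "integrable M (\<lambda>x. norm (?f x))" by (rule integrable_norm)
    show "integrable M (\<lambda>x. \<bar>h\<bar> ^ Suc m / fact (Suc m) * \<bar>x\<bar> ^ (n + Suc m))"
      by (rule integrable_mult_right[OF integrable_abs_power[OF int]])
    fix x
    have "?f x = (\<i> * of_real x) ^ n * iexp (t * x) * (iexp (h * x) - (\<Sum>j\<le>m. (\<i> * of_real (h * x)) ^ j / fact j))"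
    proof -
      have e: "iexp ((t + h) * x) = iexp (t * x) * iexp (h * x)"
        by (simp add: exp_add[symmetric] algebra_simps)
      have p: "of_real (h ^ j / fact j) * ((\<i> * of_real x) ^ (n + j) * iexp (t * x)) =
          (\<i> * of_real x) ^ n * iexp (t * x) * ((\<i> * of_real (h * x)) ^ j / fact j)" for j
        by (simp add: power_add power_mult_distrib)
      show ?thesis unfolding e p right_diff_distrib sum_distrib_left by (simp only: mult.assoc)
    qed
    then have "norm (?f x) = \<bar>x\<bar> ^ n * norm (iexp (h * x) - (\<Sum>j\<le>m. (\<i> * of_real (h * x)) ^ j / fact j))"
      by (simp add: norm_mult norm_power)
    also have "\<dots> \<le> \<bar>x\<bar> ^ n * (\<bar>h * x\<bar> ^ Suc m / fact (Suc m))"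
      by (intro mult_left_mono iexp_approx1) auto
    also have "\<dots> = \<bar>h\<bar> ^ Suc m / fact (Suc m) * \<bar>x\<bar> ^ (n + Suc m)"
      by (simp add: power_add abs_mult power_mult_distrib)
    finally show "norm (?f x) \<le> \<bar>h\<bar> ^ Suc m / fact (Suc m) * \<bar>x\<bar> ^ (n + Suc m)" .
  qed
  also have "\<dots> = \<bar>h\<bar> ^ Suc m / fact (Suc m) * (\<integral>x. \<bar>x\<bar> ^ (n + Suc m) \<partial>M)"
    by (rule integral_mult_right_zero)
  finally show ?thesis unfolding eq .
qed

lemma char_deriv_0:
  "char_deriv \<mu> n 0 = of_real (\<integral>x. x ^ n \<partial>\<mu>) * \<i> ^ n"
  unfolding char_deriv_def by (simp add: power_mult_distrib mult.commute flip: of_real_power)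

text \<open>The quotients of consecutive terms of a log-convex sequence increase, so up to index \<open>N + 1\<close> the
sequence grows at most geometrically with the last quotient.\<close>

lemma log_convex_ratio_power_bound:
  fixes M :: "nat \<Rightarrow> real"
  assumes pos: "\<And>n. M n > 0" and lc: "\<And>n. (M (Suc n))\<^sup>2 \<le> M n * M (Suc (Suc n))"
    and "n + j \<le> Suc N"
  shows "M (n + j) \<le> M n * (M (Suc N) / M N) ^ j"
proof -
  have r: "M (Suc n) / M n \<le> M (Suc (Suc n)) / M (Suc n)" for n
    using lc[of n] pos[of n] pos[of "Suc n"] by (simp add: field_simps power2_eq_square)
  have mono: "M (Suc a) / M a \<le> M (Suc b) / M b" if "a \<le> b" for a b
    using that by (rule lift_Suc_mono_le[of "\<lambda>n. M (Suc n) / M n", OF r])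
  show ?thesis using \<open>n + j \<le> Suc N\<close>
  proof (induction j)
    case (Suc j)
    have "M (n + Suc j) = M (n + j) * (M (Suc (n + j)) / M (n + j))"
      using pos[of "n + j"] by simp
    also have "\<dots> \<le> (M n * (M (Suc N) / M N) ^ j) * (M (Suc N) / M N)"
      using Suc pos by (intro mult_mono mono) (auto intro!: mult_nonneg_nonneg divide_nonneg_nonneg less_imp_le)
    finally show ?case by (simp add: algebra_simps)
  qed simp
qed

text \<open>The decisive estimate of Bang. Smallness is measured by the Bang norm
\<open>sup\<^sub>n \<bar>D\<^sub>n\<bar> / (e\<^sup>n M\<^sub>n)\<close>: orders \<open>n > N\<close> are under control for free because of the factor \<open>e\<^sup>n\<close>,
and for the orders \<open>n \<le> N\<close> Taylor's formula is stopped at order \<open>N + 1\<close>. With the geometric bound on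
\<open>M\<close> the Taylor sum becomes a partial sum of an exponential series. A step of length
\<open>M\<^sub>N / (e M\<^bsub>N+1\<^esub>)\<close> therefore costs only one factor \<open>e\<close>.\<close>

lemma bang_step:
  fixes D :: "nat \<Rightarrow> real \<Rightarrow> complex" and M :: "nat \<Rightarrow> real"
  assumes pos: "\<And>n. M n > 0" and lc: "\<And>n. (M (Suc n))\<^sup>2 \<le> M n * M (Suc (Suc n))"
    and bnd: "\<And>n t. norm (D n t) \<le> M n"
    and taylor: "\<And>n m t h. norm (D n (t + h) - (\<Sum>j\<le>m. of_real (h ^ j / fact j) * D (n + j) t))
        \<le> \<bar>h\<bar> ^ Suc m / fact (Suc m) * M (n + Suc m)"
    and small: "\<And>n. norm (D n t) \<le> exp (real n - real (Suc N)) * M n"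
    and h: "\<bar>h\<bar> \<le> M N / (exp 1 * M (Suc N))"
  shows "norm (D n (t + h)) \<le> exp (real n - real N) * M n"
proof (cases "n \<le> N")
  case False
  have "norm (D n (t + h)) \<le> 1 * M n" using bnd by simp
  also have "\<dots> \<le> exp (real n - real N) * M n"
    using False pos[of n] by (intro mult_right_mono) auto
  finally show ?thesis .
next
  case True
  \<comment> \<open>The Taylor polynomial is cut so that the remainder involves exactly \<open>D\<close> of order \<open>N + 1\<close>.\<close>
  define r where "r = M (Suc N) / M N"
  define m where "m = N - n"
  have m: "n + Suc m = Suc N" using True by (simp add: m_def)
  have r: "r > 0" using pos by (simp add: r_def)
  have hr: "exp 1 * \<bar>h\<bar> * r \<le> 1" using h pos[of N] pos[of "Suc N"] by (simp add: r_def field_simps)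
  have step: "\<bar>h\<bar> ^ j / fact j * (exp (real (n + j) - real (Suc N)) * M (n + j))
      \<le> exp (real n - real (Suc N)) * M n * ((exp 1 * \<bar>h\<bar> * r) ^ j / fact j)" if "j \<le> Suc m" for j
  proof -
    have "M (n + j) \<le> M n * r ^ j" unfolding r_def
      by (rule log_convex_ratio_power_bound[where M=M, OF pos lc]) (use that m in auto)
    then have "\<bar>h\<bar> ^ j / fact j * (exp (real (n + j) - real (Suc N)) * M (n + j))
      \<le> \<bar>h\<bar> ^ j / fact j * (exp (real (n + j) - real (Suc N)) * (M n * r ^ j))"
      by (intro mult_left_mono) auto
    also have "\<dots> = exp (real n - real (Suc N)) * M n * ((exp 1 * \<bar>h\<bar> * r) ^ j / fact j)"
    proof -
      have e: "exp (real (n + j) - real (Suc N)) = exp (real n - real (Suc N)) * exp 1 ^ j"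
        by (simp add: exp_of_nat_mult[symmetric] exp_add[symmetric] algebra_simps)
      show ?thesis unfolding e by (simp only: power_mult_distrib mult_ac times_divide_eq_left times_divide_eq_right)
    qed
    finally show ?thesis .
  qed
  have "norm (D n (t + h)) \<le> norm (\<Sum>j\<le>m. of_real (h ^ j / fact j) * D (n + j) t)
      + \<bar>h\<bar> ^ Suc m / fact (Suc m) * M (n + Suc m)"
    using taylor[of n t h m] norm_triangle_sub[of "D n (t + h)" "\<Sum>j\<le>m. of_real (h ^ j / fact j) * D (n + j) t"]
    by linarith
  also have "\<dots> \<le> (\<Sum>j\<le>m. \<bar>h\<bar> ^ j / fact j * (exp (real (n + j) - real (Suc N)) * M (n + j)))
      + \<bar>h\<bar> ^ Suc m / fact (Suc m) * (exp (real (n + Suc m) - real (Suc N)) * M (n + Suc m))"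
  proof (intro add_mono sum_norm_le)
    fix j
    show "norm (of_real (h ^ j / fact j) * D (n + j) t) \<le>
        \<bar>h\<bar> ^ j / fact j * (exp (real (n + j) - real (Suc N)) * M (n + j))"
      unfolding norm_mult norm_of_real using small[of "n + j"]
      by (simp only: abs_divide power_abs fact_ge_zero abs_of_nonneg) (intro mult_left_mono, auto)
  next
    have "real (n + Suc m) - real (Suc N) = 0" unfolding m by simp
    then show "\<bar>h\<bar> ^ Suc m / fact (Suc m) * M (n + Suc m) \<le>
        \<bar>h\<bar> ^ Suc m / fact (Suc m) * (exp (real (n + Suc m) - real (Suc N)) * M (n + Suc m))"
      by (simp only: exp_zero mult_1 order_refl)
  qed
  also have "\<dots> = (\<Sum>j\<le>Suc m. \<bar>h\<bar> ^ j / fact j * (exp (real (n + j) - real (Suc N)) * M (n + j)))"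
    by (simp only: sum.atMost_Suc)
  also have "\<dots> \<le> (\<Sum>j\<le>Suc m. exp (real n - real (Suc N)) * M n * ((exp 1 * \<bar>h\<bar> * r) ^ j / fact j))"
    by (intro sum_mono step) auto
  also have "\<dots> = exp (real n - real (Suc N)) * M n * (\<Sum>j\<le>Suc m. (exp 1 * \<bar>h\<bar> * r) ^ j / fact j)"
    by (simp only: sum_distrib_left)
  also have "\<dots> \<le> exp (real n - real (Suc N)) * M n * exp 1"
  proof (intro mult_left_mono)
    have "(\<Sum>j\<in>{..Suc m}. (exp 1 * \<bar>h\<bar> * r) ^ j /\<^sub>R fact j) \<le> exp (exp 1 * \<bar>h\<bar> * r)"
      using exp_converges[of "exp 1 * \<bar>h\<bar> * r"] r
        sum_le_suminf[of "\<lambda>j. (exp 1 * \<bar>h\<bar> * r) ^ j /\<^sub>R fact j" "{..Suc m}"]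
      by (auto simp: sums_iff simp del: sum.atMost_Suc)
    also have "\<dots> \<le> exp 1" using hr by simp
    finally show "(\<Sum>j\<le>Suc m. (exp 1 * \<bar>h\<bar> * r) ^ j / fact j) \<le> exp 1"
      by (simp add: divide_inverse mult.commute del: sum.atMost_Suc)
  qed (use pos[of n] in auto)
  also have "\<dots> = exp (real n - real N) * M n"
  proof -
    have "exp (real n - real N) = exp (real n - real (Suc N)) * exp 1" by (simp add: exp_add[symmetric])
    then show ?thesis by simp
  qed
  finally show ?thesis .
qed

text \<open>Starting at \<open>0\<close> with Bang norm at most \<open>e\<^bsup>-(K + d)\<^esup>\<close> and losing a factor \<open>e\<close> in each of \<open>d\<close>
steps leaves \<open>e\<^bsup>-K\<^esup>\<close>. As the step lengths have a divergent sum, every point is reached with an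
arbitrarily large \<open>K\<close>.\<close>

lemma bang_vanishing:
  fixes D :: "nat \<Rightarrow> real \<Rightarrow> complex" and M :: "nat \<Rightarrow> real"
  assumes pos: "\<And>n. M n > 0" and lc: "\<And>n. (M (Suc n))\<^sup>2 \<le> M n * M (Suc (Suc n))"
    and bnd: "\<And>n t. norm (D n t) \<le> M n"
    and taylor: "\<And>n m t h. norm (D n (t + h) - (\<Sum>j\<le>m. of_real (h ^ j / fact j) * D (n + j) t))
        \<le> \<bar>h\<bar> ^ Suc m / fact (Suc m) * M (n + Suc m)"
    and zero: "\<And>n. D n 0 = 0"
    and div: "\<not> summable (\<lambda>n. M n / M (Suc n))"
  shows "D 0 t = 0"
proof -
  define w where "w n = M n / (exp 1 * M (Suc n))" for n
  have w0: "w n \<ge> 0" for n using pos by (simp add: w_def less_imp_le)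
  have iter: "norm (D n t) \<le> exp (real n - real K) * M n"
    if "\<bar>t\<bar> \<le> (\<Sum>i\<in>{K..<K + d}. w i)" for K d n t
    using that
  proof (induction d arbitrary: K t n)
    case 0 then show ?case using zero pos[of n] by simp
  next
    case (Suc d)
    let ?S = "\<Sum>i\<in>{Suc K..<Suc K + d}. w i"
    have S0: "?S \<ge> 0" by (intro sum_nonneg w0)
    have eq: "(\<Sum>i\<in>{K..<K + Suc d}. w i) = w K + ?S"
      by (subst sum.atLeast_Suc_lessThan) auto
    \<comment> \<open>The point within reach of the remaining steps that is closest to \<open>t\<close>.\<close>
    define s where "s = max (- ?S) (min ?S t)"
    have "\<bar>s\<bar> \<le> ?S" using S0 by (auto simp: s_def)
    then have sm: "norm (D n s) \<le> exp (real n - real (Suc K)) * M n" for n by (rule Suc.IH)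
    have "\<bar>t - s\<bar> \<le> w K" using Suc.prems S0 w0[of K] unfolding eq by (auto simp: s_def)
    then have "norm (D n (s + (t - s))) \<le> exp (real n - real K) * M n"
      unfolding w_def by (intro bang_step[OF pos lc bnd taylor sm])
    then show ?case by simp
  qed
  have nsw: "\<not> summable w"
  proof
    assume "summable w"
    then have "summable (\<lambda>n. exp 1 * w n)" by (rule summable_mult)
    then show False using div by (simp add: w_def)
  qed
  have "norm (D 0 t) \<le> exp (- real K) * M 0" for K
  proof -
    have "\<exists>d. \<bar>t\<bar> \<le> (\<Sum>i\<in>{K..<K + d}. w i)"
    proof (rule ccontr)
      assume *: "\<not> ?thesis"
      have "(\<Sum>i<d. w (i + K)) \<le> \<bar>t\<bar>" for d
      proof -
        have "(\<Sum>i<d. w (i + K)) = (\<Sum>i\<in>{K..<K + d}. w i)"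
          using sum.shift_bounds_nat_ivl[of w 0 K d] by (simp add: atLeast0LessThan add.commute)
        with * show ?thesis by (simp add: not_le less_imp_le)
      qed
      then have "summable (\<lambda>i. w (i + K))" by (intro summableI_nonneg_bounded w0)
      then show False using nsw by (simp add: summable_iff_shift)
    qed
    then show ?thesis using iter[of t K _ 0] by auto
  qed
  moreover have "(\<lambda>K. exp (- real K) * M 0) \<longlonglongrightarrow> 0 * M 0"
    by (intro tendsto_mult tendsto_const filterlim_compose[OF exp_at_bot])
       (auto simp: filterlim_uminus_at_bot filterlim_real_sequentially)
  ultimately have "norm (D 0 t) \<le> 0 * M 0"
    by (intro tendsto_lowerbound[of "\<lambda>K. exp (- real K) * M 0"]) auto
  then show ?thesis by simp
qed

section \<open>Determinacy of the moment problem under Carleman's condition\<close>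

lemma (in real_distribution) second_moment_0_imp_integral_at_0:
  fixes f :: "real \<Rightarrow> 'b::{banach, second_countable_topology}"
  assumes "integrable M (\<lambda>x. x\<^sup>2)" "(\<integral>x. x\<^sup>2 \<partial>M) = 0"
    and f: "f \<in> borel_measurable borel"
  shows "(\<integral>x. f x \<partial>M) = f 0"
proof -
  have "AE x in M. x\<^sup>2 = 0"
    using assms by (subst integral_nonneg_eq_0_iff_AE[symmetric]) auto
  then have "AE x in M. f x = f 0" by eventually_elim auto
  then have "(\<integral>x. f x \<partial>M) = (\<integral>x. f 0 \<partial>M)" using f by (intro integral_cong_AE) auto
  then show ?thesis using prob_space by simp
qed

lemma (in real_distribution) abs_moment_pos:
  assumes int: "\<And>k. integrable M (\<lambda>x. x ^ k)" and nz: "(\<integral>x. x\<^sup>2 \<partial>M) \<noteq> 0"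
  shows "0 < (\<integral>x. \<bar>x\<bar> ^ n \<partial>M)"
proof (rule ccontr)
  assume "\<not> ?thesis"
  moreover have "0 \<le> (\<integral>x. \<bar>x\<bar> ^ n \<partial>M)" by (rule integral_nonneg_AE) auto
  ultimately have "(\<integral>x. \<bar>x\<bar> ^ n \<partial>M) = 0" by simp
  then have "AE x in M. \<bar>x\<bar> ^ n = 0"
    using integrable_abs_power[OF int] by (subst integral_nonneg_eq_0_iff_AE[symmetric]) auto
  then have "AE x in M. x\<^sup>2 = 0" by eventually_elim auto
  then have "(\<integral>x. x\<^sup>2 \<partial>M) = (\<integral>x. 0 \<partial>M)" by (intro integral_cong_AE) auto
  then show False using nz by simp
qed

text \<open>The Cauchy-Schwarz inequality for absolute moments, as a quadratic form in \<open>s\<close>. In this form it is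
additive in the measure, so that the sum of the absolute moments of two measures is again
log-convex.\<close>

lemma (in real_distribution) abs_moment_quadratic:
  assumes int: "\<And>k. integrable M (\<lambda>x. x ^ k)"
  shows "0 \<le> s\<^sup>2 * (\<integral>x. \<bar>x\<bar> ^ n \<partial>M) - 2 * s * (\<integral>x. \<bar>x\<bar> ^ Suc n \<partial>M) + (\<integral>x. \<bar>x\<bar> ^ Suc (Suc n) \<partial>M)"
proof -
  note [intro] = integrable_abs_power[OF int]
  have "0 \<le> (\<integral>x. \<bar>x\<bar> ^ n * ((s - \<bar>x\<bar>) * (s - \<bar>x\<bar>)) \<partial>M)"
      by (rule integral_nonneg_AE) auto
  also have "\<dots> = (\<integral>x. s\<^sup>2 * \<bar>x\<bar> ^ n - 2 * s * \<bar>x\<bar> ^ Suc n +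
      \<bar>x\<bar> ^ Suc (Suc n) \<partial>M)"
    by (intro Bochner_Integration.integral_cong) (simp_all add: power2_eq_square algebra_simps del: abs_mult_self_eq)
  also have "\<dots> = s\<^sup>2 * (\<integral>x. \<bar>x\<bar> ^ n \<partial>M) - 2 * s * (\<integral>x. \<bar>x\<bar> ^ Suc n \<partial>M) + (\<integral>x. \<bar>x\<bar> ^ Suc (Suc n) \<partial>M)"
    using integrable_abs_power[OF int, of n] integrable_abs_power[OF int, of "Suc n"]
      integrable_abs_power[OF int, of "Suc (Suc n)"] by simp
  finally show ?thesis .
qed

abbreviation carleman_terms :: "(nat \<Rightarrow> real) \<Rightarrow> nat \<Rightarrow> real" where
  "carleman_terms \<beta> k \<equiv> 1 / \<beta> (2 * Suc k) powr (1 / real (2 * Suc k))"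

text \<open>Bang's argument is applied with \<open>M\<^sub>n\<close> the sum of the \<open>n\<close>-th absolute moments of the two
measures, whose even terms are twice the common moments. The product of the quotients
\<open>M\<^sub>i / M\<^bsub>i+1\<^esub>\<close> telescopes, so if their sum converged, Carleman's inequality would
contradict the hypothesis. Measures with vanishing second moment are point masses at \<open>0\<close>.\<close>

theorem carleman_determinacy:
  assumes \<mu>: "real_distribution \<mu>" and \<nu>: "real_distribution \<nu>"
    and int\<mu>: "\<And>k. integrable \<mu> (\<lambda>x. x ^ k)" and int\<nu>: "\<And>k. integrable \<nu> (\<lambda>x. x ^ k)"
    and eq: "\<And>k. (\<integral>x. x ^ k \<partial>\<mu>) = (\<integral>x. x ^ k \<partial>\<nu>)"
    and carl: "(\<integral>x. x\<^sup>2 \<partial>\<mu>) \<noteq> 0 \<Longrightarrow>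
      \<not> summable (carleman_terms (\<lambda>n. \<integral>x. x ^ n \<partial>\<mu>))"
  shows "\<mu> = \<nu>"
proof (rule Levy_uniqueness[OF \<mu> \<nu>], rule ext)
  fix t
  interpret mu: real_distribution \<mu> by fact
  interpret nu: real_distribution \<nu> by fact
  show "char \<mu> t = char \<nu> t"
  proof (cases "(\<integral>x. x\<^sup>2 \<partial>\<mu>) = 0")
    case True
    then have "char \<mu> t = 1" "char \<nu> t = 1"
      unfolding char_def using int\<mu>[of 2] int\<nu>[of 2] eq[of 2]
      by (subst mu.second_moment_0_imp_integral_at_0, simp_all, subst nu.second_moment_0_imp_integral_at_0, simp_all)
    then show ?thesis by simp
  next
    case False
    define M where "M n = (\<integral>x. \<bar>x\<bar> ^ n \<partial>\<mu>) +
        (\<integral>x. \<bar>x\<bar> ^ n \<partial>\<nu>)" for n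
    define D where "D n t = char_deriv \<mu> n t - char_deriv \<nu> n t" for n t
    have pos: "M n > 0" for n
      unfolding M_def using mu.abs_moment_pos[OF int\<mu>] nu.abs_moment_pos[OF int\<nu>] False eq[of 2]
      by (intro add_pos_pos) auto
    have quad: "0 \<le> s\<^sup>2 * M n - 2 * s * M (Suc n) + M (Suc (Suc n))" for s n
      unfolding M_def
      using mu.abs_moment_quadratic[OF int\<mu>, of s n] nu.abs_moment_quadratic[OF int\<nu>, of s n]
      by (simp add: algebra_simps)
    have lc: "(M (Suc n))\<^sup>2 \<le> M n * M (Suc (Suc n))" for n
    proof -
      have "0 \<le> M n * ((M (Suc n) / M n)\<^sup>2 * M n - 2 * (M (Suc n) / M n) * M (Suc n) + M (Suc (Suc n)))"
        by (rule mult_nonneg_nonneg[OF less_imp_le[OF pos] quad])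
      also have "\<dots> = M n * M (Suc (Suc n)) - (M (Suc n))\<^sup>2"
        using pos[of n] by (simp add: field_simps power2_eq_square)
      finally show ?thesis by simp
    qed
    have bnd: "norm (D n t) \<le> M n" for n t
      unfolding D_def M_def
      using mu.norm_char_deriv_le[OF int\<mu>, of n t] nu.norm_char_deriv_le[OF int\<nu>, of n t]
        norm_triangle_ineq4[of "char_deriv \<mu> n t" "char_deriv \<nu> n t"] by linarith
    have taylor: "norm (D n (t + h) - (\<Sum>j\<le>m. of_real (h ^ j / fact j) * D (n + j) t))
        \<le> \<bar>h\<bar> ^ Suc m / fact (Suc m) * M (n + Suc m)" for n m t h
    proof -
      let ?T = "\<lambda>\<mu>. char_deriv \<mu> n (t + h) - (\<Sum>j\<le>m. of_real (h ^ j / fact j) * char_deriv \<mu> (n +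
          j) t)"
      have "D n (t + h) - (\<Sum>j\<le>m. of_real (h ^ j / fact j) * D (n + j) t) = ?T \<mu> - ?T \<nu>"
        unfolding D_def by (simp only: right_diff_distrib sum_subtractf algebra_simps)
      then have "norm (D n (t + h) - (\<Sum>j\<le>m. of_real (h ^ j / fact j) * D (n + j) t)) \<le>
          norm (?T \<mu>) + norm (?T \<nu>)"
        by (simp only: norm_triangle_ineq4)
      also have "\<dots> \<le> \<bar>h\<bar> ^ Suc m / fact (Suc m) * M (n + Suc m)"
        unfolding M_def distrib_left
        by (intro add_mono mu.char_deriv_taylor[OF int\<mu>] nu.char_deriv_taylor[OF int\<nu>])
      finally show ?thesis .
    qed
    have zero: "D n 0 = 0" for n by (simp add: D_def char_deriv_0 eq)
    have div: "\<not> summable (\<lambda>n. M n / M (Suc n))"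
    proof
      assume sm: "summable (\<lambda>n. M n / M (Suc n))"
      have prod: "(\<Prod>i<n. M i / M (Suc i)) = M 0 / M n" for n
        using less_imp_neq[OF pos, symmetric] by (induction n) auto
      have "summable (\<lambda>k. (\<Prod>i<Suc k. M i / M (Suc i)) powr (1 / real (Suc k)))"
        by (rule carleman_inequality_summable[OF _ sm]) (simp add: pos)
      then have "summable ((\<lambda>k. (\<Prod>i<Suc k. M i / M (Suc i)) powr (1 / real (Suc k))) \<circ> (\<lambda>j. 2 * j + 1))"
        by (intro summable_reindex) (auto simp: inj_def)
      moreover have "(\<Prod>i<Suc (2 * j + 1). M i / M (Suc i)) powr (1 / real (Suc (2 * j + 1))) =
          1 / (\<integral>x. x ^ (2 * Suc j) \<partial>\<mu>) powr (1 / real (2 * Suc j))" for j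
      proof -
        have S: "Suc (2 * j + 1) = 2 * Suc j" by simp
        have "M (2 * Suc j) = 2 * (\<integral>x. x ^ (2 * Suc j) \<partial>\<mu>)"
        proof -
          have ab: "\<bar>x\<bar> ^ (2 * Suc j) = x ^ (2 * Suc j)" for x :: real by (rule power_even_abs) simp
          show ?thesis unfolding M_def ab using eq[of "2 * Suc j"] by linarith
        qed
        moreover have "M 0 = 2" using mu.prob_space nu.prob_space by (simp add: M_def)
        moreover have "(\<integral>x. x ^ (2 * Suc j) \<partial>\<mu>) \<ge> 0"
          by (intro integral_nonneg_AE AE_I2 zero_le_even_power) simp
        ultimately show ?thesis unfolding S prod
          by (simp add: powr_divide del: mult_Suc_right of_nat_mult of_nat_Suc)
      qed
      ultimately show False using carl[OF False] by (simp only: comp_def)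
    qed
    have "D 0 t = 0" by (rule bang_vanishing[where M=M, OF pos lc bnd taylor zero div])
    then show ?thesis by (simp add: D_def char_deriv_def char_def)
  qed
qed

section \<open>The method of moments\<close>

text \<open>Trading powers for smallness: outside the clipping range a power is bounded by a higher even power
divided by \<open>R\<close>. This is how bounded moments give uniform integrability.\<close>

lemma clip_power_error:
  fixes x R :: real
  assumes R: "R \<ge> 1"
  shows "\<bar>x ^ k - (max (- R) (min R x)) ^ k\<bar> \<le> 2 * x ^ (2 * (k + 1)) / R"
proof (cases "\<bar>x\<bar> \<le> R")
  case True
  then have "max (- R) (min R x) = x" by auto
  moreover have "0 \<le> x ^ (2 * (k + 1))" by (rule zero_le_even_power) simp
  ultimately show ?thesis using R by (simp only: diff_self abs_zero) (intro divide_nonneg_nonneg, auto)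
next
  case False
  let ?c = "max (- R) (min R x)"
  have c: "\<bar>?c\<bar> \<le> \<bar>x\<bar>" using False R by auto
  have "\<bar>x ^ k - ?c ^ k\<bar> \<le> \<bar>x\<bar> ^ k + \<bar>?c\<bar> ^ k"
      by (simp add: power_abs[symmetric] abs_triangle_ineq4)
  also have "\<dots> \<le> 2 * \<bar>x\<bar> ^ k" using power_mono[OF c, of k] by simp
  also have "\<dots> \<le> 2 * (\<bar>x\<bar> ^ (2 * (k + 1)) / R)"
  proof -
    have "\<bar>x\<bar> ^ k * R \<le> \<bar>x\<bar> ^ k * \<bar>x\<bar>" using False by (intro mult_left_mono) auto
    also have "\<dots> = \<bar>x\<bar> ^ (k + 1)" by simp
    also have "\<dots> \<le> \<bar>x\<bar> ^ (2 * (k + 1))" using False R by (intro power_increasing) auto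
    finally show ?thesis using R by (simp add: field_simps)
  qed
  finally show ?thesis by (simp add: power_even_abs)
qed

lemma moments_tight:
  fixes \<mu> :: "nat \<Rightarrow> real measure"
  assumes rd: "\<And>n. real_distribution (\<mu> n)"
    and int: "\<And>n. integrable (\<mu> n) (\<lambda>x. x\<^sup>2)"
    and bd: "Bseq (\<lambda>n. \<integral>x. x\<^sup>2 \<partial>\<mu> n)"
  shows "tight \<mu>"
  unfolding tight_def
proof (intro conjI allI impI rd)
  fix \<epsilon> :: real assume e: "\<epsilon> > 0"
  obtain B where B: "B > 0" "\<And>n. \<bar>\<integral>x. x\<^sup>2 \<partial>\<mu> n\<bar> \<le>
      B" using bd by (auto simp: Bseq_def)
  define a where "a = sqrt (2 * B / \<epsilon>)"
  have a: "a > 0" "a\<^sup>2 = 2 * B / \<epsilon>" using B e by (auto simp: a_def)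
  have "1 - \<epsilon> < measure (\<mu> n) {-a<..a}" for n
  proof -
    interpret real_distribution "\<mu> n" by (rule rd)
    have "measure (\<mu> n) {x \<in> space (\<mu> n). a \<le> \<bar>x\<bar>} \<le>
        (\<integral>x. x\<^sup>2 \<partial>\<mu> n) / a\<^sup>2"
      by (rule second_moment_method) (auto simp: int a)
    also have "\<dots> \<le> B / a\<^sup>2" using B(2)[of n] by (intro divide_right_mono) auto
    also have "\<dots> = \<epsilon> / 2" using a B e by simp
    finally have *: "measure (\<mu> n) {x \<in> space (\<mu> n). a \<le> \<bar>x\<bar>} \<le> \<epsilon> / 2" .
    have "1 = measure (\<mu> n) UNIV" using prob_space by simp
    also have "\<dots> \<le> measure (\<mu> n) ({-a<..a} \<union> {x \<in> space (\<mu> n). a \<le> \<bar>x\<bar>})"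
      by (rule finite_measure_mono) auto
    also have "\<dots> \<le> measure (\<mu> n) {-a<..a} + measure (\<mu> n) {x \<in> space (\<mu> n). a \<le> \<bar>x\<bar>}"
      by (rule measure_Un_le) auto
    finally show ?thesis using * e by linarith
  qed
  then show "\<exists>a b. a < b \<and> (\<forall>n. 1 - \<epsilon> < measure (\<mu> n) {a<..b})"
    using a by (intro exI[of _ "-a"] exI[of _ a]) auto
qed

text \<open>Clipped powers are bounded and continuous, so their integrals converge; the clipping error is of order
\<open>1 / R\<close> uniformly in \<open>n\<close>. The even powers come first, by monotone convergence, since the clipping
error of the limit measure is measured by one of its even moments.\<close>

lemma weak_limit_moments:
  fixes \<mu> :: "nat \<Rightarrow> real measure"
  assumes rd: "\<And>n. real_distribution (\<mu> n)" and rd': "real_distribution \<nu>"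
    and int: "\<And>n k. integrable (\<mu> n) (\<lambda>x. x ^ k)"
    and conv: "\<And>k. (\<lambda>n. \<integral>x. x ^ k \<partial>\<mu> n) \<longlonglongrightarrow> \<beta> k"
    and wc: "weak_conv_m \<mu> \<nu>"
  shows "integrable \<nu> (\<lambda>x. x ^ k)" and "(\<integral>x. x ^ k \<partial>\<nu>) = \<beta> k"
proof -
  interpret nu: real_distribution \<nu> by fact
  interpret mu: real_distribution "\<mu> n" for n by fact
  note lim = weak_conv_imp_integral_bdd_continuous_conv[OF rd rd' wc]
  have even: "integrable \<nu> (\<lambda>x. x ^ (2 * k)) \<and> (\<integral>x. x ^ (2 * k) \<partial>\<nu>) \<le>
      \<beta> (2 * k)" for k
  proof -
    let ?f = "\<lambda>R x. min (x ^ (2 * k)) (real R)"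
    have bnd: "norm (?f R x) \<le> real R" for R x by auto
    have fint: "integrable \<nu> (?f R)" for R
      by (rule nu.integrable_const_bound[of _ "real R"]) auto
    have up: "(\<integral>x. ?f R x \<partial>\<nu>) \<le> \<beta> (2 * k)" for R
    proof (rule LIMSEQ_le)
      show "(\<lambda>n. \<integral>x. ?f R x \<partial>\<mu> n) \<longlonglongrightarrow>
          (\<integral>x. ?f R x \<partial>\<nu>)"
        by (rule lim[of _ "real R"]) (auto intro!: continuous_intros)
      show "(\<lambda>n. \<integral>x. x ^ (2 * k) \<partial>\<mu> n) \<longlonglongrightarrow> \<beta> (2 * k)" by (rule conv)
      show "\<exists>N. \<forall>n\<ge>N. (\<integral>x. ?f R x \<partial>\<mu> n) \<le>
          (\<integral>x. x ^ (2 * k) \<partial>\<mu> n)"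
        by (intro exI allI impI integral_mono int mu.integrable_const_bound[of _ "real R"]) auto
    qed
    have inc: "incseq (\<lambda>R. \<integral>x. ?f R x \<partial>\<nu>)"
      unfolding incseq_def by (auto intro!: integral_mono fint)
    then obtain L where L: "(\<lambda>R. \<integral>x. ?f R x \<partial>\<nu>) \<longlonglongrightarrow> L"
      using incseq_convergent[OF inc, of "\<beta> (2 * k)"] up by blast
    have ptw: "(\<lambda>R. ?f R x) \<longlonglongrightarrow> x ^ (2 * k)" for x
    proof (rule tendsto_eventually)
      obtain N :: nat where "x ^ (2 * k) \<le> real N" using real_arch_simple by blast
      then show "\<forall>\<^sub>F R in sequentially. ?f R x = x ^ (2 * k)"
        by (intro eventually_sequentiallyI[of N]) auto
    qed
    have m: "AE x in \<nu>. mono (\<lambda>R. ?f R x)" by (auto simp: mono_def)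
    have "integrable \<nu> (\<lambda>x. x ^ (2 * k))"
      by (rule integrable_monotone_convergence[OF fint m _ L]) (auto intro: ptw)
    moreover have "(\<integral>x. x ^ (2 * k) \<partial>\<nu>) = L"
      by (rule integral_monotone_convergence[OF fint m _ L]) (auto intro: ptw)
    moreover have "L \<le> \<beta> (2 * k)" by (rule LIMSEQ_le_const2[OF L]) (auto intro: up)
    ultimately show ?thesis by simp
  qed
  have intk: "integrable \<nu> (\<lambda>x. x ^ k)" for k
  proof (rule Bochner_Integration.integrable_bound)
    show "integrable \<nu> (\<lambda>x. 1 + x ^ (2 * k))" using even by simp
    have "\<bar>x\<bar> ^ k \<le> 1 + x ^ (2 * k)" for x :: real
    proof -
      have "x ^ (2 * k) = (\<bar>x\<bar> ^ k)\<^sup>2"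
        by (metis power_even_abs even_mult_iff even_numeral power_mult mult.commute)
      moreover have "0 \<le> (\<bar>x\<bar> ^ k - 1)\<^sup>2" "0 \<le> \<bar>x\<bar> ^ k" by simp_all
      ultimately show ?thesis unfolding power2_diff one_power2 mult_1_right by linarith
    qed
    then show "AE x in \<nu>. norm (x ^ k) \<le> norm (1 + x ^ (2 * k))" by (auto simp: power_abs)
  qed auto
  then show "integrable \<nu> (\<lambda>x. x ^ k)" .
  let ?K = "2 * (k + 1)"
  let ?g = "\<lambda>R x. (max (- real R) (min (real R) x)) ^ k"
  have gbd: "norm (?g R x) \<le> real R ^ k" for R x
    by (auto simp: power_abs intro!: power_mono)
  have close: "\<bar>(\<integral>x. x ^ k \<partial>\<rho>) - (\<integral>x. ?g R x \<partial>\<rho>)\<bar> \<le>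
      2 * (\<integral>x. x ^ ?K \<partial>\<rho>) / real R"
    if "real_distribution \<rho>" and i: "\<And>k. integrable \<rho> (\<lambda>x. x ^ k)" and "R \<ge> 1" for \<rho>
    and R :: nat
  proof -
    interpret rho: real_distribution \<rho> by fact
    have gi: "integrable \<rho> (?g R)"
      by (rule rho.integrable_const_bound[of _ "real R ^ k"]) (use gbd in auto)
    have "(\<integral>x. x ^ k \<partial>\<rho>) - (\<integral>x. ?g R x \<partial>\<rho>) =
        (\<integral>x. x ^ k - ?g R x \<partial>\<rho>)"
      using i gi by simp
    also have "\<bar>\<dots>\<bar> \<le> (\<integral>x. \<bar>x ^ k - ?g R x\<bar> \<partial>\<rho>)"
        by (rule integral_abs_bound)
    also have "\<dots> \<le> (\<integral>x. 2 * x ^ ?K / real R \<partial>\<rho>)"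
      using i[of ?K] i gi \<open>R \<ge> 1\<close> by (intro integral_mono clip_power_error) auto
    also have "\<dots> = 2 * (\<integral>x. x ^ ?K \<partial>\<rho>) / real R" by simp
    finally show ?thesis .
  qed
  have main: "\<bar>\<beta> k - (\<integral>x. x ^ k \<partial>\<nu>)\<bar> \<le>
      4 * \<beta> ?K / real R" if R: "R \<ge> 1" for R
  proof -
    have "\<bar>\<beta> k - (\<integral>x. ?g R x \<partial>\<nu>)\<bar> \<le> 2 * \<beta> ?K / real R"
    proof (rule LIMSEQ_le)
      show "(\<lambda>n. \<bar>(\<integral>x. x ^ k \<partial>\<mu> n) - (\<integral>x. ?g R x \<partial>\<mu> n)\<bar>) \<longlonglongrightarrow> \<bar>\<beta> k - (\<integral>x. ?g R x \<partial>\<nu>)\<bar>"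
        by (intro tendsto_intros conv lim[of _ "real R ^ k"]) (use gbd in \<open>auto intro!: continuous_intros\<close>)
      show "(\<lambda>n. 2 * (\<integral>x. x ^ ?K \<partial>\<mu> n) / real R) \<longlonglongrightarrow>
          2 * \<beta> ?K / real R"
        using R by (intro tendsto_intros conv) auto
      show "\<exists>N. \<forall>n\<ge>N. \<bar>(\<integral>x. x ^ k \<partial>\<mu> n) - (\<integral>x. ?g R x \<partial>\<mu> n)\<bar> \<le> 2 * (\<integral>x. x ^ ?K \<partial>\<mu> n) / real R"
        using close[OF rd int R] by blast
    qed
    moreover have "\<bar>(\<integral>x. x ^ k \<partial>\<nu>) - (\<integral>x. ?g R x \<partial>\<nu>)\<bar> \<le>
        2 * \<beta> ?K / real R"
    proof -
      have "2 * (\<integral>x. x ^ ?K \<partial>\<nu>) / real R \<le> 2 * \<beta> ?K / real R"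
        using even[of "k + 1"] by (intro divide_right_mono) auto
      then show ?thesis using close[OF rd' intk R] by linarith
    qed
    ultimately show ?thesis by (simp add: add_divide_distrib[symmetric] abs_if field_simps split: if_splits)
  qed
  have "(\<lambda>R. 4 * \<beta> ?K / real R) \<longlonglongrightarrow> 0" by (rule lim_const_over_n)
  then have "\<bar>\<beta> k - (\<integral>x. x ^ k \<partial>\<nu>)\<bar> \<le> 0"
    by (rule LIMSEQ_le_const) (use main in blast)
  then show "(\<integral>x. x ^ k \<partial>\<nu>) = \<beta> k" by simp
qed

lemma moment_limit_exists:
  fixes \<mu> :: "nat \<Rightarrow> real measure"
  assumes rd: "\<And>n. real_distribution (\<mu> n)"
    and int: "\<And>n k. integrable (\<mu> n) (\<lambda>x. x ^ k)"
    and conv: "\<And>k. (\<lambda>n. \<integral>x. x ^ k \<partial>\<mu> n) \<longlonglongrightarrow> \<beta> k"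
  obtains \<nu> where "real_distribution \<nu>" "\<And>k. integrable \<nu> (\<lambda>x. x ^ k)" "\<And>k. (\<integral>x. x ^ k \<partial>\<nu>) = \<beta> k"
proof -
  have "tight \<mu>" using convergent_imp_Bseq[OF convergentI[OF conv[of 2]]] by (intro moments_tight rd int)
  then obtain r \<nu> where r: "strict_mono r" "real_distribution \<nu>" "weak_conv_m (\<mu> \<circ> id \<circ> r) \<nu>"
    using tight_imp_convergent_subsubsequence[of \<mu> id] by (auto simp: strict_mono_def)
  have "(\<lambda>n. \<integral>x. x ^ k \<partial>(\<mu> \<circ> id \<circ> r) n) \<longlonglongrightarrow> \<beta> k" for k
    using LIMSEQ_subseq_LIMSEQ[OF conv r(1)] by (simp add: comp_def)
  note * = weak_limit_moments[OF _ r(2) _ this r(3)]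
  show thesis by (rule that[OF r(2) *]) (auto simp: rd int)
qed

text \<open>Every subsequential weak limit has the moments of \<open>\<nu>\<close>, hence equals \<open>\<nu>\<close> by determinacy, and by
tightness this forces convergence of the whole sequence.\<close>

theorem moment_method:
  fixes \<mu> :: "nat \<Rightarrow> real measure"
  assumes rd: "\<And>n. real_distribution (\<mu> n)" and rd': "real_distribution \<nu>"
    and int: "\<And>n k. integrable (\<mu> n) (\<lambda>x. x ^ k)"
    and conv: "\<And>k. (\<lambda>n. \<integral>x. x ^ k \<partial>\<mu> n) \<longlonglongrightarrow>
        (\<integral>x. x ^ k \<partial>\<nu>)"
    and int': "\<And>k. integrable \<nu> (\<lambda>x. x ^ k)"
    and carl: "(\<integral>x. x\<^sup>2 \<partial>\<nu>) \<noteq> 0 \<Longrightarrow>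
      \<not> summable (carleman_terms (\<lambda>n. \<integral>x. x ^ n \<partial>\<nu>))"
  shows "weak_conv_m \<mu> \<nu>"
proof (rule tight_subseq_weak_converge[OF rd rd'])
  show "tight \<mu>" using convergent_imp_Bseq[OF convergentI[OF conv[of 2]]] by (intro moments_tight rd int)
  fix s \<nu>' assume s: "strict_mono s" and d: "real_distribution \<nu>'" and w: "weak_conv_m (\<mu> \<circ> s) \<nu>'"
  have "(\<lambda>n. \<integral>x. x ^ k \<partial>(\<mu> \<circ> s) n) \<longlonglongrightarrow>
      (\<integral>x. x ^ k \<partial>\<nu>)" for k
    using LIMSEQ_subseq_LIMSEQ[OF conv s] by (simp add: comp_def)
  note * = weak_limit_moments[OF _ d _ this w]
  have "\<nu> = \<nu>'"
    by (rule carleman_determinacy[OF rd' d int' _ _ carl]) (auto intro!: * simp: rd int *(2))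
  then show "weak_conv_m (\<mu> \<circ> s) \<nu>" using w by simp
qed

section \<open>The moment-cumulant formula and limits of products of power series\<close>

text \<open>A partition of \<open>A \<union> {a}\<close> amounts to the block of \<open>a\<close>, given by its other elements \<open>B\<close>, together
with a partition of \<open>A - B\<close>.\<close>

lemma bij_betw_partition_on_insert:
  assumes A: "a \<notin> A"
  shows "bij_betw (\<lambda>(B, \<sigma>). insert (insert a B) \<sigma>) (Sigma (Pow A) (\<lambda>B. {\<sigma>. partition_on (A - B) \<sigma>}))
    {\<sigma>. partition_on (insert a A) \<sigma>}"
proof (rule bij_betw_byWitness[where f' =
    "\<lambda>\<sigma>. (\<Union>{V \<in> \<sigma>. a \<in> V} - {a}, {V \<in> \<sigma>. a \<notin> V})"])
  let ?S = "Sigma (Pow A) (\<lambda>B. {\<sigma>. partition_on (A - B) \<sigma>})"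
  let ?h = "\<lambda>(B, \<sigma>). insert (insert a B) \<sigma>"
  let ?g = "\<lambda>\<sigma>. (\<Union>{V \<in> \<sigma>. a \<in> V} - {a}, {V \<in> \<sigma>. a \<notin> V})"
  have notin: "a \<notin> V" if "partition_on (A - B) \<sigma>" "V \<in> \<sigma>" for B \<sigma> V
    using partition_onD1[OF that(1)] that(2) A by blast
  show "\<forall>s\<in>?S. ?g (?h s) = s"
  proof
    fix s assume "s \<in> ?S"
    then obtain B \<sigma> where s: "s = (B, \<sigma>)" "B \<subseteq> A" "partition_on (A - B) \<sigma>" by blast
    have "{V \<in> insert (insert a B) \<sigma>. a \<in> V} = {insert a B}" using notin[OF s(3)] by blast
    moreover have "{V \<in> insert (insert a B) \<sigma>. a \<notin> V} = \<sigma>" using notin[OF s(3)] by blast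
    moreover have "insert a B - {a} = B" using s(2) A by blast
    ultimately show "?g (?h s) = s" unfolding s(1) by simp
  qed
  show "?h ` ?S \<subseteq> {\<sigma>. partition_on (insert a A) \<sigma>}"
  proof (rule image_subsetI)
    fix s assume "s \<in> ?S"
    then obtain B \<sigma> where s: "s = (B, \<sigma>)" "B \<subseteq> A" "partition_on (A - B) \<sigma>" by blast
    have "\<Union>\<sigma> = A - B" using partition_onD1[OF s(3)] by simp
    then have "disjnt (insert a B) (\<Union>\<sigma>)" using A by (simp add: disjnt_def)
    moreover have "insert a A - insert a B = A - B" using A by auto
    ultimately show "?h s \<in> {\<sigma>. partition_on (insert a A) \<sigma>}"
      unfolding s(1) using s(2,3) by (simp add: partition_on_insert) blast
  qed
  have V: "\<exists>V. {V \<in> \<sigma>. a \<in> V} =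
      {V} \<and> V \<in> \<sigma> \<and> a \<in> V \<and> {V \<in> \<sigma>. a \<notin> V} = \<sigma> - {V}"
    if p: "partition_on (insert a A) \<sigma>" for \<sigma>
  proof -
    have "a \<in> \<Union>\<sigma>" using partition_onD1[OF p] by blast
    then obtain V where V: "V \<in> \<sigma>" "a \<in> V" by blast
    have "V' = V" if V': "V' \<in> \<sigma>" "a \<in> V'" for V'
    proof (rule ccontr)
      assume "V' \<noteq> V"
      then have "V' \<inter> V = {}" by (rule disjointD[OF partition_onD2[OF p] V'(1) V(1)])
      then show False using V V' by blast
    qed
    then have "{V \<in> \<sigma>. a \<in> V} = {V}" "{V \<in> \<sigma>. a \<notin> V} = \<sigma> - {V}" using V by blast+
    with V show ?thesis by blast
  qed
  show "\<forall>\<sigma>\<in>{\<sigma>. partition_on (insert a A) \<sigma>}. ?h (?g \<sigma>) = \<sigma>"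
  proof
    fix \<sigma> assume "\<sigma> \<in> {\<sigma>. partition_on (insert a A) \<sigma>}"
    then obtain V where V: "{V \<in> \<sigma>. a \<in> V} =
        {V}" "V \<in> \<sigma>" "a \<in> V" "{V \<in> \<sigma>. a \<notin> V} = \<sigma> - {V}"
      using V by blast
    show "?h (?g \<sigma>) = \<sigma>" unfolding V(1,4) using V(2,3) by (simp add: insert_absorb)
  qed
  show "?g ` {\<sigma>. partition_on (insert a A) \<sigma>} \<subseteq> ?S"
  proof (rule image_subsetI)
    fix \<sigma> assume "\<sigma> \<in> {\<sigma>. partition_on (insert a A) \<sigma>}"
    then have p: "partition_on (insert a A) \<sigma>" by simp
    then obtain V where V: "{V \<in> \<sigma>. a \<in> V} =
        {V}" "V \<in> \<sigma>" "a \<in> V" "{V \<in> \<sigma>. a \<notin> V} = \<sigma> - {V}"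
      using V by blast
    have "V \<inter> W = {}" if "W \<in> \<sigma> - {V}" for W
      using disjointD[OF partition_onD2[OF p], of V W] V(2) that by blast
    then have dis: "disjnt V (\<Union>(\<sigma> - {V}))" unfolding disjnt_def by blast
    have ins: "insert V (\<sigma> - {V}) = \<sigma>" using V(2) by (rule insert_Diff)
    have "partition_on (insert a A - V) (\<sigma> - {V})" "V \<subseteq> insert a A"
      using p partition_on_insert[OF dis, of "insert a A"] unfolding ins by blast+
    moreover have "insert a A - V = A - (V - {a})" using V(3) A by blast
    ultimately show "?g \<sigma> \<in> ?S" unfolding V(1,4) by auto
  qed
qed

lemma sum_partition_on_insert:
  fixes f :: "nat \<Rightarrow> real"
  assumes A: "finite A" "a \<notin> A"
  shows "(\<Sum>\<sigma> | partition_on (insert a A) \<sigma>. mult_ext f \<sigma>) =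
    (\<Sum>B\<in>Pow A. f (Suc (card B)) * (\<Sum>\<sigma> | partition_on (A - B) \<sigma>. mult_ext f \<sigma>))"
proof -
  let ?S = "Sigma (Pow A) (\<lambda>B. {\<sigma>. partition_on (A - B) \<sigma>})"
  let ?h = "\<lambda>(B, \<sigma>). insert (insert a B) \<sigma>"
  have fin: "finite {\<sigma>. partition_on (A - B) \<sigma>}" for B using A by (intro finitely_many_partition_on) auto
  have "(\<Sum>\<sigma> | partition_on (insert a A) \<sigma>. mult_ext f \<sigma>) = (\<Sum>s\<in>?S. mult_ext f (?h s))"
    by (rule sum.reindex_bij_betw[OF bij_betw_partition_on_insert[OF A(2)], symmetric])
  also have "\<dots> = (\<Sum>(B, \<sigma>)\<in>?S. f (Suc (card B)) * mult_ext f \<sigma>)"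
  proof (rule sum.cong[OF refl], unfold split_beta)
    fix s assume "s \<in> ?S"
    then obtain B \<sigma> where s: "s = (B, \<sigma>)" "B \<subseteq> A" "partition_on (A - B) \<sigma>" by blast
    have "finite \<sigma>" using s(3) A(1) by (intro finite_elements) auto
    moreover have "insert a B \<notin> \<sigma>" using partition_onD1[OF s(3)] A(2) by blast
    moreover have "card (insert a B) = Suc (card B)"
      using s(2) A by (intro card_insert_disjoint) (auto dest: finite_subset)
    ultimately show "mult_ext f (insert (insert a (fst s)) (snd s)) = f (Suc (card (fst s))) * mult_ext f (snd s)"
      by (simp add: mult_ext_def s(1))
  qed
  also have "\<dots> = (\<Sum>B\<in>Pow A. f (Suc (card B)) * (\<Sum>\<sigma> | partition_on (A - B) \<sigma>. mult_ext f \<sigma>))"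
    using A fin by (subst sum.Sigma[symmetric]) (auto simp: sum_distrib_left)
  finally show ?thesis .
qed

text \<open>The moment sequence with cumulants \<open>\<kappa>\<close>, whether or not it comes from a measure. The recursion is the
coefficient form of \<open>F' = K' F\<close> for the exponential generating functions \<open>F\<close> of the moments and
\<open>K\<close> of the cumulants.\<close>

fun cumulant_moment :: "(nat \<Rightarrow> real) \<Rightarrow> nat \<Rightarrow> real" where
  "cumulant_moment \<kappa> 0 = 1"
| "cumulant_moment \<kappa> (Suc k) = (\<Sum>j\<le>k. real (k choose j) * \<kappa> (Suc j) * cumulant_moment \<kappa> (k - j))"

lemma sum_partition_on_eq_cumulant_moment:
  assumes "finite A"
  shows "(\<Sum>\<sigma> | partition_on A \<sigma>. mult_ext \<kappa> \<sigma>) = cumulant_moment \<kappa> (card A)"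
  using assms
proof (induction "card A" arbitrary: A rule: less_induct)
  case less
  show ?case
  proof (cases "A = {}")
    case True
    then have "{\<sigma>. partition_on A \<sigma>} = {{}}" by (auto simp: partition_on_empty)
    then show ?thesis using True by (simp add: mult_ext_def)
  next
    case False
    then obtain a A' where A: "A = insert a A'" "a \<notin> A'" by (meson mk_disjoint_insert ex_in_conv)
    have fin: "finite A'" using less A by simp
    have card: "card A = Suc (card A')" using A fin by simp
    have "(\<Sum>\<sigma> | partition_on A \<sigma>. mult_ext \<kappa> \<sigma>) =
        (\<Sum>B\<in>Pow A'. \<kappa> (Suc (card B)) * cumulant_moment \<kappa> (card A' - card B))"
      unfolding A(1) sum_partition_on_insert[OF fin A(2)]
    proof (intro sum.cong refl arg_cong2[of _ _ _ _ "(*)"])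
      fix B assume B: "B \<in> Pow A'"
      then have c: "card (A' - B) = card A' - card B"
        using fin by (intro card_Diff_subset) (auto dest: finite_subset)
      have "(\<Sum>\<sigma> | partition_on (A' - B) \<sigma>. mult_ext \<kappa> \<sigma>) =
          cumulant_moment \<kappa> (card (A' - B))"
        using fin card c by (intro less(1)) auto
      then show "(\<Sum>\<sigma> | partition_on (A' - B) \<sigma>. mult_ext \<kappa> \<sigma>) =
          cumulant_moment \<kappa> (card A' - card B)"
        by (simp add: c)
    qed
    also have "\<dots> = (\<Sum>j\<le>card A'. \<Sum>B | B \<in> Pow A' \<and> card B =
        j. \<kappa> (Suc (card B)) * cumulant_moment \<kappa> (card A' - card B))"
      using fin by (intro sum.group[symmetric]) (auto intro: card_mono)
    also have "\<dots> = (\<Sum>j\<le>card A'. real (card A' choose j) * \<kappa> (Suc j) * cumulant_moment \<kappa> (card A' - j))"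
    proof (intro sum.cong refl)
      fix j
      have "(\<Sum>B | B \<in> Pow A' \<and> card B = j. \<kappa> (Suc (card B)) * cumulant_moment \<kappa> (card A' - card B))
        = (\<Sum>B | B \<subseteq> A' \<and> card B = j. \<kappa> (Suc j) * cumulant_moment \<kappa> (card A' - j))"
        by (rule sum.cong) auto
      then show "(\<Sum>B | B \<in> Pow A' \<and> card B =
          j. \<kappa> (Suc (card B)) * cumulant_moment \<kappa> (card A' - card B))
        = real (card A' choose j) * \<kappa> (Suc j) * cumulant_moment \<kappa> (card A' - j)"
        by (simp add: n_subsets[OF fin])
    qed
    also have "\<dots> = cumulant_moment \<kappa> (card A)" by (simp add: card)
    finally show ?thesis .
  qed
qed

lemma fps_deriv_prod_log:
  fixes U :: "'b \<Rightarrow> real fps"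
  assumes "finite L" "\<And>l. l \<in> L \<Longrightarrow> fps_nth (U l) 0 = 1"
  shows "fps_deriv (\<Prod>l\<in>L. U l) = (\<Sum>l\<in>L. fps_deriv (U l) * inverse (U l)) * (\<Prod>l\<in>L. U l)"
  using assms
proof (induction L rule: finite_induct)
  case (insert l L)
  let ?d = "fps_deriv (U l)" and ?i = "inverse (U l)" and ?P = "\<Prod>l\<in>L. U l"
    and ?S = "\<Sum>l\<in>L. fps_deriv (U l) * inverse (U l)"
  have inv: "?i * U l = 1" using insert by (intro inverse_mult_eq_1) auto
  have "(?d * ?i + ?S) * (U l * ?P) = ?d * (?i * U l) * ?P + U l * (?S * ?P)"
    by (simp only: algebra_simps)
  also have "\<dots> = fps_deriv (U l * ?P)" unfolding inv using insert by (simp add: algebra_simps)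
  finally show ?case using insert by simp
qed simp

text \<open>The class of arrays that are negligible in a product of power series: it is closed under sums and
products, and the product of two of its members is negligible even after summation.\<close>

definition l2_null :: "(nat \<Rightarrow> 'b set) \<Rightarrow> (nat \<Rightarrow> 'b \<Rightarrow> real) \<Rightarrow> bool" where
  "l2_null L a \<longleftrightarrow> (\<lambda>n. \<Sum>l\<in>L n. (a n l)\<^sup>2) \<longlonglongrightarrow> 0"

lemma l2_null_mult_sum:
  assumes "l2_null L a" "l2_null L b"
  shows "(\<lambda>n. \<Sum>l\<in>L n. a n l * b n l) \<longlonglongrightarrow> 0"
proof (rule Lim_null_comparison)
  show "\<forall>\<^sub>F n in sequentially. norm (\<Sum>l\<in>L n. a n l * b n l) \<le>
      (\<Sum>l\<in>L n. (a n l)\<^sup>2) + (\<Sum>l\<in>L n. (b n l)\<^sup>2)"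
  proof (intro always_eventually allI)
    fix n
    have "norm (\<Sum>l\<in>L n. a n l * b n l) \<le> (\<Sum>l\<in>L n. (a n l)\<^sup>2 + (b n l)\<^sup>2)"
    proof (rule sum_norm_le)
      fix l
      have "0 \<le> (\<bar>a n l\<bar> - \<bar>b n l\<bar>)\<^sup>2" "0 \<le> \<bar>a n l\<bar> * \<bar>b n l\<bar>" by auto
      then show "norm (a n l * b n l) \<le> (a n l)\<^sup>2 + (b n l)\<^sup>2"
        unfolding power2_diff power2_abs real_norm_def abs_mult by linarith
    qed
    then show "norm (\<Sum>l\<in>L n. a n l * b n l) \<le> (\<Sum>l\<in>L n. (a n l)\<^sup>2) +
        (\<Sum>l\<in>L n. (b n l)\<^sup>2)"
      by (simp add: sum.distrib)
  qed
  show "(\<lambda>n. (\<Sum>l\<in>L n. (a n l)\<^sup>2) + (\<Sum>l\<in>L n. (b n l)\<^sup>2)) \<longlonglongrightarrow> 0"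
    using tendsto_add[OF assms[unfolded l2_null_def]] by simp
qed

lemma l2_null_mult:
  assumes "\<And>n. finite (L n)" "l2_null L a" "l2_null L b"
  shows "l2_null L (\<lambda>n l. a n l * b n l)"
  unfolding l2_null_def
proof (rule Lim_null_comparison)
  show "\<forall>\<^sub>F n in sequentially. norm (\<Sum>l\<in>L n. (a n l * b n l)\<^sup>2) \<le>
      (\<Sum>l\<in>L n. (a n l)\<^sup>2) * (\<Sum>l\<in>L n. (b n l)\<^sup>2)"
  proof (intro always_eventually allI)
    fix n
    have "(\<Sum>l\<in>L n. (a n l * b n l)\<^sup>2) \<le>
        (\<Sum>l\<in>L n. (a n l)\<^sup>2 * (\<Sum>l\<in>L n. (b n l)\<^sup>2))"
      unfolding power_mult_distrib
      by (intro sum_mono mult_left_mono member_le_sum) (auto simp: assms)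
    then show "norm (\<Sum>l\<in>L n. (a n l * b n l)\<^sup>2) \<le>
        (\<Sum>l\<in>L n. (a n l)\<^sup>2) * (\<Sum>l\<in>L n. (b n l)\<^sup>2)"
      by (simp add: sum_distrib_right sum_nonneg)
  qed
  show "(\<lambda>n. (\<Sum>l\<in>L n. (a n l)\<^sup>2) * (\<Sum>l\<in>L n. (b n l)\<^sup>2)) \<longlonglongrightarrow> 0"
    using tendsto_mult[OF assms(2,3)[unfolded l2_null_def]] by simp
qed

lemma l2_null_add:
  assumes "l2_null L a" "l2_null L b"
  shows "l2_null L (\<lambda>n l. a n l + b n l)"
proof -
  have "(\<Sum>l\<in>L n. (a n l + b n l)\<^sup>2) = (\<Sum>l\<in>L n. (a n l)\<^sup>2) +
      (\<Sum>l\<in>L n. (b n l)\<^sup>2) + 2 * (\<Sum>l\<in>L n. a n l * b n l)" for n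
    by (simp add: power2_sum sum.distrib sum_distrib_left algebra_simps)
  moreover have "(\<lambda>n. (\<Sum>l\<in>L n. (a n l)\<^sup>2) + (\<Sum>l\<in>L n. (b n l)\<^sup>2) +
      2 * (\<Sum>l\<in>L n. a n l * b n l)) \<longlonglongrightarrow> 0 + 0 + 2 * 0"
    using assms by (intro tendsto_intros l2_null_mult_sum) (auto simp: l2_null_def)
  ultimately show ?thesis by (simp add: l2_null_def)
qed

lemma l2_null_cmult:
  assumes "l2_null L a"
  shows "l2_null L (\<lambda>n l. c * a n l)"
  using tendsto_mult_left[OF assms[unfolded l2_null_def], of "c\<^sup>2"]
  by (simp add: l2_null_def power_mult_distrib sum_distrib_left)

lemma l2_null_sum:
  assumes "finite I" "\<And>i. i \<in> I \<Longrightarrow> l2_null L (a i)"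
  shows "l2_null L (\<lambda>n l. \<Sum>i\<in>I. a i n l)"
  using assms
proof (induction I rule: finite_induct)
  case empty show ?case by (simp add: l2_null_def)
next
  case (insert i I) then show ?case by (simp add: l2_null_add)
qed

text \<open>The product \<open>F\<close> satisfies \<open>F' = G F\<close> with \<open>G = \<Sum>\<^sub>l U\<^sub>l' / U\<^sub>l\<close>. The coefficients of each
\<open>U\<^sub>l' / U\<^sub>l\<close> differ from those of \<open>U\<^sub>l'\<close> by sums of products of two null arrays, so those of \<open>G\<close>
have the same limits as those of \<open>\<Sum>\<^sub>l U\<^sub>l'\<close>. The differential equation then determines the limits
of the coefficients of \<open>F\<close> one after the other.\<close>

theorem fps_prod_tendsto_cumulant_moment:
  fixes U :: "nat \<Rightarrow> 'b \<Rightarrow> real fps"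
  assumes fin: "\<And>n. finite (L n)" and one: "\<And>n l. fps_nth (U n l) 0 = 1"
    and lim: "\<And>p. p \<ge> 1 \<Longrightarrow> (\<lambda>n. \<Sum>l\<in>L n. fps_nth (U n l) p) \<longlonglongrightarrow>
        \<kappa> p / fact p"
    and null: "\<And>p. p \<ge> 1 \<Longrightarrow> l2_null L (\<lambda>n l. fps_nth (U n l) p)"
  shows "(\<lambda>n. fps_nth (\<Prod>l\<in>L n. U n l) k) \<longlonglongrightarrow> cumulant_moment \<kappa> k / fact k"
proof -
  define V where "V n l = fps_deriv (U n l) * inverse (U n l)" for n l
  have VU: "V n l * U n l = fps_deriv (U n l)" for n l
  proof -
    have "inverse (U n l) * U n l = 1" using one by (intro inverse_mult_eq_1) auto
    then show ?thesis by (simp add: V_def mult.assoc)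
  qed
  \<comment> \<open>Comparing coefficients in \<open>V U = U'\<close> exhibits those of \<open>V\<close> as the ones of \<open>U'\<close> up to products.\<close>
  have Vrec: "fps_nth (V n l) j = real (Suc j) * fps_nth (U n l) (Suc j) +
      (-1) * (\<Sum>i<j. fps_nth (V n l) i * fps_nth (U n l) (j - i))" for n l j
  proof -
    have "fps_nth (V n l * U n l) j = fps_nth (V n l) j + (\<Sum>i<j. fps_nth (V n l) i * fps_nth (U n l) (j - i))"
      unfolding fps_mult_nth atLeast0AtMost by (subst lessThan_Suc_atMost[symmetric]) (simp add: one)
    then show ?thesis unfolding VU by (simp add: algebra_simps)
  qed
  have Vnull: "l2_null L (\<lambda>n l. fps_nth (V n l) j)" for j
  proof (induction j rule: less_induct)
    case (less j)
    show ?case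
      unfolding Vrec[of _ _ j] using less
      by (intro l2_null_add l2_null_cmult l2_null_sum l2_null_mult null fin) auto
  qed
  define G where "G n = (\<Sum>l\<in>L n. V n l)" for n
  have Glim: "(\<lambda>n. fps_nth (G n) j) \<longlonglongrightarrow> \<kappa> (Suc j) / fact j" for j
  proof -
    have "fps_nth (G n) j = real (Suc j) * (\<Sum>l\<in>L n. fps_nth (U n l) (Suc j)) -
        (\<Sum>i<j. \<Sum>l\<in>L n. fps_nth (V n l) i * fps_nth (U n l) (j - i))" for n
      unfolding G_def fps_sum_nth Vrec[of _ _ j] sum.distrib sum_distrib_left
      by (subst (2) sum.swap) (simp add: sum_negf)
    moreover have "(\<lambda>n. real (Suc j) * (\<Sum>l\<in>L n. fps_nth (U n l) (Suc j)) -
        (\<Sum>i<j. \<Sum>l\<in>L n. fps_nth (V n l) i * fps_nth (U n l) (j - i))) \<longlonglongrightarrow>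
        real (Suc j) * (\<kappa> (Suc j) / fact (Suc j)) - (\<Sum>i<j. 0)"
      by (intro tendsto_diff tendsto_mult_left lim tendsto_sum l2_null_mult_sum Vnull null) auto
    moreover have "real (Suc j) * (\<kappa> (Suc j) / fact (Suc j)) - (\<Sum>i<j. 0) = \<kappa> (Suc j) / fact j"
      by (simp add: fact_Suc del: of_nat_Suc)
    ultimately show ?thesis by (simp only:)
  qed
  define F where "F n = (\<Prod>l\<in>L n. U n l)" for n
  have F': "fps_deriv (F n) = G n * F n" for n
    unfolding F_def G_def V_def by (rule fps_deriv_prod_log) (auto simp: fin one)
  have "(\<lambda>n. fps_nth (F n) k) \<longlonglongrightarrow> cumulant_moment \<kappa> k / fact k"
  proof (induction k rule: less_induct)
    case (less k)
    show ?case
    proof (cases k)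
      case 0
      have "fps_nth (\<Prod>l\<in>S. U n l) 0 = 1" for n and S :: "'b set"
        by (induction S rule: infinite_finite_induct) (auto simp: one)
      then have "fps_nth (F n) 0 = 1" for n
        unfolding F_def by simp
      then show ?thesis using 0 by simp
    next
      case (Suc m)
      have "fps_nth (F n) k = (\<Sum>j\<le>m. fps_nth (G n) j * fps_nth (F n) (m - j)) / real (Suc m)" for n
      proof -
        have "real (Suc m) * fps_nth (F n) (Suc m) = fps_nth (fps_deriv (F n)) m" by simp
        also have "\<dots> = (\<Sum>j\<le>m. fps_nth (G n) j * fps_nth (F n) (m - j))" unfolding F'
            by (simp add: fps_mult_nth atLeast0AtMost)
        finally show ?thesis unfolding Suc by (simp add: field_simps del: of_nat_Suc)
      qed
      moreover have "(\<lambda>n. (\<Sum>j\<le>m. fps_nth (G n) j * fps_nth (F n) (m - j)) / real (Suc m)) \<longlonglongrightarrow>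
          (\<Sum>j\<le>m. (\<kappa> (Suc j) / fact j) * (cumulant_moment \<kappa> (m - j) / fact (m - j))) / real (Suc m)"
        by (intro tendsto_intros Glim less) (auto simp: Suc)
      moreover have "(\<Sum>j\<le>m. (\<kappa> (Suc j) / fact j) * (cumulant_moment \<kappa> (m - j) / fact (m - j))) / real (Suc m)
          = cumulant_moment \<kappa> k / fact k"
      proof -
        have "cumulant_moment \<kappa> (Suc m) / fact m =
            (\<Sum>j\<le>m. (\<kappa> (Suc j) / fact j) * (cumulant_moment \<kappa> (m - j) / fact (m - j)))"
          by (simp add: sum_divide_distrib) (intro sum.cong, auto simp: binomial_fact)
        then have "(\<Sum>j\<le>m. (\<kappa> (Suc j) / fact j) * (cumulant_moment \<kappa> (m - j) / fact (m - j))) / real (Suc m)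
            = cumulant_moment \<kappa> (Suc m) / fact m / real (Suc m)" by presburger
        also have "\<dots> = cumulant_moment \<kappa> (Suc m) / fact (Suc m)"
          by (simp only: fact_Suc divide_divide_eq_left mult.commute of_nat_id)
        finally show ?thesis unfolding Suc .
      qed
      ultimately show ?thesis by simp
    qed
  qed
  then show ?thesis by (simp add: F_def)
qed

section \<open>Diagonalisation of symmetric circulants\<close>

abbreviation angle :: "nat \<Rightarrow> nat \<Rightarrow> nat \<Rightarrow> real" where
  "angle n j l \<equiv> 2 * pi * real j * real l / real n"

text \<open>The kernel of the discrete Hartley transform, the real counterpart of the Fourier transform. It keeps
the diagonalisation over the reals, where the spectral distribution is defined.\<close>

definition cas :: "real \<Rightarrow> real" where "cas u = cos u + sin u"

lemma sum_cos_sin_multiples: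
  fixes m :: int
  assumes n: "n > 0"
  shows "(\<Sum>k<n. cos (2 * pi * real k * real_of_int m / real n)) = (if int n dvd m then real n else 0)"
    and "(\<Sum>k<n. sin (2 * pi * real k * real_of_int m / real n)) = 0"
proof -
  define z where "z = cis (2 * pi * real_of_int m / real n)"
  have zk: "z ^ k = cis (2 * pi * real k * real_of_int m / real n)" for k
    unfolding z_def Complex.DeMoivre by (simp add: field_simps)
  have zn: "z ^ n = 1"
  proof -
    have "2 * pi * real n * real_of_int m / real n = 2 * pi * real_of_int m" using n by simp
    then have "z ^ n = cis (2 * pi * real_of_int m)" by (simp only: zk)
    also have "\<dots> = 1" by (rule cis_multiple_2pi) simp
    finally show ?thesis .
  qed
  have z1: "z = 1 \<longleftrightarrow> int n dvd m"
  proof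
    assume "z = 1"
    then have "cos (2 * pi * real_of_int m / real n) = 1" by (simp add: z_def complex_eq_iff)
    then obtain q :: int where "2 * pi * real_of_int m / real n = real_of_int q * 2 * pi"
      using cos_one_2pi_int by blast
    then have "real_of_int m = real_of_int q * real n" using n by (simp add: field_simps)
    then have "real_of_int m = real_of_int (q * int n)" by simp
    then have "m = q * int n" by (simp only: of_int_eq_iff)
    then show "int n dvd m" by simp
  next
    assume "int n dvd m"
    then obtain q where "m = int n * q" by (elim dvdE)
    then have "2 * pi * real_of_int m / real n = 2 * pi * real_of_int q" using n by simp
    then show "z = 1" unfolding z_def by (simp add: complex_eq_iff)
  qed
  have S: "(\<Sum>k<n. z ^ k) = (if int n dvd m then of_nat n else 0)"
    using zn z1 by (cases "z = 1") (simp_all add: geometric_sum)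
  have "(\<Sum>k<n. cos (2 * pi * real k * real_of_int m / real n)) = Re (\<Sum>k<n. z ^ k)" by (simp add: zk)
  then show "(\<Sum>k<n. cos (2 * pi * real k * real_of_int m / real n)) = (if int n dvd m then real n else 0)"
    unfolding S by simp
  have "(\<Sum>k<n. sin (2 * pi * real k * real_of_int m / real n)) = Im (\<Sum>k<n. z ^ k)" by (simp add: zk)
  then show "(\<Sum>k<n. sin (2 * pi * real k * real_of_int m / real n)) = 0"
    unfolding S by simp
qed

lemma cas_orthogonality:
  assumes "n > 0" "i < n" "j < n"
  shows "(\<Sum>k<n. cas (angle n i k) * cas (angle n k j))
    = (if i = j then real n else 0)"
proof -
  have "cas (angle n i k) * cas (angle n k j) =
    cos (2 * pi * real k * real_of_int (int i - int j) / real n) + sin (2 * pi * real k * real_of_int (int i +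
        int j) / real n)" for k
  proof -
    have "cas u * cas v = cos (u - v) + sin (u + v)" for u v
      by (simp add: cas_def cos_diff sin_add algebra_simps)
    then show ?thesis by (simp add: diff_divide_distrib add_divide_distrib algebra_simps)
  qed
  moreover have "int n dvd int i - int j \<longleftrightarrow> i = j"
    using assms dvd_imp_le_int[of "int i - int j" "int n"] by fastforce
  ultimately show ?thesis by (simp only: sum.distrib sum_cos_sin_multiples[OF assms(1)])
qed

text \<open>An index \<open>l\<close> with \<open>0 < l < n / 2\<close> occurs twice in each row, at distance \<open>l\<close> in either direction
around the circle; the two exceptional indices occur once.\<close>

definition circ_weight :: "nat \<Rightarrow> nat \<Rightarrow> nat \<Rightarrow> real" where
  "circ_weight n j l = (if l = 0 \<or> 2 * l = n then 1 else 2) * cos (angle n j l)"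

definition circ_eigenvalue :: "nat \<Rightarrow> (nat \<Rightarrow> real) \<Rightarrow> nat \<Rightarrow> real" where
  "circ_eigenvalue n x j = (\<Sum>l\<le>n div 2. circ_weight n j l * x l)"

lemma sym_circulant_index:
  assumes "i < n" "k < n"
  shows "sym_circulant n x $$ (i, k) = x (min (nat \<bar>int i - int k\<bar>) (n - nat \<bar>int i - int k\<bar>))"
proof -
  define d where "d = nat \<bar>int i - int k\<bar>"
  have "\<bar>real i - real k\<bar> = real d" by (auto simp: d_def of_nat_diff)
  moreover have "d < n" using assms by (auto simp: d_def)
  ultimately have "real n / 2 - \<bar>real n / 2 - \<bar>real i - real k\<bar>\<bar> = real (min d (n - d))"
    by (auto simp: abs_if min_def of_nat_diff field_simps split: if_splits)
  then show ?thesis using assms by (simp add: sym_circulant_def d_def)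
qed

lemma sum_circulant_row:
  fixes n :: nat and F :: "int \<Rightarrow> real"
  assumes n: "n > 0" and per: "\<And>d. F (d + int n) = F d"
  shows "(\<Sum>k<n. F (int k - int i)) = (\<Sum>d<n. F (int d))"
proof (induction i)
  case (Suc i)
  have "(\<Sum>k<n. F (int k - int (Suc i))) = (\<Sum>k<n. F (int k - int i))"
  proof -
    obtain m where m: "n = Suc m" using n by (cases n) auto
    have "(\<Sum>k<Suc m. F (int k - int (Suc i))) = F (- int (Suc i)) + (\<Sum>k<m. F (int k - int i))"
      by (subst sum.lessThan_Suc_shift) simp
    moreover have "F (- int (Suc i)) = F (int m - int i)" using per[of "- int (Suc i)"] by (simp add: m)
    ultimately show ?thesis by (simp add: m)
  qed
  then show ?case using Suc by simp
qed simp

lemma sum_fold_circulant: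
  fixes n :: nat and f :: "nat \<Rightarrow> real"
  assumes n: "n > 0"
  shows "(\<Sum>d<n. f (min d (n - d))) = (\<Sum>l\<le>n div 2. (if l = 0 \<or> 2 * l = n then 1 else 2) * f l)"
proof -
  have "(\<Sum>d<n. f (min d (n - d))) = (\<Sum>l\<le>n div 2. \<Sum>d | d \<in> {..<n} \<and> min d (n - d) =
      l. f (min d (n - d)))"
    by (rule sum.group[symmetric]) auto
  also have "\<dots> = (\<Sum>l\<le>n div 2. (if l = 0 \<or> 2 * l = n then 1 else 2) * f l)"
  proof (rule sum.cong[OF refl])
    fix l assume l: "l \<in> {..n div 2}"
    have "{d \<in> {..<n}. min d (n - d) = l} = (if l = 0 \<or> 2 * l = n then {l} else {l, n - l})"
      using l n by (auto simp: min_def split: if_splits)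
    moreover have "l \<noteq> n - l" if "2 * l \<noteq> n" using that l by auto
    moreover have "min l (n - l) = l" "min (n - l) (n - (n - l)) = l" using l by auto
    ultimately show "(\<Sum>d | d \<in> {..<n} \<and> min d (n - d) = l. f (min d (n - d))) = (if l = 0 \<or> 2 * l =
        n then 1 else 2) * f l"
      by auto
  qed
  finally show ?thesis .
qed

lemma circ_eigenvalue_altdef:
  assumes n: "n > 0"
  shows "circ_eigenvalue n x j = (\<Sum>d<n. x (min d (n - d)) * cos (angle n j d))"
proof -
  have fold: "cos (angle n j d) = cos (angle n j (min d (n - d)))" if "d < n" for d
  proof (cases "d \<le> n - d")
    case False
    have "angle n j (n - d) = 2 * pi * real j - angle n j d"
      using that by (simp add: of_nat_diff field_simps)
    then have "cos (angle n j (n - d)) = cos (angle n j d)"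
      using cos_2npi[of j] sin_2npi[of j] by (simp add: cos_diff mult_ac)
    then show ?thesis using False by (simp add: min_def)
  qed (simp add: min_def)
  have "(\<Sum>d<n. x (min d (n - d)) * cos (angle n j d)) =
    (\<Sum>d<n. (\<lambda>l. x l * cos (angle n j l)) (min d (n - d)))"
  proof (rule sum.cong[OF refl])
    fix d assume "d \<in> {..<n}"
    then have "d < n" by simp
    then show "x (min d (n - d)) * cos (angle n j d) =
        (\<lambda>l. x l * cos (angle n j l)) (min d (n - d))"
      by (rule arg_cong[where f = "(*) _", OF fold])
  qed
  also have "\<dots> = circ_eigenvalue n x j"
    unfolding sum_fold_circulant[OF n, of "\<lambda>l. x l * cos (angle n j l)"]
      circ_eigenvalue_def circ_weight_def by (rule sum.cong) simp_all
  finally show ?thesis ..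
qed

text \<open>The matrix entry as an \<open>n\<close>-periodic, even function of the difference of the indices, defined on all
integers.\<close>

definition circ_entry :: "nat \<Rightarrow> (nat \<Rightarrow> real) \<Rightarrow> int \<Rightarrow> real" where
  "circ_entry n x d = x (min (nat (d mod int n)) (n - nat (d mod int n)))"

lemma sym_circulant_eq_circ_entry:
  assumes "i < n" "k < n"
  shows "sym_circulant n x $$ (i, k) = circ_entry n x (int k - int i)"
proof (cases "i \<le> k")
  case True
  then have "(int k - int i) mod int n = int k - int i" using assms by (intro mod_pos_pos_trivial) auto
  then show ?thesis using True assms by (simp add: sym_circulant_index circ_entry_def abs_if nat_diff_distrib)
next
  case False
  have "(int k - int i) mod int n = (int k - int i + int n) mod int n" by simp
  also have "\<dots> = int k - int i + int n" using assms False by (intro mod_pos_pos_trivial) auto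
  finally have m: "nat ((int k - int i) mod int n) = n - (i - k)" using False assms by linarith
  have a: "nat \<bar>int i - int k\<bar> = i - k" using False by linarith
  have "n - (n - (i - k)) = i - k" using assms by simp
  then show ?thesis unfolding sym_circulant_index[OF assms] circ_entry_def m a by (simp add: min.commute)
qed

lemma circ_entry_minus:
  assumes "n > 0"
  shows "circ_entry n x (- d) = circ_entry n x d"
proof (cases "d mod int n = 0")
  case True
  then have "(- d) mod int n = 0" by (simp add: zmod_zminus1_eq_if)
  then show ?thesis using True by (simp add: circ_entry_def)
next
  case False
  then have "(- d) mod int n = int n - d mod int n" by (simp add: zmod_zminus1_eq_if)
  moreover have "0 \<le> d mod int n" "d mod int n < int n" using assms by auto
  ultimately have "nat ((- d) mod int n) = n - nat (d mod int n)" "nat (d mod int n) \<le> n" by linarith+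
  then show ?thesis by (simp add: circ_entry_def min.commute)
qed

lemma circ_entry_periodic: "circ_entry n x (d + int n) = circ_entry n x d"
  by (simp add: circ_entry_def)

text \<open>By the addition theorem the row sum splits into a cosine part, which is the eigenvalue, and a sine
part, which vanishes because the entries are even in the difference of the indices.\<close>

lemma sym_circulant_eigenvector:
  assumes n: "n > 0" and "i < n" "j < n"
  shows "(\<Sum>k<n. sym_circulant n x $$ (i, k) * cas (angle n k j)) =
    circ_eigenvalue n x j * cas (angle n i j)"
proof -
  let ?a = "angle n i j"
  let ?t = "\<lambda>d. 2 * pi * real j * real_of_int d / real n"
  let ?C = "\<lambda>d. circ_entry n x d * cos (?t d)" and ?S = "\<lambda>d. circ_entry n x d * sin (?t d)"
  have shift: "?t (d + int n) = ?t d + 2 * real j * pi" for d using n by (simp add: field_simps)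
  have perC: "?C (d + int n) = ?C d" and perS: "?S (d + int n) = ?S d" for d
    unfolding circ_entry_periodic shift
    using cos_2npi[of j] sin_2npi[of j] by (simp_all add: cos_add sin_add mult_ac)
  have S0: "(\<Sum>d<n. ?S (int d)) = 0"
  proof -
    have "(\<Sum>d<n. ?S (int d)) = (\<Sum>k<n. ?S (int k - int (n - 1)))"
      by (rule sum_circulant_row[where F = ?S, OF n perS, symmetric])
    also have "\<dots> = (\<Sum>k<n. ?S (int (n - Suc k) - int (n - 1)))"
      by (rule sum.nat_diff_reindex[symmetric])
    also have "\<dots> = (\<Sum>k<n. - ?S (int k))"
    proof (rule sum.cong[OF refl])
      fix k assume "k \<in> {..<n}"
      then have e: "int (n - Suc k) - int (n - 1) = - int k" by auto
      show "?S (int (n - Suc k) - int (n - 1)) = - ?S (int k)"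
        unfolding e circ_entry_minus[OF n] by simp
    qed
    finally show ?thesis by (simp add: sum_negf)
  qed
  have "(\<Sum>k<n. sym_circulant n x $$ (i, k) * cas (angle n k j)) =
      (\<Sum>k<n. cas ?a * ?C (int k - int i) + (cos ?a - sin ?a) * ?S (int k - int i))"
  proof (rule sum.cong[OF refl])
    fix k assume k: "k \<in> {..<n}"
    have t: "angle n k j = ?a + ?t (int k - int i)"
      by (simp add: right_diff_distrib diff_divide_distrib mult_ac)
    have cas_add: "cas (u + v) = cas u * cos v + (cos u - sin u) * sin v" for u v
      by (simp add: cas_def cos_add sin_add algebra_simps)
    have entry: "sym_circulant n x $$ (i, k) = circ_entry n x (int k - int i)"
      using k assms by (intro sym_circulant_eq_circ_entry) auto
    have dist: "E * (p * q + r * s) = p * (E * q) + r * (E * s)" for E p q r s :: real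
      by (simp add: algebra_simps)
    show "sym_circulant n x $$ (i, k) * cas (angle n k j) =
        cas ?a * ?C (int k - int i) + (cos ?a - sin ?a) * ?S (int k - int i)"
      unfolding entry t cas_add dist ..
  qed
  also have "\<dots> = cas ?a * (\<Sum>d<n. ?C (int d)) + (cos ?a - sin ?a) * (\<Sum>d<n. ?S (int d))"
    unfolding sum.distrib sum_distrib_left[symmetric]
    by (simp only: sum_circulant_row[where F = ?C, OF n perC] sum_circulant_row[where F = ?S, OF n perS])
  also have "(\<Sum>d<n. ?C (int d)) = circ_eigenvalue n x j"
    unfolding circ_eigenvalue_altdef[OF n] by (rule sum.cong) (auto simp: circ_entry_def)
  finally show ?thesis unfolding S0 by simp
qed

lemma sym_circulant_carrier [simp]: "sym_circulant n x \<in> carrier_mat n n"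
  by (simp add: sym_circulant_def)

text \<open>The Hartley matrix \<open>H\<close> satisfies \<open>H H = n I\<close>, so the eigenvector relation is a similarity with a
diagonal matrix. This gives the eigenvalues with their algebraic multiplicities, also when several
frequencies share an eigenvalue.\<close>

lemma char_poly_sym_circulant:
  assumes n: "n > 0"
  shows "char_poly (sym_circulant n x) = prod_list (map (\<lambda>j. [:- circ_eigenvalue n x j, 1:]) [0..<n])"
proof -
  define H where "H = mat n n (\<lambda>(i, k). cas (angle n i k))"
  define D where "D = mat_diag n (circ_eigenvalue n x)"
  define A where "A = sym_circulant n x"
  have carr: "A \<in> carrier_mat n n" "D \<in> carrier_mat n n" "H \<in> carrier_mat n n"
    by (simp_all add: A_def D_def H_def)
  have HH: "H * H = real n \<cdot>\<^sub>m 1\<^sub>m n"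
    by (rule eq_matI) (use n in \<open>auto simp: H_def scalar_prod_def atLeast0LessThan cas_orthogonality\<close>)
  have AH: "A * H = H * D"
  proof (rule eq_matI)
    fix i j assume "i < dim_row (H * D)" "j < dim_col (H * D)"
    then have ij: "i < n" "j < n" using carr by auto
    have "(A * H) $$ (i, j) = (\<Sum>k<n. A $$ (i, k) * cas (angle n k j))"
      using ij carr by (simp add: scalar_prod_def H_def atLeast0LessThan)
    also have "\<dots> = circ_eigenvalue n x j * H $$ (i, j)"
      unfolding A_def sym_circulant_eigenvector[OF n ij] using ij by (simp add: H_def)
    also have "\<dots> = (H * D) $$ (i, j)"
      unfolding D_def mat_diag_mult_right[OF carr(3)] using ij by simp
    finally show "(A * H) $$ (i, j) = (H * D) $$ (i, j)" .
  qed (use carr in auto)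
  define Q where "Q = inverse (real n) \<cdot>\<^sub>m H"
  have Q: "Q \<in> carrier_mat n n" using carr by (simp add: Q_def)
  have HQ: "H * Q = 1\<^sub>m n" unfolding Q_def
    using carr n by (simp add: mult_smult_distrib[OF carr(3) carr(3)] HH) (auto intro!: eq_matI)
  have QH: "Q * H = 1\<^sub>m n" unfolding Q_def
    using carr n by (simp add: mult_smult_assoc_mat[OF carr(3) carr(3)] HH) (auto intro!: eq_matI)
  have "A = A * (H * Q)" using carr(1) by (simp add: HQ)
  also have "\<dots> = A * H * Q" by (rule assoc_mult_mat[OF carr(1,3) Q, symmetric])
  finally have "similar_mat A D" unfolding AH
    by (intro similar_matI[of _ _ H Q n] HQ QH) (use carr Q in auto)
  then have "char_poly A = char_poly D" by (rule char_poly_similar)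
  also have "\<dots> = (\<Prod>a\<leftarrow>diag_mat D. [:- a, 1:])"
    by (rule char_poly_upper_triangular[OF carr(2)]) (auto simp: D_def mat_diag_def)
  also have "diag_mat D = map (circ_eigenvalue n x) [0..<n]"
    by (auto simp: diag_mat_def D_def mat_diag_def intro!: nth_equalityI)
  finally show ?thesis by (simp add: A_def comp_def)
qed

section \<open>Spectral distributions as laws of a random eigenvalue\<close>

text \<open>The algebraic multiplicity of an eigenvalue is the number of frequencies at which it is attained.\<close>

lemma esd_sym_circulant_fun:
  assumes n: "n > 0"
  shows "(\<Sum>l | eigenvalue (sym_circulant n x) l.
      of_nat (order l (char_poly (sym_circulant n x))) * indicator B l) =
    (\<Sum>j<n. indicator B (circ_eigenvalue n x j) :: ennreal)"
proof -
  let ?A = "sym_circulant n x" and ?e = "circ_eigenvalue n x"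
  have ev: "{l. eigenvalue ?A l} = ?e ` {..<n}"
  proof -
    have "eigenvalue ?A l \<longleftrightarrow> (\<exists>j<n. ?e j = l)" for l
    proof -
      have "eigenvalue ?A l \<longleftrightarrow> (\<Prod>j\<leftarrow>[0..<n]. poly [:- ?e j, 1:] l) = 0"
        by (simp only: eigenvalue_root_char_poly[OF sym_circulant_carrier] char_poly_sym_circulant[OF n]
            poly_prod_list map_map comp_def)
      also have "\<dots> \<longleftrightarrow> (\<exists>j<n. poly [:- ?e j, 1:] l = 0)"
      proof -
        have "0 \<in> set (map f [0..<m]) \<longleftrightarrow> (\<exists>j<m. f j = 0)" for f :: "nat \<Rightarrow> real" and m
          by (induction m) (auto simp: less_Suc_eq)
        then show ?thesis by (simp only: prod_list_zero_iff)
      qed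
      also have "\<dots> \<longleftrightarrow> (\<exists>j<n. ?e j = l)" by auto
      finally show ?thesis .
    qed
    then show ?thesis by (auto simp: image_iff)
  qed
  have ord: "order l (char_poly ?A) = card {j \<in> {..<n}. ?e j = l}" for l
  proof -
    have nz: "p \<noteq> 0" if "p \<in> set (map (\<lambda>j. [:- ?e j, 1:]) [0..<n])" for p
      using that by (auto simp only: set_map pCons_eq_0_iff)
    from order_prod_list[OF nz, where x = l]
    have "order l (char_poly ?A) = (\<Sum>j\<leftarrow>[0..<n]. order l [:- ?e j, 1:])"
      unfolding char_poly_sym_circulant[OF n] by (simp only: map_map comp_def)
    also have "\<dots> = (\<Sum>j<n. order l [:- ?e j, 1:])"
      by (simp only: interv_sum_list_conv_sum_set_nat set_upt atLeast0LessThan)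
    also have "\<dots> = (\<Sum>j<n. if ?e j = l then 1 else 0)"
      by (rule sum.cong) (simp_all only: order_linear' neg_equal_iff_equal)
    also have "\<dots> = card {j \<in> {..<n}. ?e j = l}" by (simp add: sum.If_cases Int_def)
    finally show ?thesis .
  qed
  have "(\<Sum>l | eigenvalue ?A l. of_nat (order l (char_poly ?A)) * indicator B l :: ennreal) =
    (\<Sum>l\<in>?e ` {..<n}. \<Sum>j | j \<in> {..<n} \<and> ?e j = l. indicator B (?e j))"
    unfolding ev
  proof (rule sum.cong[OF refl])
    fix l
    have "(\<Sum>j | j \<in> {..<n} \<and> ?e j = l. indicator B (?e j) :: ennreal) = (\<Sum>j | j \<in> {..<n} \<and> ?e j =
        l. indicator B l)"
      by (rule sum.cong) auto
    then show "of_nat (order l (char_poly ?A)) * indicator B l = (\<Sum>j | j \<in> {..<n} \<and> ?e j =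
        l. indicator B (?e j) :: ennreal)"
      by (simp only: ord sum_constant)
  qed
  also have "\<dots> = (\<Sum>j<n. indicator B (?e j))" by (rule sum.group) auto
  finally show ?thesis .
qed

lemma esd_sym_circulant:
  assumes n: "n > 0"
  shows "esd (sym_circulant n x) = distr (uniform_count_measure {..<n}) borel (circ_eigenvalue n x)"
    (is "_ = ?D")
proof -
  have "esd (sym_circulant n x) = measure_of (space ?D) (sets ?D) (emeasure ?D)"
    unfolding esd_def esd_sym_circulant_fun[OF n] space_distr sets_distr space_borel
  proof (rule measure_of_eq)
    fix B :: "real set" assume "B \<in> sigma_sets UNIV (sets borel)"
    then have B: "B \<in> sets borel" using sets.sigma_sets_eq[of "borel :: real measure"] by simp
    have "emeasure ?D B = ennreal (real (card {j \<in> {..<n}. circ_eigenvalue n x j \<in> B}) / real n)"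
      using n B by (subst emeasure_distr)
        (auto simp: emeasure_uniform_count_measure space_uniform_count_measure sets_uniform_count_measure
           measurable_def intro!: arg_cong[where f = card])
    also have "\<dots> = ennreal (real (card {j \<in> {..<n}. circ_eigenvalue n x j \<in> B})) / ennreal (real n)"
      using n by (simp add: divide_ennreal)
    also have "ennreal (real (card {j \<in> {..<n}. circ_eigenvalue n x j \<in> B})) =
        (\<Sum>j<n. indicator B (circ_eigenvalue n x j))"
      by (simp add: indicator_def sum.If_cases Int_def ennreal_of_nat_eq_real_of_nat)
    finally show "(\<Sum>j<n. indicator B (circ_eigenvalue n x j)) / of_nat (dim_row (sym_circulant n x)) = emeasure ?D B"
      by (simp add: ennreal_of_nat_eq_real_of_nat sym_circulant_def)
  qed auto
  then show ?thesis by (simp only: measure_of_of_measure)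
qed

lemma circ_eigenvalue_measurable:
  assumes "\<And>l. l \<le> n div 2 \<Longrightarrow> x l \<in> borel_measurable M"
  shows "(\<lambda>(\<omega>, j). circ_eigenvalue n (\<lambda>i. x i \<omega>) j) \<in> borel_measurable (M \<Otimes>\<^sub>M uniform_count_measure {..<n})"
  unfolding circ_eigenvalue_def split_beta
proof (intro borel_measurable_sum borel_measurable_times)
  fix l assume "l \<in> {..n div 2}"
  then show "(\<lambda>p. x l (fst p)) \<in> borel_measurable (M \<Otimes>\<^sub>M uniform_count_measure {..<n})"
    using assms by (intro measurable_compose[OF measurable_fst]) auto
  show "(\<lambda>p. circ_weight n (snd p) l) \<in> borel_measurable (M \<Otimes>\<^sub>M uniform_count_measure {..<n})"
    by (rule measurable_compose[OF measurable_snd])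
       (auto simp: measurable_def sets_uniform_count_measure space_uniform_count_measure)
qed

text \<open>Averaging over the eigenvalues of a matrix is averaging over a uniform frequency, and the expectation
makes this frequency independent of the entries.\<close>

lemma eesd_sym_circulant:
  assumes n: "n > 0" and "prob_space M"
    and x: "\<And>l. l \<le> n div 2 \<Longrightarrow> x l \<in> borel_measurable M"
  shows "eesd M (\<lambda>\<omega>. sym_circulant n (\<lambda>i. x i \<omega>)) =
    distr (M \<Otimes>\<^sub>M uniform_count_measure {..<n}) borel (\<lambda>(\<omega>, j). circ_eigenvalue n (\<lambda>i. x i \<omega>) j)"
    (is "_ = ?D")
proof -
  interpret M: prob_space M by fact
  interpret U: prob_space "uniform_count_measure {..<n}"
    using n by (intro prob_space_uniform_count_measure) auto
  have "eesd M (\<lambda>\<omega>. sym_circulant n (\<lambda>i. x i \<omega>)) = measure_of (space ?D) (sets ?D) (emeasure ?D)"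
    unfolding eesd_def space_distr sets_distr space_borel
  proof (rule measure_of_eq)
    fix B :: "real set" assume "B \<in> sigma_sets UNIV (sets borel)"
    then have B: "B \<in> sets borel" using sets.sigma_sets_eq[of "borel :: real measure"] by simp
    let ?L = "\<lambda>(\<omega>, j). circ_eigenvalue n (\<lambda>i. x i \<omega>) j"
    let ?P = "M \<Otimes>\<^sub>M uniform_count_measure {..<n}"
    have L: "?L \<in> borel_measurable ?P" by (rule circ_eigenvalue_measurable[OF x])
    have "emeasure ?D B = emeasure ?P (?L -` B \<inter> space ?P)"
      by (rule emeasure_distr[OF L B])
    also have "\<dots> = (\<integral>\<^sup>+\<omega>. emeasure (uniform_count_measure {..<n}) (Pair \<omega> -` (?L -` B \<inter> space ?P)) \<partial>M)"
      by (rule U.emeasure_pair_measure_alt) (rule measurable_sets[OF L B])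
    also have "\<dots> = (\<integral>\<^sup>+\<omega>. emeasure (esd (sym_circulant n (\<lambda>i. x i \<omega>))) B \<partial>M)"
    proof (rule nn_integral_cong)
      fix \<omega> assume w: "\<omega> \<in> space M"
      have "emeasure (esd (sym_circulant n (\<lambda>i. x i \<omega>))) B = emeasure (uniform_count_measure {..<n})
          (circ_eigenvalue n (\<lambda>i. x i \<omega>) -` B \<inter> space (uniform_count_measure {..<n}))"
        unfolding esd_sym_circulant[OF n]
        by (rule emeasure_distr[OF _ B]) (auto simp: measurable_def sets_uniform_count_measure space_uniform_count_measure)
      moreover have "Pair \<omega> -` (?L -` B \<inter> space ?P) =
          circ_eigenvalue n (\<lambda>i. x i \<omega>) -` B \<inter> space (uniform_count_measure {..<n})"
        using w by (auto simp: space_pair_measure)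
      ultimately show "emeasure (uniform_count_measure {..<n}) (Pair \<omega> -` (?L -` B \<inter> space ?P)) =
          emeasure (esd (sym_circulant n (\<lambda>i. x i \<omega>))) B" by simp
    qed
    finally show "(\<integral>\<^sup>+\<omega>. emeasure (esd (sym_circulant n (\<lambda>i. x i \<omega>))) B \<partial>M) =
        emeasure ?D B" ..
  qed auto
  then show ?thesis by (simp only: measure_of_of_measure)
qed

lemma eesd_sym_circulant_char:
  assumes n: "n > 0" and "prob_space M"
    and x: "\<And>l. l \<le> n div 2 \<Longrightarrow> x l \<in> borel_measurable M"
  shows "real_distribution (eesd M (\<lambda>\<omega>. sym_circulant n (\<lambda>i. x i \<omega>)))" (is ?thesis1)
    and "char (eesd M (\<lambda>\<omega>. sym_circulant n (\<lambda>i. x i \<omega>))) t =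
      (\<Sum>j<n. \<integral>\<omega>. iexp (t * circ_eigenvalue n (\<lambda>i. x i \<omega>) j) \<partial>M) / of_nat n" (is ?thesis2)
proof -
  interpret M: prob_space M by fact
  interpret U: prob_space "uniform_count_measure {..<n}"
    using n by (intro prob_space_uniform_count_measure) auto
  interpret P: pair_prob_space M "uniform_count_measure {..<n}" ..
  let ?L = "\<lambda>(\<omega>, j). circ_eigenvalue n (\<lambda>i. x i \<omega>) j"
  let ?P = "M \<Otimes>\<^sub>M uniform_count_measure {..<n}"
  have L: "?L \<in> borel_measurable ?P" by (rule circ_eigenvalue_measurable[OF x])
  have D: "eesd M (\<lambda>\<omega>. sym_circulant n (\<lambda>i. x i \<omega>)) = distr ?P borel ?L"
    by (rule eesd_sym_circulant[OF assms])
  show ?thesis1 unfolding D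
    by (rule P.P.real_distribution_distr[OF L])
  have "char (eesd M (\<lambda>\<omega>. sym_circulant n (\<lambda>i. x i \<omega>))) t =
      (\<integral>p. iexp (t * ?L p) \<partial>?P)"
    unfolding char_def D
    by (rule integral_distr[OF L]) simp
  also have "\<dots> = (\<integral>p. (\<lambda>(\<omega>, j). iexp (t * circ_eigenvalue n (\<lambda>i. x i \<omega>) j)) p \<partial>?P)"
    by (simp add: split_beta)
  also have "\<dots> = (\<integral>j. \<integral>\<omega>. iexp (t * circ_eigenvalue n (\<lambda>i. x i \<omega>) j) \<partial>M \<partial>uniform_count_measure {..<n})"
  proof (rule P.integral_snd[symmetric])
    have "integrable ?P (\<lambda>p. iexp (t * ?L p))"
      by (rule P.P.integrable_const_bound[of _ 1]) (use L in auto)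
    then show "integrable ?P (\<lambda>(\<omega>, j). iexp (t * circ_eigenvalue n (\<lambda>i. x i \<omega>) j))"
      unfolding split_beta .
  qed
  also have "\<dots> = (\<Sum>j<n. \<integral>\<omega>. iexp (t * circ_eigenvalue n (\<lambda>i. x i \<omega>) j) \<partial>M) / of_nat n"
    by (simp add: uniform_count_measure_def lebesgue_integral_point_measure_finite sum_divide_distrib scaleR_conv_of_real)
  finally show ?thesis2 .
qed

section \<open>Mean squares over the frequency\<close>

text \<open>The values \<open>q l + c\<close> for \<open>l < n\<close> are distinct and lie in an interval of length \<open>q n\<close>, which contains
exactly \<open>q\<close> multiples of \<open>n\<close>.\<close>

lemma card_multiples_in_progression_le:
  fixes c :: int
  assumes n: "n > 0" and q: "q > 0"
  shows "card {l. l < n \<and> int n dvd int q * int l + c} \<le> q"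
proof -
  let ?S = "{l. l < n \<and> int n dvd int q * int l + c}"
  define a where "a = - ((- c) div int n)"
  define f where "f l = (int q * int l + c) div int n" for l
  have nf: "int n * f l = int q * int l + c" if "l \<in> ?S" for l
    using that by (simp add: f_def)
  have a: "c \<le> int n * a"
  proof -
    have "int n * ((- c) div int n) \<le> - c" using n
        by (metis mult_div_mod_eq of_nat_0_less_iff pos_mod_sign le_add_same_cancel1)
    then show ?thesis by (simp add: a_def)
  qed
  have inj: "inj_on f ?S"
  proof (rule inj_onI)
    fix l l' assume "l \<in> ?S" "l' \<in> ?S" "f l = f l'"
    then have "int q * int l + c = int q * int l' + c" using nf by metis
    then show "l = l'" using q by simp
  qed
  have "f ` ?S \<subseteq> {a..<a + int q}"
  proof (rule image_subsetI)
    fix l assume l: "l \<in> ?S"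
    have "a \<le> f l"
    proof -
      have "- (int q * int l + c) \<le> - c" by simp
      then have "- (int n * f l) div int n \<le> (- c) div int n" unfolding nf[OF l]
        using n by (intro zdiv_mono1) auto
      moreover have "- (int n * f l) div int n = - f l" using n
        by (metis mult_minus_right nonzero_mult_div_cancel_left of_nat_eq_0_iff less_numeral_extra(3))
      ultimately show ?thesis by (simp add: a_def)
    qed
    moreover have "f l < a + int q"
    proof (rule ccontr)
      assume "\<not> f l < a + int q"
      then have "int n * (a + int q) \<le> int n * f l" by (intro mult_left_mono) auto
      then have "int n * int q \<le> int q * int l" using a nf[OF l] by (simp add: algebra_simps)
      then show False using l q by (simp add: mult.commute flip: of_nat_mult)
    qed
    ultimately show "f l \<in> {a..<a + int q}" by simp
  qed
  then have "card ?S \<le> card {a..<a + int q}"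
    by (rule card_inj_on_le[OF inj]) simp
  then show ?thesis by simp
qed

text \<open>For \<open>q = 1\<close> this is Bessel's inequality. For larger \<open>q\<close> the frequencies \<open>q l\<close> may coincide modulo
\<open>n\<close>, but each residue class is met at most \<open>q\<close> times, so the normalised Gram matrix of the cosines has
row sums at most \<open>q\<close> and Schur's test applies.\<close>

lemma cos_sum_parseval_bound:
  fixes \<tau> :: "nat \<Rightarrow> real"
  assumes n: "n > 0" and q: "q > 0" and L: "L \<subseteq> {..<n}"
  shows "(\<Sum>j<n. (\<Sum>l\<in>L. \<tau> l * cos (real q * (angle n j l)))\<^sup>2) / real n
    \<le> real q * (\<Sum>l\<in>L. (\<tau> l)\<^sup>2)"
proof -
  let ?c = "\<lambda>l j. cos (real q * (angle n j l))"
  define D where "D m = (if int n dvd m then 1 else 0 :: real)" for m :: int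
  define K where "K l k = (D (int q * int l - int q * int k) + D (int q * int l + int q * int k)) / 2" for l k
  have K0: "K l k \<ge> 0" for l k by (simp add: K_def D_def)
  have Ksym: "K l k = K k l" for l k
  proof -
    have "int n dvd int q * int l - int q * int k \<longleftrightarrow> int n dvd int q * int k - int q * int l"
      by (metis dvd_minus_iff minus_diff_eq)
    then show ?thesis by (simp add: K_def D_def add.commute)
  qed
  have finL: "finite L" using L finite_subset by blast
  have orth: "(\<Sum>j<n. ?c l j * ?c k j) = real n * K l k" for l k
  proof -
    have "?c l j * ?c k j = (cos (2 * pi * real j * real_of_int (int q * int l - int q * int k) / real n)
        + cos (2 * pi * real j * real_of_int (int q * int l + int q * int k) / real n)) / 2" for j
    proof -
      have "cos u * cos v = (cos (u - v) + cos (u + v)) / 2" for u v :: real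
        by (simp add: cos_diff cos_add)
      moreover have "real q * (angle n j l) - real q * (angle n j k) =
          2 * pi * real j * real_of_int (int q * int l - int q * int k) / real n"
        by (simp add: diff_divide_distrib right_diff_distrib mult_ac)
      moreover have "real q * (angle n j l) + real q * (angle n j k) =
          2 * pi * real j * real_of_int (int q * int l + int q * int k) / real n"
        by (simp add: add_divide_distrib distrib_left mult_ac)
      ultimately show ?thesis by (simp only:)
    qed
    then have "(\<Sum>j<n. ?c l j * ?c k j) =
        ((\<Sum>j<n. cos (2 * pi * real j * real_of_int (int q * int l - int q * int k) / real n))
      + (\<Sum>j<n. cos (2 * pi * real j * real_of_int (int q * int l + int q * int k) / real n))) / 2"
      by (simp only: sum.distrib sum_divide_distrib[symmetric])
    then show ?thesis by (simp only: sum_cos_sin_multiples[OF n]) (simp add: K_def D_def)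
  qed
  have row: "(\<Sum>k\<in>L. K l k) \<le> real q" for l
  proof -
    have D1: "(\<Sum>k\<in>L. D (int q * int k + c)) \<le> real q" for c
    proof -
      have "(\<Sum>k\<in>L. D (int q * int k + c)) \<le> (\<Sum>k<n. D (int q * int k + c))"
        using L by (intro sum_mono2) (auto simp: D_def)
      also have "\<dots> = real (card {l. l < n \<and> int n dvd int q * int l + c})"
        by (simp add: D_def sum.If_cases Int_def)
      also have "\<dots> \<le> real q" using card_multiples_in_progression_le[OF n q] by simp
      finally show ?thesis .
    qed
    have "D (int q * int l - int q * int k) = D (int q * int k + (- (int q * int l)))" for k
      unfolding D_def using dvd_minus_iff[of "int n" "int q * int l - int q * int k"] by simp
    then have "(\<Sum>k\<in>L. K l k) = ((\<Sum>k\<in>L. D (int q * int k + (- (int q * int l)))) +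
        (\<Sum>k\<in>L. D (int q * int k + int q * int l))) / 2"
      unfolding K_def by (simp only: sum.distrib sum_divide_distrib[symmetric] add.commute[of "int q * int l"])
    also have "\<dots> \<le> (real q + real q) / 2" by (intro divide_right_mono add_mono D1) auto
    finally show ?thesis by simp
  qed
  have "(\<Sum>j<n. (\<Sum>l\<in>L. \<tau> l * ?c l j)\<^sup>2) =
      (\<Sum>j<n. \<Sum>l\<in>L. \<Sum>k\<in>L. (\<tau> l * \<tau> k) * (?c l j * ?c k j))"
    unfolding power2_eq_square sum_product by (intro sum.cong refl) (simp only: mult_ac)
  also have "\<dots> = (\<Sum>l\<in>L. \<Sum>k\<in>L. (\<tau> l * \<tau> k) * (\<Sum>j<n. ?c l j * ?c k j))"
    unfolding sum_distrib_left by (subst sum.swap, rule sum.cong[OF refl], rule sum.swap)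
  also have "\<dots> = real n * (\<Sum>l\<in>L. \<Sum>k\<in>L. (\<tau> l * \<tau> k) * K l k)"
    unfolding orth sum_distrib_left by (intro sum.cong refl) (simp only: mult_ac)
  also have "(\<Sum>l\<in>L. \<Sum>k\<in>L. (\<tau> l * \<tau> k) * K l k) \<le>
      (\<Sum>l\<in>L. \<Sum>k\<in>L. ((\<tau> l)\<^sup>2 / 2 + (\<tau> k)\<^sup>2 / 2) * K l k)"
  proof (intro sum_mono mult_right_mono K0)
    fix l k
    have "0 \<le> (\<tau> l - \<tau> k)\<^sup>2" by simp
    then show "\<tau> l * \<tau> k \<le> (\<tau> l)\<^sup>2 / 2 + (\<tau> k)\<^sup>2 / 2" unfolding power2_diff by simp
  qed
  also have "\<dots> = (\<Sum>l\<in>L. \<Sum>k\<in>L. (\<tau> l)\<^sup>2 / 2 * K l k) +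
      (\<Sum>l\<in>L. \<Sum>k\<in>L. (\<tau> k)\<^sup>2 / 2 * K l k)"
    by (simp only: distrib_right sum.distrib)
  also have "(\<Sum>l\<in>L. \<Sum>k\<in>L. (\<tau> k)\<^sup>2 / 2 * K l k) =
      (\<Sum>l\<in>L. \<Sum>k\<in>L. (\<tau> l)\<^sup>2 / 2 * K l k)"
    by (subst sum.swap) (simp only: Ksym)
  also have "(\<Sum>l\<in>L. \<Sum>k\<in>L. (\<tau> l)\<^sup>2 / 2 * K l k) +
      (\<Sum>l\<in>L. \<Sum>k\<in>L. (\<tau> l)\<^sup>2 / 2 * K l k) =
      (\<Sum>l\<in>L. (\<tau> l)\<^sup>2 * (\<Sum>k\<in>L. K l k))"
    unfolding sum.distrib[symmetric] sum_distrib_left by (intro sum.cong refl) (simp add: field_simps)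
  also have "\<dots> \<le> (\<Sum>l\<in>L. (\<tau> l)\<^sup>2 * real q)" by (intro sum_mono mult_left_mono row) auto
  finally show ?thesis using n by (simp add: field_simps sum_distrib_left)
qed

lemma cos_power_expand:
  "(2 * cos \<theta>) ^ p = (\<Sum>s\<le>p. real (p choose s) * cos ((real p - 2 * real s) * \<theta>))"
proof -
  have "(complex_of_real (2 * cos \<theta>)) ^ p = (cis \<theta> + cis (- \<theta>)) ^ p"
    by (simp add: complex_eq_iff)
  also have "\<dots> = (\<Sum>s\<le>p. of_nat (p choose s) * cis \<theta> ^ s * cis (- \<theta>) ^ (p - s))"
    by (rule binomial_ring)
  also have "\<dots> = (\<Sum>s\<le>p. of_nat (p choose s) * cis (- ((real p - 2 * real s) * \<theta>)))"
  proof (rule sum.cong[OF refl])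
    fix s assume "s \<in> {..p}"
    then have "real s * \<theta> + real (p - s) * - \<theta> = - ((real p - 2 * real s) * \<theta>)"
      by (simp add: of_nat_diff algebra_simps)
    then show "of_nat (p choose s) * cis \<theta> ^ s * cis (- \<theta>) ^ (p - s) =
        of_nat (p choose s) * cis (- ((real p - 2 * real s) * \<theta>))"
      by (simp only: Complex.DeMoivre cis_mult mult.assoc)
  qed
  finally have "Re ((complex_of_real (2 * cos \<theta>)) ^ p) =
      Re (\<Sum>s\<le>p. of_nat (p choose s) * cis (- ((real p - 2 * real s) * \<theta>)))"
    by simp
  moreover have "Re ((complex_of_real y) ^ p) = y ^ p" for y
    by (metis Re_complex_of_real of_real_power)
  moreover have "Re (of_nat c * cis (- u)) = real c * cos u" for c u by simp
  ultimately show ?thesis by (simp only: Re_sum)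
qed

text \<open>The factor that turns \<open>2 cos\<close> into the weight \<open>circ_weight\<close>.\<close>

definition half_weight :: "nat \<Rightarrow> nat \<Rightarrow> real" where
  "half_weight n l = (if l = 0 \<or> 2 * l = n then 1 / 2 else 1)"

text \<open>The constant Fourier coefficient of \<open>(2 cos \<theta>)\<^sup>p\<close>.\<close>

definition central_coeff :: "nat \<Rightarrow> real" where
  "central_coeff p = (if even p then real (p choose (p div 2)) else 0)"

definition parseval_const :: "nat \<Rightarrow> real" where
  "parseval_const p = real (Suc p) * (\<Sum>s\<le>p. (real (p choose s))\<^sup>2 * real p)"

text \<open>In the cosine expansion of \<open>(2 cos \<theta>)\<^sup>p\<close> the constant term gives the subtracted mean; every other
term is a cosine sum with a nonzero frequency multiplier of modulus at most \<open>p\<close>, and the bound for cosine sums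
applies to it.\<close>

lemma circ_weight_power_mean_square:
  fixes \<rho> :: "nat \<Rightarrow> real"
  assumes n: "n > 0"
  shows "(\<Sum>j<n. ((\<Sum>l\<le>n div 2. \<rho> l * circ_weight n j l ^ p) - central_coeff p * (\<Sum>l\<le>n div 2. \<rho> l * half_weight n l ^ p))\<^sup>2) / real n
    \<le> parseval_const p * (\<Sum>l\<le>n div 2. (\<rho> l)\<^sup>2)"
proof -
  let ?L = "{..n div 2}"
  let ?\<theta> = "\<lambda>j l. angle n j l"
  \<comment> \<open>\<open>I\<close> collects the terms with a nonzero frequency multiplier \<open>p - 2s\<close>.\<close>
  define \<tau> where "\<tau> l = \<rho> l * half_weight n l ^ p" for l
  define I where "I = {s \<in> {..p}. 2 * s \<noteq> p}"
  define T where "T s j = (\<Sum>l\<in>?L. \<tau> l * cos ((real p - 2 * real s) * ?\<theta> j l))" for s j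
  have L: "?L \<subseteq> {..<n}" using n by auto
  have S: "(\<Sum>l\<le>n div 2. \<rho> l * circ_weight n j l ^ p) - central_coeff p * (\<Sum>l\<le>n div 2. \<tau> l) =
      (\<Sum>s\<in>I. real (p choose s) * T s j)" for j
  proof -
    have "\<rho> l * circ_weight n j l ^ p =
        \<tau> l * (\<Sum>s\<le>p. real (p choose s) * cos ((real p - 2 * real s) * ?\<theta> j l))" for l
    proof -
      have "circ_weight n j l = half_weight n l * (2 * cos (?\<theta> j l))"
        by (simp add: circ_weight_def half_weight_def)
      then show ?thesis unfolding cos_power_expand[symmetric] \<tau>_def by (simp only: power_mult_distrib mult.assoc)
    qed
    then have "(\<Sum>l\<le>n div 2. \<rho> l * circ_weight n j l ^ p) =
        (\<Sum>l\<in>?L. \<Sum>s\<le>p. real (p choose s) * (\<tau> l * cos ((real p - 2 * real s) * ?\<theta> j l)))"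
      by (simp only: sum_distrib_left mult.left_commute)
    also have "\<dots> = (\<Sum>s\<le>p. real (p choose s) * T s j)"
      unfolding T_def sum_distrib_left by (rule sum.swap)
    also have "\<dots> = (\<Sum>s\<in>I. real (p choose s) * T s j) + (\<Sum>s\<in>{s \<in> {..p}. 2 * s =
        p}. real (p choose s) * T s j)"
      unfolding I_def by (subst sum.union_disjoint[symmetric]) (auto intro!: sum.cong)
    also have "(\<Sum>s\<in>{s \<in> {..p}. 2 * s = p}. real (p choose s) * T s j) =
        central_coeff p * (\<Sum>l\<le>n div 2. \<tau> l)"
    proof (cases "even p")
      case True
      then obtain m where m: "p = 2 * m" by (elim evenE)
      then have "{s \<in> {..p}. 2 * s = p} = {m}" by auto
      then show ?thesis using m by (simp add: T_def central_coeff_def)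
    next
      case False
      then have e: "{s \<in> {..p}. 2 * s = p} = {}" by auto
      show ?thesis unfolding e using False by (simp add: central_coeff_def)
    qed
    finally show ?thesis by simp
  qed
  have T: "(\<Sum>j<n. (T s j)\<^sup>2) / real n \<le> real p * (\<Sum>l\<in>?L. (\<rho> l)\<^sup>2)" if s: "s \<in> I" for s
  proof -
    define q where "q = nat \<bar>int p - 2 * int s\<bar>"
    have q: "q > 0" "q \<le> p" using s by (auto simp: I_def q_def)
    have "\<bar>real p - 2 * real s\<bar> = real q" by (simp add: q_def)
    then have "cos ((real p - 2 * real s) * u) = cos (real q * u)" for u
      by (metis abs_mult cos_abs_real abs_of_nat)
    then have "(\<Sum>j<n. (T s j)\<^sup>2) / real n =
        (\<Sum>j<n. (\<Sum>l\<in>?L. \<tau> l * cos (real q * ?\<theta> j l))\<^sup>2) / real n"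
      by (simp only: T_def)
    also have "\<dots> \<le> real q * (\<Sum>l\<in>?L. (\<tau> l)\<^sup>2)" by (rule cos_sum_parseval_bound[OF n q(1) L])
    also have "\<dots> \<le> real p * (\<Sum>l\<in>?L. (\<rho> l)\<^sup>2)"
    proof (intro mult_mono sum_mono)
      fix l
      have "\<bar>half_weight n l ^ p\<bar> \<le> 1" by (auto simp: half_weight_def power_abs intro!: power_le_one)
      then have "\<bar>\<tau> l\<bar> \<le> \<bar>\<rho> l\<bar>" unfolding \<tau>_def abs_mult
          by (intro mult_right_le_one_le) auto
      then show "(\<tau> l)\<^sup>2 \<le> (\<rho> l)\<^sup>2" by (simp only: abs_le_square_iff)
    qed (use q in \<open>auto intro: sum_nonneg\<close>)
    finally show ?thesis .
  qed
  have finI: "finite I" "card I \<le> Suc p" "I \<subseteq> {..p}" unfolding I_def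
      by (auto intro: order.trans[OF card_mono[of "{..p}"]])
  have "(\<Sum>j<n. (\<Sum>s\<in>I. real (p choose s) * T s j)\<^sup>2) / real n \<le>
      (\<Sum>j<n. (\<Sum>s\<in>I. (real (p choose s) * T s j)\<^sup>2) * real (Suc p)) / real n"
  proof (intro divide_right_mono sum_mono)
    fix j
    have "(\<Sum>s\<in>I. real (p choose s) * T s j)\<^sup>2 \<le>
        (\<Sum>s\<in>I. (real (p choose s) * T s j)\<^sup>2) * real (card I)"
      by (rule sum_squared_le_sum_of_squares)
    also have "\<dots> \<le> (\<Sum>s\<in>I. (real (p choose s) * T s j)\<^sup>2) * real (Suc p)"
      using finI by (intro mult_left_mono sum_nonneg) auto
    finally show "(\<Sum>s\<in>I. real (p choose s) * T s j)\<^sup>2 \<le>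
        (\<Sum>s\<in>I. (real (p choose s) * T s j)\<^sup>2) * real (Suc p)" .
  qed auto
  also have "\<dots> = real (Suc p) * (\<Sum>s\<in>I. (real (p choose s))\<^sup>2 * ((\<Sum>j<n. (T s j)\<^sup>2) / real n))"
  proof -
    have "(\<Sum>j<n. \<Sum>s\<in>I. (real (p choose s) * T s j)\<^sup>2) =
        (\<Sum>s\<in>I. (real (p choose s))\<^sup>2 * (\<Sum>j<n. (T s j)\<^sup>2))"
      unfolding power_mult_distrib sum_distrib_left by (rule sum.swap)
    then show ?thesis
      unfolding sum_distrib_right[symmetric] times_divide_eq_right sum_divide_distrib[symmetric] by (simp only: mult.commute)
  qed
  also have "\<dots> \<le> real (Suc p) * (\<Sum>s\<in>I. (real (p choose s))\<^sup>2 * (real p * (\<Sum>l\<in>?L. (\<rho> l)\<^sup>2)))"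
    by (intro mult_left_mono sum_mono T) auto
  also have "\<dots> \<le> real (Suc p) * (\<Sum>s\<le>p. (real (p choose s))\<^sup>2 * (real p * (\<Sum>l\<in>?L. (\<rho> l)\<^sup>2)))"
    using finI by (intro mult_left_mono sum_mono2) (auto intro!: mult_nonneg_nonneg sum_nonneg)
  also have "\<dots> = parseval_const p * (\<Sum>l\<le>n div 2. (\<rho> l)\<^sup>2)"
    by (simp only: parseval_const_def sum_distrib_right mult.assoc)
  finally show ?thesis unfolding S[symmetric] \<tau>_def .
qed

lemma circ_eigenvalue_mean_square:
  assumes n: "n > 0"
  shows "(\<Sum>j<n. (circ_eigenvalue n r j)\<^sup>2) / real n \<le> 4 * (\<Sum>l\<le>n div 2. (r l)\<^sup>2)"
proof -
  have L: "{..n div 2} \<subseteq> {..<n}" using n by auto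
  define \<tau> where "\<tau> l = (if l = 0 \<or> 2 * l = n then 1 else 2) * r l" for l
  have "circ_eigenvalue n r j = (\<Sum>l\<le>n div 2. \<tau> l * cos (real 1 * (angle n j l)))" for j
    by (simp add: circ_eigenvalue_def circ_weight_def \<tau>_def mult_ac)
  then have "(\<Sum>j<n. (circ_eigenvalue n r j)\<^sup>2) / real n \<le> real 1 * (\<Sum>l\<le>n div 2. (\<tau> l)\<^sup>2)"
    using cos_sum_parseval_bound[of n 1 "{..n div 2}" \<tau>] n L by simp
  also have "\<dots> \<le> 4 * (\<Sum>l\<le>n div 2. (r l)\<^sup>2)"
    by (simp add: sum_distrib_left \<tau>_def power_mult_distrib) (rule sum_mono, simp)
  finally show ?thesis .
qed

section \<open>Riemann sums over half of the grid\<close>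

text \<open>A Riemann integrable function is Henstock-Kurzweil integrable, and its gauges may be taken of constant
radius. The latter is what Riemann sums over a fixed grid require.\<close>

lemma Riemann_integrable_onD:
  assumes "Riemann_integrable_on f a b"
  shows "f integrable_on {a..b}"
    and "\<And>e. e > 0 \<Longrightarrow>
        \<exists>d>0. \<forall>p. p tagged_division_of {a..b} \<and> (\<lambda>x. ball x d) fine p \<longrightarrow>
      \<bar>(\<Sum>(x, K)\<in>p. measure lborel K * f x) - integral {a..b} f\<bar> < e"
proof -
  obtain I where I: "\<And>e. e > 0 \<Longrightarrow>
      \<exists>d>0. \<forall>p. p tagged_division_of {a..b} \<and> (\<lambda>x. ball x d) fine p \<longrightarrow>
        \<bar>(\<Sum>(x, K)\<in>p. measure lborel K * f x) - I\<bar> < e"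
    using assms unfolding Riemann_integrable_on_def by blast
  have hi: "(f has_integral I) (cbox a b)"
    unfolding has_integral
  proof (intro allI impI)
    fix e :: real assume "e > 0"
    then obtain d where d: "d > 0" "\<And>p. p tagged_division_of {a..b} \<and> (\<lambda>x. ball x d) fine p \<Longrightarrow>
        \<bar>(\<Sum>(x, K)\<in>p. measure lborel K * f x) - I\<bar> < e" using I by blast
    show "\<exists>\<gamma>. gauge \<gamma> \<and> (\<forall>\<D>. \<D> tagged_division_of cbox a b \<and> \<gamma> fine \<D> \<longrightarrow>
        norm ((\<Sum>(x, k)\<in>\<D>. measure lborel k *\<^sub>R f x) - I) < e)"
      using d by (intro exI[of _ "\<lambda>x. ball x d"]) (auto simp: gauge_ball)
  qed
  then show "f integrable_on {a..b}" by (auto simp: integrable_on_def)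
  have "integral {a..b} f = I" using hi by (simp add: integral_unique)
  with I show "\<And>e. e > 0 \<Longrightarrow>
      \<exists>d>0. \<forall>p. p tagged_division_of {a..b} \<and> (\<lambda>x. ball x d) fine p \<longrightarrow>
      \<bar>(\<Sum>(x, K)\<in>p. measure lborel K * f x) - integral {a..b} f\<bar> < e" by blast
qed

lemma integral_sum_grid:
  fixes f :: "real \<Rightarrow> real"
  assumes "f integrable_on {0..1}" "n > 0" "N \<le> n"
  shows "(\<Sum>l<N. integral {real l / real n..real (Suc l) / real n} f) = integral {0..real N / real n} f"
  using assms(3)
proof (induction N)
  case (Suc N)
  have "integral {0..real N / real n} f + integral {real N / real n..real (Suc N) / real n} f =
      integral {0..real (Suc N) / real n} f"
  proof (rule Henstock_Kurzweil_Integration.integral_combine)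
    show "f integrable_on {0..real (Suc N) / real n}"
      by (rule integrable_on_subinterval[OF assms(1)]) (use Suc.prems assms(2) in \<open>auto simp: field_simps\<close>)
  qed (use assms(2) in \<open>auto simp: field_simps\<close>)
  then show ?case using Suc by simp
qed simp

text \<open>The grid cells that fit into \<open>[0, 1/2]\<close> form a partial division of \<open>[0, 1]\<close>, for which Henstock's
lemma gives the same accuracy as for a full division. The cell that contains \<open>1/2\<close> and the last
summand contribute at most the supremum divided by \<open>n\<close> each.\<close>

lemma half_riemann_sum_tendsto:
  fixes f :: "real \<Rightarrow> real"
  assumes R: "Riemann_integrable_on f 0 1" and bd: "bounded (f ` {0..1})"
  shows "(\<lambda>n. (\<Sum>l\<le>n div 2. f (real l / real n)) / real n) \<longlonglongrightarrow> integral {0..1/2} f"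
proof (rule LIMSEQ_I)
  fix e :: real assume e: "e > 0"
  have int: "f integrable_on {0..1}" by (rule Riemann_integrable_onD(1)[OF R])
  obtain B where B: "B > 0" "\<And>x. x \<in> {0..1} \<Longrightarrow> \<bar>f x\<bar> \<le> B"
    using bd by (auto simp: bounded_pos)
  obtain d where d: "d > 0" "\<And>p. p tagged_division_of {0..1} \<and> (\<lambda>x. ball x d) fine p \<Longrightarrow>
        \<bar>(\<Sum>(x, K)\<in>p. measure lborel K * f x) - integral {0..1} f\<bar> < e / 2"
    using Riemann_integrable_onD(2)[OF R, of "e / 2"] e by auto
  obtain N where N: "N > 0" "\<And>n. n \<ge> N \<Longrightarrow> 1 / real n < d \<and> 2 * B / real n < e / 2"
  proof -
    have "(\<lambda>n. 1 / real n) \<longlonglongrightarrow> 0" "(\<lambda>n. 2 * B / real n) \<longlonglongrightarrow>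
        0" by (rule lim_const_over_n)+
    then have "\<forall>\<^sub>F n in sequentially. 1 / real n < d \<and> 2 * B / real n < e / 2"
      using d(1) e by (intro eventually_conj order_tendstoD(2)) auto
    then obtain N where "\<And>n. n \<ge> N \<Longrightarrow> 1 / real n < d \<and> 2 * B / real n < e / 2"
      by (auto simp: eventually_sequentially)
    then show thesis by (intro that[of "max N 1"]) auto
  qed
  show "\<exists>no. \<forall>n\<ge>no. norm ((\<Sum>l\<le>n div 2. f (real l / real n)) / real n - integral {0..1/2} f) < e"
  proof (intro exI[of _ N] allI impI)
    fix n assume n: "n \<ge> N"
    then have n0: "n > 0" using N(1) by simp
    define m where "m = n div 2"
    have m: "m \<le> n" "real m / real n \<le> 1 / 2" "1 / 2 - real m / real n \<le> 1 / real n"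
    proof -
      have "2 * m \<le> n" "n \<le> 2 * m + 1" unfolding m_def by presburger+
      then have "2 * real m \<le> real n" "real n \<le> 2 * real m + 1" by linarith+
      moreover from this have "real n / real n \<le> (2 * real m + 2) / real n" by (intro divide_right_mono) auto
      ultimately show "m \<le> n" "real m / real n \<le> 1 / 2" "1 / 2 - real m / real n \<le> 1 / real n"
        using n0 by (auto simp: add_divide_distrib pos_divide_le_eq)
    qed
    let ?K = "\<lambda>l. {real l / real n..real (Suc l) / real n}"
    define p where "p = (\<lambda>l. (real l / real n, ?K l)) ` {..<m}"
    have inj: "inj_on (\<lambda>l. (real l / real n, ?K l)) {..<m}" using n0 by (auto simp: inj_on_def)
    have tpd: "p tagged_partial_division_of (cbox 0 1)"
      unfolding tagged_partial_division_of_def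
    proof (intro conjI allI impI)
      show "finite p" by (simp add: p_def)
      fix x K assume "(x, K) \<in> p"
      then obtain l where l: "l < m" "x = real l / real n" "K = ?K l" by (auto simp: p_def)
      show "x \<in> K" using l n0 by (auto simp: field_simps)
      have "real (Suc l) \<le> real n" using l(1) m(1) by linarith
      then show "K \<subseteq> cbox 0 1" using l n0 by (auto simp: field_simps intro: order.trans[of _ "real (Suc l) / real n"])
      show "\<exists>a b. K = cbox a b" using l by auto
    next
      fix x1 K1 x2 K2 assume "(x1, K1) \<in> p \<and> (x2, K2) \<in> p \<and> (x1, K1) \<noteq> (x2, K2)"
      then obtain l1 l2 where l: "K1 = ?K l1" "K2 = ?K l2" "l1 \<noteq> l2" by (auto simp: p_def)
      then have "l1 + 1 \<le> l2 \<or> l2 + 1 \<le> l1" by auto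
      then have "real (Suc l1) / real n \<le> real l2 / real n \<or> real (Suc l2) / real n \<le> real l1 / real n"
        using n0 by (auto intro!: divide_right_mono)
      then show "interior K1 \<inter> interior K2 = {}"
        unfolding l interior_atLeastAtMost_real by auto
    qed
    have fine: "(\<lambda>x. ball x d) fine p"
      unfolding fine_def
    proof clarify
      fix x K y assume "(x, K) \<in> p" "y \<in> K"
      then obtain l where "(x, K) = (real l / real n, ?K l)" unfolding p_def by blast
      then have l: "x = real l / real n" "y \<in> ?K l" using \<open>y \<in> K\<close> by auto
      have "\<bar>x - y\<bar> \<le> 1 / real n" using l by (auto simp: add_divide_distrib)
      then show "y \<in> ball x d" using N(2)[OF n] by (auto simp: dist_real_def)
    qed
    have "norm (\<Sum>(x, K)\<in>p. measure lborel K *\<^sub>R f x - integral K f) \<le> e / 2"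
    proof (rule Henstock_lemma_part1[OF _ _ _ _ tpd fine])
      show "f integrable_on cbox 0 1" using int by simp
      show "gauge (\<lambda>x. ball x d)" using d by (simp add: gauge_ball)
      show "norm ((\<Sum>(x, K)\<in>q. measure lborel K *\<^sub>R f x) - integral (cbox 0 1) f) < e / 2"
        if "q tagged_division_of cbox 0 1" "(\<lambda>x. ball x d) fine q" for q
        using d(2)[of q] that by simp
    qed (use e in simp)
    also have "(\<Sum>(x, K)\<in>p. measure lborel K *\<^sub>R f x - integral K f) =
        (\<Sum>l<m. f (real l / real n) / real n - integral (?K l) f)"
    proof -
      have c: "measure lborel (?K l) = 1 / real n" for l
      proof -
        have "real l / real n \<le> real (Suc l) / real n" by (intro divide_right_mono) auto
        then show ?thesis by (simp add: diff_divide_distrib[symmetric])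
      qed
      show ?thesis unfolding p_def by (subst sum.reindex[OF inj]) (simp only: comp_def split_conv c real_scaleR_def times_divide_eq_left mult_1)
    qed
    also have "\<dots> = (\<Sum>l<m. f (real l / real n)) / real n - integral {0..real m / real n} f"
      by (simp only: sum_subtractf sum_divide_distrib integral_sum_grid[OF int n0 m(1)])
    finally have 1: "\<bar>(\<Sum>l<m. f (real l / real n)) / real n - integral {0..real m / real n} f\<bar> \<le>
        e / 2" by simp
    have 2: "\<bar>integral {0..1/2} f - integral {0..real m / real n} f\<bar> \<le> B / real n"
    proof -
      have "integral {0..real m / real n} f + integral {real m / real n..1/2} f = integral {0..1/2} f"
      proof (rule Henstock_Kurzweil_Integration.integral_combine)
        show "f integrable_on {0..1/2}" by (rule integrable_on_subinterval[OF int]) auto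
      qed (use m in auto)
      moreover have "norm (integral {real m / real n..1/2} f) \<le> B * (1 / 2 - real m / real n)"
      proof -
        have sub: "cbox (real m / real n) (1/2) \<subseteq> {0..1}"
        proof
          fix x :: real assume "x \<in> cbox (real m / real n) (1/2)"
          moreover have "0 \<le> real m / real n" by (rule divide_nonneg_nonneg) auto
          ultimately show "x \<in> {0..1}" unfolding cbox_interval atLeastAtMost_iff by linarith
        qed
        have "norm (integral (cbox (real m / real n) (1/2)) f) \<le> B * measure lborel (cbox (real m / real n) (1/2))"
        proof (rule integrable_bound)
          show "f integrable_on cbox (real m / real n) (1/2)"
              using integrable_on_subinterval[OF int, of "real m / real n" "1/2"] sub by simp
          show "norm (f x) \<le> B" if "x \<in> cbox (real m / real n) (1/2)" for x
            unfolding real_norm_def by (rule B(2)[OF subsetD[OF sub that]])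
        qed (use B(1) in simp)
        then show ?thesis using m by simp
      qed
      moreover have "B * (1 / 2 - real m / real n) \<le> B * (1 / real n)"
        using B m by (intro mult_left_mono) auto
      ultimately show ?thesis by simp
    qed
    have 3: "\<bar>f (real m / real n) / real n\<bar> \<le> B / real n"
      using B(2)[of "real m / real n"] m n0 by (simp add: abs_divide divide_right_mono)
    have 4: "(\<Sum>l\<le>m. f (real l / real n)) / real n = (\<Sum>l<m. f (real l / real n)) / real n +
        f (real m / real n) / real n"
      by (simp add: lessThan_Suc_atMost[symmetric] add_divide_distrib)
    have 5: "2 * (B / real n) < e / 2" using N(2)[OF n] by simp
    show "norm ((\<Sum>l\<le>n div 2. f (real l / real n)) / real n - integral {0..1/2} f) < e"
      using 1 2 3 5 unfolding m_def[symmetric] real_norm_def 4 by linarith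
  qed
qed

lemma half_riemann_sum_uniform_limit:
  fixes gn :: "nat \<Rightarrow> real \<Rightarrow> real"
  assumes R: "\<And>n. n \<ge> 1 \<Longrightarrow> Riemann_integrable_on (gn n) 0 1"
    and bd: "\<And>n. n \<ge> 1 \<Longrightarrow> bounded (gn n ` {0..1})"
    and ul: "uniform_limit {0..1} gn g sequentially"
  shows "g integrable_on {0..1}" and "bounded (g ` {0..1})"
    and "(\<lambda>n. (\<Sum>l\<le>n div 2. gn n (real l / real n)) / real n) \<longlonglongrightarrow> integral {0..1/2} g"
proof -
  have ev: "\<exists>N\<ge>1. \<forall>n\<ge>N. \<forall>x\<in>{0..1}. \<bar>gn n x - g x\<bar> < e" if "e > 0" for e
  proof -
    obtain N where "\<forall>n\<ge>N. \<forall>x\<in>{0..1}. dist (gn n x) (g x) < e"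
      using ul \<open>e > 0\<close> by (auto simp: uniform_limit_iff eventually_sequentially)
    then show ?thesis by (intro exI[of _ "max N 1"]) (auto simp: dist_real_def)
  qed
  have "g integrable_on cbox 0 1"
  proof (rule integrable_uniform_limit)
    fix e :: real assume "e > 0"
    then obtain N where N: "N \<ge> 1" "\<forall>n\<ge>N. \<forall>x\<in>{0..1}. \<bar>gn n x - g x\<bar> < e" using ev by blast
    have "\<forall>x\<in>cbox 0 1. norm (g x - gn N x) \<le> e"
    proof
      fix x :: real assume "x \<in> cbox 0 1"
      then have "\<bar>gn N x - g x\<bar> < e" using N by auto
      then show "norm (g x - gn N x) \<le> e" by simp
    qed
    moreover have "gn N integrable_on cbox 0 1"
      using Riemann_integrable_onD(1)[OF R[OF N(1)]] by simp
    ultimately show "\<exists>h. (\<forall>x\<in>cbox 0 1. norm (g x - h x) \<le> e) \<and> h integrable_on cbox 0 1" by blast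
  qed
  then show gint: "g integrable_on {0..1}" by simp
  show "bounded (g ` {0..1})"
  proof -
    obtain N where N: "N \<ge> 1" "\<forall>n\<ge>N. \<forall>x\<in>{0..1}. \<bar>gn n x - g x\<bar> < 1" using ev[of 1] by auto
    obtain B where B: "\<And>x. x \<in> {0..1} \<Longrightarrow> \<bar>gn N x\<bar> \<le> B"
      using bd[OF N(1)] unfolding bounded_iff by (metis imageI real_norm_def)
    have "\<bar>g x\<bar> \<le> B + 1" if "x \<in> {0..1}" for x
    proof -
      have "\<bar>gn N x - g x\<bar> < 1" using N(2) that by blast
      then show ?thesis using B[OF that] by linarith
    qed
    then show ?thesis unfolding bounded_iff by (intro exI[of _ "B + 1"]) auto
  qed
  show "(\<lambda>n. (\<Sum>l\<le>n div 2. gn n (real l / real n)) / real n) \<longlonglongrightarrow> integral {0..1/2} g"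
  proof (rule LIMSEQ_I)
    fix e :: real assume "e > 0"
    then obtain N where N: "N \<ge> 1" "\<forall>n\<ge>N. \<forall>x\<in>{0..1}. \<bar>gn n x - g x\<bar> < e / 8"
        using ev[of "e / 8"] by auto
    obtain N' where N': "\<And>n. n \<ge> N' \<Longrightarrow>
        \<bar>(\<Sum>l\<le>n div 2. gn N (real l / real n)) / real n - integral {0..1/2} (gn N)\<bar> < e / 4"
      using LIMSEQ_D[OF half_riemann_sum_tendsto[OF R[OF N(1)] bd[OF N(1)]], of "e / 4"] \<open>e > 0\<close> by auto
    have intd: "\<bar>integral {0..1/2} (gn N) - integral {0..1/2} g\<bar> \<le> e / 8"
    proof -
      have i: "gn N integrable_on {0..1/2}" "g integrable_on {0..1/2}"
        using integrable_on_subinterval[OF Riemann_integrable_onD(1)[OF R[OF N(1)]], of 0 "1/2"]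
          integrable_on_subinterval[OF gint, of 0 "1/2"] by auto
      have "norm (integral (cbox 0 (1/2)) (\<lambda>x. gn N x - g x)) \<le> e / 8 * measure lborel (cbox 0 (1/2::real))"
      proof (rule integrable_bound)
        show "(\<lambda>x. gn N x - g x) integrable_on cbox 0 (1/2)" using i by (auto intro: integrable_diff)
        fix x :: real assume "x \<in> cbox 0 (1/2)"
        then have "\<bar>gn N x - g x\<bar> < e / 8" using N(2) by auto
        then show "norm (gn N x - g x) \<le> e / 8" by simp
      qed (use \<open>e > 0\<close> in simp)
      then show ?thesis using \<open>e > 0\<close> i by (simp add: Henstock_Kurzweil_Integration.integral_diff)
    qed
    show "\<exists>no. \<forall>n\<ge>no. norm ((\<Sum>l\<le>n div 2. gn n (real l / real n)) / real n - integral {0..1/2} g) < e"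
    proof (intro exI[of _ "max N N'"] allI impI)
      fix n assume n: "n \<ge> max N N'"
      then have n0: "n > 0" using N(1) by simp
      have "\<bar>(\<Sum>l\<le>n div 2. gn n (real l / real n)) - (\<Sum>l\<le>n div 2. gn N (real l / real n))\<bar> \<le>
          (\<Sum>l\<le>n div 2. e / 4)"
        unfolding sum_subtractf[symmetric]
      proof (rule order.trans[OF sum_abs], rule sum_mono)
        fix l assume "l \<in> {..n div 2}"
        then have "real l / real n \<in> {0..1}" using n0 by auto
        then have "\<bar>gn n (real l / real n) - g (real l / real n)\<bar> < e / 8" "\<bar>gn N (real l / real n) - g (real l / real n)\<bar> < e / 8"
          using N(2) n by auto
        then show "\<bar>gn n (real l / real n) - gn N (real l / real n)\<bar> \<le> e / 4" by linarith
      qed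
      also have "\<dots> \<le> real n * (e / 4)"
        using n0 \<open>e > 0\<close> by (auto intro!: mult_right_mono simp flip: of_nat_Suc)
      finally have "\<bar>(\<Sum>l\<le>n div 2. gn n (real l / real n)) / real n - (\<Sum>l\<le>n div 2. gn N (real l / real n)) / real n\<bar> \<le> e / 4"
        using n0 by (simp add: diff_divide_distrib[symmetric] abs_divide field_simps)
      then show "norm ((\<Sum>l\<le>n div 2. gn n (real l / real n)) / real n - integral {0..1/2} g) < e"
        using N'[of n] n intd \<open>e > 0\<close> unfolding real_norm_def by (auto; linarith)
    qed
  qed
qed

section \<open>The law of one eigenvalue\<close>

lemma trunc_measurable [measurable]: "trunc t \<in> borel_measurable borel"
  unfolding trunc_def by measurable

lemma trunc_power:
  "p \<ge> 1 \<Longrightarrow> trunc t u ^ p = u ^ p * of_bool (ennreal \<bar>u\<bar> \<le> t)"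
  by (auto simp: trunc_def)

text \<open>Exponential generating series of moments multiply for independent summands. Formal power series avoid
any convergence question, which matters as the moments may grow too fast for a generating
function.\<close>

lemma (in prob_space) indep_vars_sum_moments:
  fixes X :: "'i \<Rightarrow> 'a \<Rightarrow> real"
  assumes "finite L" "indep_vars (\<lambda>_. borel) X L"
    and "\<And>l k. l \<in> L \<Longrightarrow> integrable M (\<lambda>\<omega>. X l \<omega> ^ k)"
  shows "integrable M (\<lambda>\<omega>. (\<Sum>l\<in>L. X l \<omega>) ^ k) \<and>
    expectation (\<lambda>\<omega>. (\<Sum>l\<in>L. X l \<omega>) ^ k) / fact k =
      fps_nth (\<Prod>l\<in>L. Abs_fps (\<lambda>p. expectation (\<lambda>\<omega>. X l \<omega> ^ p) / fact p)) k"
  using assms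
proof (induction L arbitrary: k rule: finite_induct)
  case empty
  then show ?case by (cases k) (auto simp: prob_space)
next
  case (insert i L)
  let ?S = "\<lambda>\<omega>. \<Sum>l\<in>L. X l \<omega>"
  have IH: "integrable M (\<lambda>\<omega>. ?S \<omega> ^ k)"
    "expectation (\<lambda>\<omega>. ?S \<omega> ^ k) / fact k =
        fps_nth (\<Prod>l\<in>L. Abs_fps (\<lambda>p. expectation (\<lambda>\<omega>. X l \<omega> ^ p) / fact p)) k" for k
    using insert.IH[of k] insert.prems by (auto intro: indep_vars_subset)
  have int: "integrable M (\<lambda>\<omega>. X i \<omega> ^ k)" for k using insert.prems by auto
  have ind: "indep_var borel (X i) borel ?S"
    by (rule indep_vars_sum[OF insert.hyps insert.prems(1)])
  have "indep_var borel (\<lambda>\<omega>. X i \<omega> ^ a) borel (\<lambda>\<omega>. ?S \<omega> ^ b)" for a b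
    using indep_var_compose[OF ind, of "\<lambda>u. u ^ a" borel "\<lambda>u. u ^ b" borel] by (simp add: comp_def)
  note prod = indep_var_integrable[OF this int IH(1)] indep_var_lebesgue_integral[OF this int IH(1)]
  have expand: "(\<Sum>l\<in>insert i L. X l \<omega>) ^ k =
      (\<Sum>j\<le>k. real (k choose j) * (X i \<omega> ^ j * ?S \<omega> ^ (k - j)))" for \<omega>
    using insert.hyps by (simp add: binomial_ring mult.assoc)
  have "expectation (\<lambda>\<omega>. (\<Sum>l\<in>insert i L. X l \<omega>) ^ k) / fact k =
      (\<Sum>j\<le>k. real (k choose j) * (expectation (\<lambda>\<omega>. X i \<omega> ^ j) * expectation (\<lambda>\<omega>. ?S \<omega> ^ (k - j)))) / fact k"
    unfolding expand prod(2)[symmetric] using prod(1) by (subst Bochner_Integration.integral_sum) auto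
  also have "\<dots> = (\<Sum>j\<le>k. (expectation (\<lambda>\<omega>. X i \<omega> ^ j) / fact j) * (expectation (\<lambda>\<omega>. ?S \<omega> ^ (k - j)) / fact (k - j)))"
    unfolding sum_divide_distrib by (intro sum.cong refl) (simp add: binomial_fact)
  also have "\<dots> = fps_nth (\<Prod>l\<in>insert i L. Abs_fps (\<lambda>p. expectation (\<lambda>\<omega>. X l \<omega> ^ p) / fact p)) k"
    using insert.hyps by (simp add: fps_mult_nth IH(2) atLeast0AtMost)
  finally show ?case unfolding expand using prod(1) by auto
qed

lemma circ_weight_abs_le: "\<bar>circ_weight n j l\<bar> \<le> 2"
  using abs_cos_le_one[of "angle n j l"] by (auto simp: circ_weight_def abs_mult)

lemma (in prob_space) circ_eigenvalue_moments:
  assumes n: "n > 0" and indep: "indep_vars (\<lambda>_. borel) y {..<n}"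
    and int: "\<And>l k. l < n \<Longrightarrow> integrable M (\<lambda>\<omega>. y l \<omega> ^ k)"
  shows "integrable M (\<lambda>\<omega>. circ_eigenvalue n (\<lambda>l. y l \<omega>) j ^ k)"
    and "expectation (\<lambda>\<omega>. circ_eigenvalue n (\<lambda>l. y l \<omega>) j ^ k) / fact k =
      fps_nth (\<Prod>l\<in>{..n div 2}. Abs_fps (\<lambda>p. circ_weight n j l ^ p * expectation (\<lambda>\<omega>. y l \<omega> ^ p) / fact p)) k"
proof -
  have L: "{..n div 2} \<subseteq> {..<n}" using n by auto
  have "indep_vars (\<lambda>_. borel) (\<lambda>l \<omega>. circ_weight n j l * y l \<omega>) {..n div 2}"
    using indep_vars_compose2[OF indep_vars_subset[OF indep L], of "\<lambda>l u. circ_weight n j l * u" "\<lambda>_. borel"] by simp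
  moreover have "integrable M (\<lambda>\<omega>. (circ_weight n j l * y l \<omega>) ^ k)" if "l \<in> {..n div 2}" for l k
    using int[of l k] that L by (auto simp: power_mult_distrib)
  ultimately have *: "integrable M (\<lambda>\<omega>. (\<Sum>l\<in>{..n div 2}. circ_weight n j l * y l \<omega>) ^ k) \<and>
      expectation (\<lambda>\<omega>. (\<Sum>l\<in>{..n div 2}. circ_weight n j l * y l \<omega>) ^ k) / fact k =
      fps_nth (\<Prod>l\<in>{..n div 2}. Abs_fps (\<lambda>p. expectation (\<lambda>\<omega>. (circ_weight n j l * y l \<omega>) ^ p) / fact p)) k"
    by (intro indep_vars_sum_moments) auto
  from * show "integrable M (\<lambda>\<omega>. circ_eigenvalue n (\<lambda>l. y l \<omega>) j ^ k)"
      by (simp add: circ_eigenvalue_def)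
  from * show "expectation (\<lambda>\<omega>. circ_eigenvalue n (\<lambda>l. y l \<omega>) j ^ k) / fact k =
      fps_nth (\<Prod>l\<in>{..n div 2}. Abs_fps (\<lambda>p. circ_weight n j l ^ p * expectation (\<lambda>\<omega>. y l \<omega> ^ p) / fact p)) k"
    by (simp add: circ_eigenvalue_def power_mult_distrib)
qed

lemma (in prob_space) indep_vars_borel_measurable:
  "indep_vars (\<lambda>_. borel) y I \<Longrightarrow> i \<in> I \<Longrightarrow> y i \<in> borel_measurable M"
  by (simp add: indep_vars_def)

definition circ_law :: "'a measure \<Rightarrow> nat \<Rightarrow> (nat \<Rightarrow> 'a \<Rightarrow> real) \<Rightarrow> nat \<Rightarrow> real measure" where
  "circ_law M n y j = distr M borel (\<lambda>\<omega>. circ_eigenvalue n (\<lambda>l. y l \<omega>) j)"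

lemma (in prob_space) circ_law_props:
  assumes n: "n > 0" and indep: "indep_vars (\<lambda>_. borel) y {..<n}"
    and int: "\<And>l k. l < n \<Longrightarrow> integrable M (\<lambda>\<omega>. y l \<omega> ^ k)"
  shows "real_distribution (circ_law M n y j)"
    and "integrable (circ_law M n y j) (\<lambda>u. u ^ k)"
    and "(\<integral>u. u ^ k \<partial>circ_law M n y j) = fact k *
      fps_nth (\<Prod>l\<in>{..n div 2}. Abs_fps (\<lambda>p. circ_weight n j l ^ p * expectation (\<lambda>\<omega>. y l \<omega> ^ p) / fact p)) k"
    and "char (circ_law M n y j) t = expectation (\<lambda>\<omega>. iexp (t * circ_eigenvalue n (\<lambda>l. y l \<omega>) j))"
proof -
  have m: "(\<lambda>\<omega>. circ_eigenvalue n (\<lambda>l. y l \<omega>) j) \<in> borel_measurable M"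
    unfolding circ_eigenvalue_def using n
    by (intro borel_measurable_sum borel_measurable_times indep_vars_borel_measurable[OF indep]) auto
  note mom = circ_eigenvalue_moments[OF n indep int]
  show "real_distribution (circ_law M n y j)" unfolding circ_law_def using m by simp
  show "integrable (circ_law M n y j) (\<lambda>u. u ^ k)" unfolding circ_law_def
    using mom(1) m by (subst integrable_distr_eq) auto
  have "(\<integral>u. u ^ k \<partial>circ_law M n y j) =
      expectation (\<lambda>\<omega>. circ_eigenvalue n (\<lambda>l. y l \<omega>) j ^ k)"
    unfolding circ_law_def using m by (subst integral_distr) auto
  also have "\<dots> = fact k * (expectation (\<lambda>\<omega>. circ_eigenvalue n (\<lambda>l. y l \<omega>) j ^ k) / fact k)" by simp
  also have "expectation (\<lambda>\<omega>. circ_eigenvalue n (\<lambda>l. y l \<omega>) j ^ k) / fact k =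
      fps_nth (\<Prod>l\<in>{..n div 2}. Abs_fps (\<lambda>p. circ_weight n j l ^ p * expectation (\<lambda>\<omega>. y l \<omega> ^ p) / fact p)) k"
    by (rule circ_eigenvalue_moments(2)[OF n indep int])
  finally show "(\<integral>u. u ^ k \<partial>circ_law M n y j) = fact k *
      fps_nth (\<Prod>l\<in>{..n div 2}. Abs_fps (\<lambda>p. circ_weight n j l ^ p * expectation (\<lambda>\<omega>. y l \<omega> ^ p) / fact p)) k" .
  show "char (circ_law M n y j) t = expectation (\<lambda>\<omega>. iexp (t * circ_eigenvalue n (\<lambda>l. y l \<omega>) j))"
    unfolding char_def circ_law_def using m by (subst integral_distr) auto
qed

section \<open>Triangular arrays with convergent cumulants\<close>

text \<open>The part of the assumptions that is responsible for the limit: the entries are independent with all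
moments, no single entry matters in the limit, and the averages of the weighted moments converge to the
cumulants.\<close>

locale circulant_array =
  fixes M :: "nat \<Rightarrow> 'a measure" and y :: "nat \<Rightarrow> nat \<Rightarrow> 'a \<Rightarrow> real"
    and \<kappa> :: "nat \<Rightarrow> real"
  assumes prob: "\<And>n. n \<ge> 1 \<Longrightarrow> prob_space (M n)"
    and indep: "\<And>n. n \<ge> 1 \<Longrightarrow> prob_space.indep_vars (M n) (\<lambda>_. borel) (y n) {..<n}"
    and int: "\<And>n i k. n \<ge> 1 \<Longrightarrow> i < n \<Longrightarrow>
        integrable (M n) (\<lambda>\<omega>. y n i \<omega> ^ k)"
    and null: "\<And>p. p \<ge> 1 \<Longrightarrow>
        (\<lambda>n. \<Sum>l\<le>n div 2. (\<integral>\<omega>. y n l \<omega> ^ p \<partial>M n)\<^sup>2) \<longlonglongrightarrow> 0"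
    and lim: "\<And>p. p \<ge> 1 \<Longrightarrow>
      (\<lambda>n. central_coeff p * (\<Sum>l\<le>n div 2. (\<integral>\<omega>. y n l \<omega> ^ p \<partial>M n) * half_weight n l ^ p)) \<longlonglongrightarrow> \<kappa> p"
begin

definition power_sum :: "nat \<Rightarrow> nat \<Rightarrow> nat \<Rightarrow> real" where
  "power_sum p n j = (\<Sum>l\<le>n div 2. (\<integral>\<omega>. y n l \<omega> ^ p \<partial>M n) * circ_weight n j l ^ p)"

abbreviation sq_err :: "nat \<Rightarrow> nat \<Rightarrow> nat \<Rightarrow> real" where
  "sq_err p n j \<equiv> (power_sum p n j - \<kappa> p)\<^sup>2"

abbreviation exceptional :: "nat \<Rightarrow> real \<Rightarrow> nat \<Rightarrow> nat set" where
  "exceptional m \<delta> n \<equiv> {j. j < n \<and> (\<exists>p\<in>{1..m}. sq_err p n j \<ge> \<delta>)}"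

abbreviation law :: "nat \<Rightarrow> nat \<Rightarrow> real measure" where
  "law n j \<equiv> circ_law (M n) n (y n) j"

lemma power_sum_mean_square:
  assumes p: "p \<ge> 1"
  shows "(\<lambda>n. (\<Sum>j<n. sq_err p n j) / real n) \<longlonglongrightarrow> 0"
proof (rule tendsto_sandwich)
  let ?m = "\<lambda>n l. \<integral>\<omega>. y n l \<omega> ^ p \<partial>M n"
  let ?c = "\<lambda>n. central_coeff p * (\<Sum>l\<le>n div 2. ?m n l * half_weight n l ^ p)"
  let ?b = "\<lambda>n. 2 * (parseval_const p * (\<Sum>l\<le>n div 2. (?m n l)\<^sup>2)) + 2 * (?c n - \<kappa> p)\<^sup>2"
  show "\<forall>\<^sub>F n in sequentially. 0 \<le> (\<Sum>j<n. sq_err p n j) / real n"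
    by (intro always_eventually allI divide_nonneg_nonneg sum_nonneg) auto
  show "\<forall>\<^sub>F n in sequentially. (\<Sum>j<n. sq_err p n j) / real n \<le> ?b n"
  proof (rule eventually_sequentiallyI[of 1])
    fix n :: nat assume "1 \<le> n"
    then have n: "n > 0" by simp
    have "sq_err p n j \<le> 2 * (power_sum p n j - ?c n)\<^sup>2 + 2 * (?c n - \<kappa> p)\<^sup>2" for j
    proof -
      have "0 \<le> ((power_sum p n j - ?c n) - (?c n - \<kappa> p))\<^sup>2" by simp
      then show ?thesis by (simp add: power2_eq_square algebra_simps)
    qed
    then have "(\<Sum>j<n. sq_err p n j) / real n \<le>
        (\<Sum>j<n. 2 * (power_sum p n j - ?c n)\<^sup>2 + 2 * (?c n - \<kappa> p)\<^sup>2) / real n"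
      by (intro divide_right_mono sum_mono) auto
    also have "\<dots> = 2 * ((\<Sum>j<n. (power_sum p n j - ?c n)\<^sup>2) / real n) + 2 * (?c n - \<kappa> p)\<^sup>2"
      using n by (simp add: sum.distrib sum_distrib_left[symmetric] add_divide_distrib)
    also have "\<dots> \<le> ?b n"
      unfolding power_sum_def using circ_weight_power_mean_square[OF n, of "?m n" p] by simp
    finally show "(\<Sum>j<n. sq_err p n j) / real n \<le> ?b n" .
  qed
  have "?b \<longlonglongrightarrow> 2 * (parseval_const p * 0) + 2 * (\<kappa> p - \<kappa> p)\<^sup>2"
    by (intro tendsto_intros null lim p)
  then show "?b \<longlonglongrightarrow> 0" by simp
qed auto

text \<open>Markov's inequality over the frequencies, for finitely many orders at a time.\<close>

lemma exceptional_average_small: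
  assumes \<delta>: "\<delta> > 0"
  shows "(\<lambda>n. real (card (exceptional m \<delta> n)) / real n) \<longlonglongrightarrow> 0"
proof (rule tendsto_sandwich)
  let ?B = "\<lambda>n. (exceptional m \<delta> n)"
  let ?e = "\<lambda>p n j. sq_err p n j"
  show "\<forall>\<^sub>F n in sequentially. 0 \<le> real (card (?B n)) / real n" by auto
  show "\<forall>\<^sub>F n in sequentially. real (card (?B n)) / real n \<le>
      (\<Sum>p\<in>{1..m}. (\<Sum>j<n. ?e p n j) / real n) / \<delta>"
  proof (intro always_eventually allI)
    fix n
    have "real (card (?B n)) = (\<Sum>j\<in>?B n. 1)" by simp
    also have "\<dots> \<le> (\<Sum>j\<in>?B n. (\<Sum>p\<in>{1..m}. ?e p n j) / \<delta>)"
    proof (rule sum_mono)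
      fix j assume "j \<in> ?B n"
      then obtain p where p: "p \<in> {1..m}" "\<delta> \<le> ?e p n j" by auto
      have "?e p n j \<le> (\<Sum>p\<in>{1..m}. ?e p n j)"
        by (rule member_le_sum[of p "{1..m}" "\<lambda>p. ?e p n j"]) (use p in auto)
      then show "1 \<le> (\<Sum>p\<in>{1..m}. ?e p n j) / \<delta>" using p \<delta> by simp
    qed
    also have "\<dots> \<le> (\<Sum>j<n. (\<Sum>p\<in>{1..m}. ?e p n j) / \<delta>)"
      using \<delta> by (intro sum_mono2) (auto intro!: divide_nonneg_nonneg sum_nonneg)
    finally have "real (card (?B n)) / real n \<le> (\<Sum>j<n. (\<Sum>p\<in>{1..m}. ?e p n j) / \<delta>) / real n"
      by (intro divide_right_mono) auto
    also have "(\<Sum>j<n. (\<Sum>p\<in>{1..m}. ?e p n j) / \<delta>) / real n =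
        (\<Sum>p\<in>{1..m}. (\<Sum>j<n. ?e p n j) / real n) / \<delta>"
      unfolding sum_divide_distrib by (subst sum.swap) (intro sum.cong refl, simp add: mult.commute)
    finally show "real (card (?B n)) / real n \<le> (\<Sum>p\<in>{1..m}. (\<Sum>j<n. ?e p n j) / real n) / \<delta>" .
  qed
  have "(\<lambda>n. (\<Sum>p\<in>{1..m}. (\<Sum>j<n. ?e p n j) / real n) / \<delta>) \<longlonglongrightarrow>
      (\<Sum>p\<in>{1..m}. 0) / \<delta>"
    using \<delta> by (intro tendsto_divide tendsto_sum power_sum_mean_square tendsto_const) auto
  then show "(\<lambda>n. (\<Sum>p\<in>{1..m}. (\<Sum>j<n. ?e p n j) / real n) / \<delta>) \<longlonglongrightarrow> 0" by simp
qed auto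

lemma law_props:
  assumes "n \<ge> 1"
  shows "real_distribution (law n j)"
    and "integrable (law n j) (\<lambda>u. u ^ k)"
    and "(\<integral>u. u ^ k \<partial>law n j) = fact k *
      fps_nth (\<Prod>l\<in>{..n div 2}. Abs_fps (\<lambda>p. circ_weight n j l ^ p * (\<integral>\<omega>. y n l \<omega> ^ p \<partial>M n) / fact p)) k"
    and "char (law n j) t = (\<integral>\<omega>. iexp (t * circ_eigenvalue n (\<lambda>l. y n l \<omega>) j) \<partial>M n)"
  using prob_space.circ_law_props[OF prob[OF assms] _ indep[OF assms] int[OF assms]] assms by auto

text \<open>Along any choice of frequencies for which all weighted power sums converge, the moments of the
eigenvalue converge; the order \<open>n\<close> may vary along the sequence.\<close>

lemma good_sequence_moments:
  fixes N J :: "nat \<Rightarrow> nat"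
  assumes N1: "\<And>i. N i \<ge> 1" and N: "filterlim N at_top sequentially"
    and good: "\<And>p. p \<ge> 1 \<Longrightarrow> (\<lambda>i. power_sum p (N i) (J i)) \<longlonglongrightarrow> \<kappa> p"
  shows "(\<lambda>i. \<integral>u. u ^ k \<partial>law (N i) (J i)) \<longlonglongrightarrow> cumulant_moment \<kappa> k"
proof -
  let ?m = "\<lambda>i p l. \<integral>\<omega>. y (N i) l \<omega> ^ p \<partial>M (N i)"
  let ?w = "\<lambda>i l. circ_weight (N i) (J i) l"
  let ?L = "\<lambda>i. {..N i div 2}"
  define U where "U i l = Abs_fps (\<lambda>p. if p = 0 then 1 else ?w i l ^ p * ?m i p l / fact p)" for i l
  have lim': "(\<lambda>i. \<Sum>l\<in>?L i. fps_nth (U i l) p) \<longlonglongrightarrow>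
      \<kappa> p / fact p" if "p \<ge> 1" for p
  proof -
    have "(\<Sum>l\<in>?L i. fps_nth (U i l) p) = power_sum p (N i) (J i) / fact p" for i
      using that by (simp add: U_def power_sum_def sum_divide_distrib mult.commute)
    then show ?thesis using tendsto_divide[OF good[OF that] tendsto_const[of "fact p"]] by simp
  qed
  have null': "l2_null ?L (\<lambda>i l. fps_nth (U i l) p)" if "p \<ge> 1" for p
    unfolding l2_null_def
  proof (rule Lim_null_comparison)
    show "\<forall>\<^sub>F i in sequentially. norm (\<Sum>l\<in>?L i. (fps_nth (U i l) p)\<^sup>2) \<le>
        (2 ^ p)\<^sup>2 * (\<Sum>l\<in>?L i. (?m i p l)\<^sup>2)"
    proof (intro always_eventually allI)
      fix i
      have "(fps_nth (U i l) p)\<^sup>2 \<le> (2 ^ p)\<^sup>2 * (?m i p l)\<^sup>2" for l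
      proof -
        have "\<bar>?w i l ^ p\<bar> \<le> 2 ^ p" unfolding power_abs by (intro power_mono circ_weight_abs_le) auto
        then have "\<bar>?w i l ^ p * ?m i p l\<bar> \<le> 2 ^ p * \<bar>?m i p l\<bar>" unfolding abs_mult
            by (intro mult_right_mono) auto
        moreover have "\<bar>?w i l ^ p * ?m i p l / fact p\<bar> \<le> \<bar>?w i l ^ p * ?m i p l\<bar>"
          using fact_ge_1[of p, where ?'a = real] divide_left_mono[of 1 "fact p" "\<bar>?w i l ^ p * ?m i p l\<bar>"]
          unfolding abs_divide by simp
        ultimately have "\<bar>fps_nth (U i l) p\<bar> \<le> \<bar>2 ^ p * ?m i p l\<bar>" using that
            by (simp add: U_def abs_mult)
        then show ?thesis unfolding power_mult_distrib[symmetric] by (simp only: abs_le_square_iff)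
      qed
      then have "(\<Sum>l\<in>?L i. (fps_nth (U i l) p)\<^sup>2) \<le> (2 ^ p)\<^sup>2 * (\<Sum>l\<in>?L i. (?m i p l)\<^sup>2)"
        unfolding sum_distrib_left by (rule sum_mono)
      then show "norm (\<Sum>l\<in>?L i. (fps_nth (U i l) p)\<^sup>2) \<le>
          (2 ^ p)\<^sup>2 * (\<Sum>l\<in>?L i. (?m i p l)\<^sup>2)"
        by (simp add: sum_nonneg)
    qed
    have "(\<lambda>i. \<Sum>l\<in>?L i. (?m i p l)\<^sup>2) \<longlonglongrightarrow> 0"
      by (rule filterlim_compose[OF null[OF that] N])
    from tendsto_mult_left[OF this, of "(2 ^ p)\<^sup>2"]
    show "(\<lambda>i. (2 ^ p)\<^sup>2 * (\<Sum>l\<in>?L i. (?m i p l)\<^sup>2)) \<longlonglongrightarrow> 0" by simp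
  qed
  have "(\<lambda>i. fps_nth (\<Prod>l\<in>?L i. U i l) k) \<longlonglongrightarrow> cumulant_moment \<kappa> k / fact k"
    by (rule fps_prod_tendsto_cumulant_moment[OF _ _ lim' null']) (auto simp: U_def)
  from tendsto_mult_left[OF this, of "fact k"]
  have "(\<lambda>i. fact k * fps_nth (\<Prod>l\<in>?L i. U i l) k) \<longlonglongrightarrow>
      cumulant_moment \<kappa> k" by simp
  moreover have "(\<integral>u. u ^ k \<partial>law (N i) (J i)) = fact k * fps_nth (\<Prod>l\<in>?L i. U i l) k" for i
  proof -
    interpret prob_space "M (N i)" by (rule prob[OF N1])
    have "Abs_fps (\<lambda>p. ?w i l ^ p * ?m i p l / fact p) = U i l" for l
      unfolding U_def by (rule fps_ext) (simp add: prob_space)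
    then show ?thesis unfolding law_props(3)[OF N1] by simp
  qed
  ultimately show ?thesis by simp
qed

lemma good_sequence:
  assumes NJ: "\<And>i. N i \<ge> max i 1"
    "\<And>i p. p \<in> {1..i} \<Longrightarrow> sq_err p (N i) (J i) < 1 / real (Suc i)"
  shows "(\<lambda>i. \<integral>u. u ^ k \<partial>law (N i) (J i)) \<longlonglongrightarrow> cumulant_moment \<kappa> k"
proof (rule good_sequence_moments)
  show N1: "N i \<ge> 1" for i using NJ(1)[of i] by simp
  show "filterlim N at_top sequentially"
    by (rule filterlim_at_top_mono[OF filterlim_ident]) (use NJ(1) in auto)
  show "(\<lambda>i. power_sum p (N i) (J i)) \<longlonglongrightarrow> \<kappa> p" if p: "p \<ge> 1" for p
  proof -
    have "(\<lambda>i. sq_err p (N i) (J i)) \<longlonglongrightarrow> 0"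
    proof (rule Lim_null_comparison)
      show "\<forall>\<^sub>F i in sequentially. norm (sq_err p (N i) (J i)) \<le> 1 / real (Suc i)"
        using p NJ(2) by (intro eventually_sequentiallyI[of p]) (auto intro: less_imp_le)
    qed (rule LIMSEQ_Suc[OF lim_const_over_n])
    then have "(\<lambda>i. power_sum p (N i) (J i) - \<kappa> p) \<longlonglongrightarrow> 0" by simp
    then show ?thesis by (simp add: LIM_zero_iff)
  qed
qed

text \<open>Frequencies whose first \<open>m\<close> power sums are within the tolerance exist for infinitely many orders, and
the eigenvalue laws along a sequence of them have a weak limit with the required moments.\<close>

lemma limit_distribution_exists:
  obtains \<mu> where "real_distribution \<mu>" "has_moments \<mu> (cumulant_moment \<kappa>)"
proof -
  \<comment> \<open>Once the exceptional proportion is below \<open>1\<close>, some frequency is not exceptional.\<close>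
  have "\<exists>n\<ge>max i 1. \<exists>j<n. \<forall>p\<in>{1..i}. sq_err p n j < 1 / real (Suc i)" for i
  proof -
    have "\<forall>\<^sub>F n in sequentially. real (card (exceptional i (1 / real (Suc i)) n)) / real n < 1"
      by (rule order_tendstoD(2)[OF exceptional_average_small]) auto
    then obtain n where n: "n \<ge> max i 1"
      "real (card (exceptional i (1 / real (Suc i)) n)) / real n < 1"
      using eventually_sequentially by (metis (no_types, lifting) max.cobounded1 max.cobounded2 max.bounded_iff)
    have "\<exists>j<n. \<not> (\<exists>p\<in>{1..i}. sq_err p n j \<ge> 1 / real (Suc i))"
    proof (rule ccontr)
      assume "\<not> ?thesis"
      then have "(exceptional i (1 / real (Suc i)) n) = {..<n}" by blast
      then show False using n by simp
    qed
    then show ?thesis using n(1) by (metis not_le)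
  qed
  then obtain N J where NJ: "\<And>i. N i \<ge> max i 1" "\<And>i. J i < N i"
    "\<And>i p. p \<in> {1..i} \<Longrightarrow> sq_err p (N i) (J i) < 1 / real (Suc i)"
    by metis
  have N1: "N i \<ge> 1" for i using NJ(1)[of i] by simp
  have "(\<lambda>i. \<integral>u. u ^ k \<partial>law (N i) (J i)) \<longlonglongrightarrow> cumulant_moment \<kappa> k" for k
    by (rule good_sequence) (use NJ in auto)
  from moment_limit_exists[OF law_props(1)[OF N1] law_props(2)[OF N1] this]
  show thesis using that by (metis has_moments_def)
qed

text \<open>Closeness of finitely many power sums forces closeness of the characteristic functions, uniformly in
the frequency. Otherwise a sequence of counterexamples with better and better power sums would exist,
and along it the method of moments gives convergence.\<close>

lemma uniform_char_convergence:
  assumes \<mu>: "real_distribution \<mu>" "has_moments \<mu> (cumulant_moment \<kappa>)"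
    and carl: "cumulant_moment \<kappa> 2 \<noteq> 0 \<Longrightarrow>
      \<not> summable (carleman_terms (cumulant_moment \<kappa>))"
    and \<epsilon>: "\<epsilon> > 0"
  shows "\<exists>m. \<forall>n\<ge>max m 1. \<forall>j<n. (\<forall>p\<in>{1..m}. sq_err p n j < 1 / real (Suc m)) \<longrightarrow>
    norm (char (law n j) t - char \<mu> t) < \<epsilon>"
proof (rule ccontr)
  assume "\<not> ?thesis"
  then have "\<forall>i. \<exists>n j. n \<ge> max i 1 \<and> j < n \<and> (\<forall>p\<in>{1..i}. sq_err p n j < 1 / real (Suc i)) \<and>
      \<epsilon> \<le> norm (char (law n j) t - char \<mu> t)" by (force simp: not_less)
  then obtain N J where NJ: "\<And>i. N i \<ge> max i 1" "\<And>i. J i < N i"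
    "\<And>i p. p \<in> {1..i} \<Longrightarrow> sq_err p (N i) (J i) < 1 / real (Suc i)"
    "\<And>i. \<epsilon> \<le> norm (char (law (N i) (J i)) t - char \<mu> t)"
    by metis
  have N1: "N i \<ge> 1" for i using NJ(1)[of i] by simp
  have mom: "integrable \<mu> (\<lambda>u. u ^ k)" "(\<integral>u. u ^ k \<partial>\<mu>) = cumulant_moment \<kappa> k" for k
    using \<mu>(2) by (auto simp: has_moments_def)
  have "weak_conv_m (\<lambda>i. law (N i) (J i)) \<mu>"
  proof (rule moment_method[OF law_props(1)[OF N1] \<mu>(1) law_props(2)[OF N1] _ mom(1)])
    show "(\<lambda>i. \<integral>u. u ^ k \<partial>law (N i) (J i)) \<longlonglongrightarrow>
        (\<integral>u. u ^ k \<partial>\<mu>)" for k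
      unfolding mom by (rule good_sequence) (use NJ in auto)
    show "\<not> summable (carleman_terms (\<lambda>n. \<integral>x. x ^ n \<partial>\<mu>))"
      if "(\<integral>x. x\<^sup>2 \<partial>\<mu>) \<noteq> 0"
      using carl that unfolding mom by simp
  qed
  then have "(\<lambda>i. char (law (N i) (J i)) t) \<longlonglongrightarrow> char \<mu> t"
    by (intro levy_continuity1 law_props(1)[OF N1] \<mu>(1))
  then have "\<forall>\<^sub>F i in sequentially. norm (char (law (N i) (J i)) t - char \<mu> t) < \<epsilon>"
    using \<epsilon> by (auto dest!: tendstoD simp: dist_norm)
  then show False using NJ(4) by (auto simp: eventually_sequentially not_less[symmetric])
qed

text \<open>The frequencies with inaccurate power sums form a vanishing proportion, and each of them contributes at
most \<open>2\<close> to the average.\<close>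

theorem char_average_tendsto:
  assumes \<mu>: "real_distribution \<mu>" "has_moments \<mu> (cumulant_moment \<kappa>)"
    and carl: "cumulant_moment \<kappa> 2 \<noteq> 0 \<Longrightarrow>
      \<not> summable (carleman_terms (cumulant_moment \<kappa>))"
  shows "(\<lambda>n. (\<Sum>j<n. char (law n j) t) / of_nat n) \<longlonglongrightarrow> char \<mu> t"
proof (rule LIMSEQ_I)
  fix \<epsilon> :: real assume \<epsilon>: "\<epsilon> > 0"
  obtain m where m: "\<And>n j. n \<ge> max m 1 \<Longrightarrow> j < n \<Longrightarrow>
      (\<forall>p\<in>{1..m}. sq_err p n j < 1 / real (Suc m)) \<Longrightarrow>
    norm (char (law n j) t - char \<mu> t) < \<epsilon> / 2"
    using uniform_char_convergence[OF \<mu> carl half_gt_zero[OF \<epsilon>], of t] by blast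
  let ?B = "\<lambda>n. (exceptional m (1 / real (Suc m)) n)"
  have "\<forall>\<^sub>F n in sequentially. real (card (?B n)) / real n < \<epsilon> / 4"
    by (rule order_tendstoD(2)[OF exceptional_average_small]) (use \<epsilon> in auto)
  then obtain K where K: "\<And>n. n \<ge> K \<Longrightarrow> real (card (?B n)) / real n < \<epsilon> / 4"
    by (auto simp: eventually_sequentially)
  show "\<exists>no. \<forall>n\<ge>no. norm ((\<Sum>j<n. char (law n j) t) / of_nat n - char \<mu> t) < \<epsilon>"
  proof (intro exI[of _ "max K (max m 1)"] allI impI)
    fix n assume n: "n \<ge> max K (max m 1)"
    then have n1: "n \<ge> 1" by simp
    let ?d = "\<lambda>j. char (law n j) t - char \<mu> t"
    have "(\<Sum>j<n. char (law n j) t) / of_nat n - char \<mu> t = (\<Sum>j<n. ?d j) / of_nat n"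
      using n1 by (simp add: sum_subtractf diff_divide_distrib)
    then have "norm ((\<Sum>j<n. char (law n j) t) / of_nat n - char \<mu> t) = norm (\<Sum>j<n. ?d j) / real n"
      by (simp add: norm_divide)
    also have "\<dots> \<le> (\<Sum>j<n. \<epsilon> / 2 + 2 * of_bool (j \<in> ?B n)) / real n"
    proof (intro divide_right_mono sum_norm_le)
      fix j assume "j \<in> {..<n}"
      then have j: "j < n" by simp
      show "norm (?d j) \<le> \<epsilon> / 2 + 2 * of_bool (j \<in> ?B n)"
      proof (cases "j \<in> ?B n")
        case True
        have "norm (?d j) \<le> norm (char (law n j) t) + norm (char \<mu> t)" by (rule norm_triangle_ineq4)
        also have "\<dots> \<le> 1 + 1"
          by (intro add_mono real_distribution.cmod_char_le_1 law_props(1)[OF n1] \<mu>(1))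
        finally show ?thesis using True \<epsilon> by simp
      next
        case False
        then have "norm (?d j) < \<epsilon> / 2" using n j by (intro m) (auto simp: not_le)
        then show ?thesis by simp
      qed
    qed auto
    also have "\<dots> = \<epsilon> / 2 + 2 * (real (card (?B n)) / real n)"
    proof -
      have "(\<Sum>j<n. of_bool (j \<in> ?B n)) = real (card (?B n))"
        by (simp add: of_bool_def sum.If_cases Int_def)
      then show ?thesis using n1 by (simp add: sum.distrib sum_distrib_left[symmetric] add_divide_distrib)
    qed
    also have "\<dots> < \<epsilon>"
    proof -
      have "n \<ge> K" using n by simp
      from K[OF this] show ?thesis by linarith
    qed
    finally show "norm ((\<Sum>j<n. char (law n j) t) / of_nat n - char \<mu> t) < \<epsilon>" .
  qed
qed

end

section \<open>The limiting cumulants and Carleman's condition\<close>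

lemma Suc_half_le: "n \<ge> 1 \<Longrightarrow> Suc (n div 2) \<le> n" by presburger

text \<open>The moments \<open>m n l\<close> are of order \<open>1 / n\<close>, so the sum of their squares tends to \<open>0\<close>, and the two
exceptional indices at which \<open>half_weight\<close> differs from \<open>1\<close> do not affect the limit.\<close>

lemma grid_mean_limits:
  fixes gn :: "nat \<Rightarrow> real \<Rightarrow> real" and m :: "nat \<Rightarrow> nat \<Rightarrow> real"
  assumes R: "\<And>n. n \<ge> 1 \<Longrightarrow> Riemann_integrable_on (gn n) 0 1"
    and bd: "\<And>n. n \<ge> 1 \<Longrightarrow> bounded (gn n ` {0..1})"
    and ul: "uniform_limit {0..1} gn g sequentially"
    and m: "\<And>n l. n \<ge> 1 \<Longrightarrow> l < n \<Longrightarrow> real n * m n l = gn n (real l / real n)"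
  shows "(\<lambda>n. \<Sum>l\<le>n div 2. (m n l)\<^sup>2) \<longlonglongrightarrow> 0"
    and "(\<lambda>n. \<Sum>l\<le>n div 2. m n l * half_weight n l ^ p) \<longlonglongrightarrow> integral {0..1/2} g"
proof -
  obtain B where B: "B \<ge> 0" "\<And>s. s \<in> {0..1} \<Longrightarrow> \<bar>g s\<bar> \<le> B"
    using half_riemann_sum_uniform_limit(2)[OF R bd ul] unfolding bounded_pos
    by (metis imageI less_imp_le real_norm_def)
  obtain N where N: "\<forall>n\<ge>N. \<forall>s\<in>{0..1}. dist (gn n s) (g s) < 1"
    using ul[unfolded uniform_limit_iff eventually_sequentially, rule_format, of 1] by auto
  have mB: "\<bar>m n l\<bar> \<le> (B + 1) / real n" if n: "n \<ge> max N 1" and l: "l \<le> n div 2" for n l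
  proof -
    have ln: "l < n" using n l by auto
    then have s: "real l / real n \<in> {0..1}" by auto
    have "dist (gn n (real l / real n)) (g (real l / real n)) < 1" using N n s by auto
    then have "\<bar>gn n (real l / real n)\<bar> \<le> B + 1" using B(2)[OF s] by (auto simp: dist_real_def)
    then have "\<bar>real n * m n l\<bar> \<le> B + 1" using m[of n l] n ln by simp
    then have "real n * \<bar>m n l\<bar> \<le> B + 1" by (simp only: abs_mult abs_of_nat)
    then show ?thesis using n by (simp add: field_simps)
  qed
  show "(\<lambda>n. \<Sum>l\<le>n div 2. (m n l)\<^sup>2) \<longlonglongrightarrow> 0"
  proof (rule Lim_null_comparison)
    show "\<forall>\<^sub>F n in sequentially. norm (\<Sum>l\<le>n div 2. (m n l)\<^sup>2) \<le> (B + 1)\<^sup>2 / real n"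
    proof (rule eventually_sequentiallyI[of "max N 1"])
      fix n assume n: "n \<ge> max N 1"
      have "(\<Sum>l\<le>n div 2. (m n l)\<^sup>2) \<le> (\<Sum>l\<le>n div 2. ((B + 1) / real n)\<^sup>2)"
      proof (rule sum_mono)
        fix l assume "l \<in> {..n div 2}"
        then have "\<bar>m n l\<bar> \<le> \<bar>(B + 1) / real n\<bar>"
            using mB[OF n, of l] abs_ge_self[of "(B + 1) / real n"] unfolding atMost_iff by linarith
        then show "(m n l)\<^sup>2 \<le> ((B + 1) / real n)\<^sup>2" by (simp only: abs_le_square_iff)
      qed
      also have "\<dots> = real (Suc (n div 2)) * ((B + 1) / real n)\<^sup>2" by simp
      also have "\<dots> \<le> real n * ((B + 1) / real n)\<^sup>2"
        using Suc_half_le[of n] n by (intro mult_right_mono) (auto simp del: of_nat_Suc)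
      also have "\<dots> = (B + 1)\<^sup>2 / real n" using n by (simp add: power2_eq_square field_simps)
      finally show "norm (\<Sum>l\<le>n div 2. (m n l)\<^sup>2) \<le> (B + 1)\<^sup>2 / real n" by (simp add: sum_nonneg)
    qed
  qed (rule lim_const_over_n)
  have 1: "(\<lambda>n. \<Sum>l\<le>n div 2. m n l) \<longlonglongrightarrow> integral {0..1/2} g"
  proof (rule Lim_transform_eventually[OF half_riemann_sum_uniform_limit(3)[OF R bd ul]])
    show "\<forall>\<^sub>F n in sequentially. (\<Sum>l\<le>n div 2. gn n (real l / real n)) / real n =
        (\<Sum>l\<le>n div 2. m n l)"
    proof (rule eventually_sequentiallyI[of 1])
      fix n :: nat assume n: "n \<ge> 1"
      have "(\<Sum>l\<le>n div 2. gn n (real l / real n)) = (\<Sum>l\<le>n div 2. real n * m n l)"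
        using n by (intro sum.cong refl m[symmetric]) auto
      then show "(\<Sum>l\<le>n div 2. gn n (real l / real n)) / real n = (\<Sum>l\<le>n div 2. m n l)"
        using n by (simp add: sum_distrib_left[symmetric])
    qed
  qed
  have 2: "(\<lambda>n. \<Sum>l\<le>n div 2. m n l * (half_weight n l ^ p - 1)) \<longlonglongrightarrow> 0"
  proof (rule Lim_null_comparison)
    show "\<forall>\<^sub>F n in sequentially. norm (\<Sum>l\<le>n div 2. m n l * (half_weight n l ^ p - 1)) \<le>
        (2 * (B + 1)) / real n"
    proof (rule eventually_sequentiallyI[of "max N 1"])
      fix n assume n: "n \<ge> max N 1"
      have "(\<Sum>l\<le>n div 2. m n l * (half_weight n l ^ p - 1)) =
          (\<Sum>l\<in>{0, n div 2}. m n l * (half_weight n l ^ p - 1))"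
        by (rule sum.mono_neutral_right) (auto simp: half_weight_def)
      also have "norm \<dots> \<le> (\<Sum>l\<in>{0, n div 2}. (B + 1) / real n)"
      proof (rule sum_norm_le)
        fix l assume "l \<in> {0, n div 2}"
        then have l: "l \<le> n div 2" by auto
        have "half_weight n l \<ge> 0" "half_weight n l \<le> 1" by (auto simp: half_weight_def)
        then have "\<bar>half_weight n l ^ p - 1\<bar> \<le> 1"
            using power_le_one[of "half_weight n l" p] zero_le_power[of "half_weight n l" p] by auto
        then have "\<bar>m n l\<bar> * \<bar>half_weight n l ^ p - 1\<bar> \<le> (B + 1) / real n * 1"
          using mB[OF n l] B by (intro mult_mono) auto
        then show "norm (m n l * (half_weight n l ^ p - 1)) \<le> (B + 1) / real n" by (simp add: abs_mult)
      qed
      also have "\<dots> = real (card {0, n div 2}) * ((B + 1) / real n)" by (simp only: sum_constant)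
      also have "\<dots> \<le> 2 * ((B + 1) / real n)"
        using B by (intro mult_right_mono) (auto simp: card_insert_if)
      finally show "norm (\<Sum>l\<le>n div 2. m n l * (half_weight n l ^ p - 1)) \<le> (2 * (B + 1)) / real n" by simp
    qed
  qed (rule lim_const_over_n)
  have "(\<Sum>l\<le>n div 2. m n l * half_weight n l ^ p) = (\<Sum>l\<le>n div 2. m n l) +
      (\<Sum>l\<le>n div 2. m n l * (half_weight n l ^ p - 1))" for n
    by (simp add: sum.distrib[symmetric] algebra_simps)
  then show "(\<lambda>n. \<Sum>l\<le>n div 2. m n l * half_weight n l ^ p) \<longlonglongrightarrow> integral {0..1/2} g"
    using tendsto_add[OF 1 2] by simp
qed

definition limit_cumulant :: "(nat \<Rightarrow> real) \<Rightarrow> nat \<Rightarrow> real" where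
  "limit_cumulant C p = (if even p then a_seq p * C p else 0)"

lemma central_coeff_eq_a_seq: "even p \<Longrightarrow> central_coeff p * c = a_seq p * (2 * c)"
  by (simp add: central_coeff_def a_seq_def)

lemma partition_finite:
  "partition_on {1..k::nat} \<sigma> \<Longrightarrow>
      finite \<sigma> \<and> (\<forall>V\<in>\<sigma>. 0 < card V) \<and> k = (\<Sum>V\<in>\<sigma>. card V)"
proof (intro conjI ballI)
  assume p: "partition_on {1..k} \<sigma>"
  show fin: "finite \<sigma>" using p by (intro finite_elements[of "{1..k}"]) auto
  have finV: "finite V" if "V \<in> \<sigma>" for V
  proof -
    have "V \<subseteq> {1..k}" using partition_onD1[OF p] that by blast
    then show "finite V" by (rule finite_subset) simp
  qed
  show "0 < card V" if "V \<in> \<sigma>" for V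
    using finV[OF that] partition_onD3[OF p] that by (auto simp: card_gt_0_iff)
  have "card (\<Union>\<sigma>) = (\<Sum>V\<in>\<sigma>. card V)"
    using p finV by (intro card_Union_disjoint) (auto simp: partition_on_def pairwise_def disjnt_def)
  moreover have "card (\<Union>\<sigma>) = k" unfolding partition_onD1[OF p, symmetric] by simp
  ultimately show "k = (\<Sum>V\<in>\<sigma>. card V)" by simp
qed

lemma finite_partitions: "finite (partitions k)"
  unfolding partitions_def by (rule finitely_many_partition_on) simp

text \<open>A partition with an odd block contributes a vanishing product, and a set of odd size has no other
partitions.\<close>

lemma cumulant_moment_eq_limit_moment:
  "cumulant_moment (limit_cumulant C) k = limit_moment C k"
proof -
  have "cumulant_moment (limit_cumulant C) k = (\<Sum>\<sigma>\<in>partitions k. mult_ext (limit_cumulant C) \<sigma>)"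
    using sum_partition_on_eq_cumulant_moment[of "{1..k}" "limit_cumulant C"] by (simp add: partitions_def)
  also have "\<dots> = (\<Sum>\<sigma>\<in>even_partitions k. mult_ext (limit_cumulant C) \<sigma>)"
  proof (rule sum.mono_neutral_right[OF finite_partitions])
    show "\<forall>\<sigma>\<in>partitions k - even_partitions k. mult_ext (limit_cumulant C) \<sigma> = 0"
    proof
      fix \<sigma> assume "\<sigma> \<in> partitions k - even_partitions k"
      then have "finite \<sigma>" "\<exists>V\<in>\<sigma>. odd (card V)"
        by (auto simp del: One_nat_def simp: even_partitions_def partitions_def dest: partition_finite)
      then show "mult_ext (limit_cumulant C) \<sigma> = 0"
        by (auto simp: mult_ext_def limit_cumulant_def prod_zero_iff)
    qed
  qed (auto simp: even_partitions_def)
  also have "\<dots> = (\<Sum>\<sigma>\<in>even_partitions k. mult_ext a_seq \<sigma> * mult_ext C \<sigma>)"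
    by (rule sum.cong) (auto simp: mult_ext_def limit_cumulant_def even_partitions_def prod.distrib[symmetric] intro!: prod.cong)
  also have "\<dots> = limit_moment C k"
  proof (cases "even k")
    case True then show ?thesis by (simp add: limit_moment_def)
  next
    case False
    have "\<sigma> \<notin> even_partitions k" for \<sigma>
    proof
      assume "\<sigma> \<in> even_partitions k"
      then have "k = (\<Sum>V\<in>\<sigma>. card V)" "\<forall>V\<in>\<sigma>. even (card V)"
        by (auto simp del: One_nat_def simp: even_partitions_def partitions_def dest: partition_finite)
      then have "even k" by (metis dvd_sum)
      then show False using False by simp
    qed
    then have "even_partitions k = {}" by blast
    then show ?thesis using False by (simp add: limit_moment_def)
  qed
  finally show ?thesis .
qed

lemma limit_moment_cong:
  assumes "\<And>m. m \<ge> 1 \<Longrightarrow> C (2 * m) = C' (2 * m)"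
  shows "limit_moment C k = limit_moment C' k"
proof -
  have "mult_ext C \<sigma> = mult_ext C' \<sigma>" if "\<sigma> \<in> even_partitions k" for \<sigma>
    unfolding mult_ext_def
  proof (rule prod.cong[OF refl])
    fix V assume "V \<in> \<sigma>"
    then have "card V > 0" "even (card V)" using that partition_finite[of k \<sigma>]
      by (auto simp del: One_nat_def simp: even_partitions_def partitions_def)
    then obtain m where "card V = 2 * m" "m \<ge> 1" by (auto elim!: evenE)
    then show "C (card V) = C' (card V)" using assms by simp
  qed
  then show ?thesis unfolding limit_moment_def by (auto intro!: sum.cong)
qed

text \<open>A block of size \<open>c\<close> contributes at most \<open>2\<^sup>c\<close> times the supremum norm, since \<open>a\<^sub>c \<le> 2\<^sup>c\<close> and
\<open>C\<^sub>c\<close> is twice an integral over an interval of length \<open>1/2\<close>; the powers of \<open>2\<close> multiply up to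
\<open>2\<^sup>k\<close>. This factor only costs a constant after taking \<open>k\<close>-th roots.\<close>

lemma limit_moment_le_carleman_alpha:
  assumes bd: "\<And>m. m \<ge> 1 \<Longrightarrow> bounded (g (2 * m) ` {0..1})"
    and C: "\<And>m. C (2 * m) = 2 * integral {0..1/2} (g (2 * m))"
    and int: "\<And>m. m \<ge> 1 \<Longrightarrow> g (2 * m) integrable_on {0..1}"
  shows "limit_moment C k \<le> 2 ^ k * carleman_alpha g k"
proof -
  have M: "\<bar>g (2 * m) s\<bar> \<le> sup_norm_seq g (2 * m)" if "m \<ge> 1" "s \<in> {0..1}" for m s
  proof -
    have "bdd_above ((\<lambda>s. \<bar>g (2 * m) s\<bar>) ` {0..1})"
      using bd[OF that(1)] unfolding bounded_iff bdd_above_def by fastforce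
    then show ?thesis unfolding sup_norm_seq_def using that by (auto intro!: cSUP_upper)
  qed
  have M0: "sup_norm_seq g (2 * m) \<ge> 0" if "m \<ge> 1" for m using M[OF that, of 0] by auto
  have M0': "sup_norm_seq g c \<ge> 0" if "c \<ge> 1" for c
    using that M0 by (cases "even c") (auto elim!: evenE simp: sup_norm_seq_def)
  have CM: "\<bar>C (2 * m)\<bar> \<le> sup_norm_seq g (2 * m)" if "m \<ge> 1" for m
  proof -
    have "norm (integral (cbox 0 (1/2)) (g (2 * m))) \<le> sup_norm_seq g (2 * m) * measure lborel (cbox 0 (1/2::real))"
    proof (rule integrable_bound[OF M0[OF that]])
      show "g (2 * m) integrable_on cbox 0 (1/2)"
        using integrable_on_subinterval[OF int[OF that], of 0 "1/2"] by auto
      show "norm (g (2 * m) s) \<le> sup_norm_seq g (2 * m)" if "s \<in> cbox 0 (1/2)" for s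
        using M[OF \<open>m \<ge> 1\<close>, of s] that by auto
    qed
    then show ?thesis unfolding C by simp
  qed
  have a: "0 \<le> a_seq (2 * m)" "a_seq (2 * m) \<le> 2 ^ (2 * m)" for m
  proof -
    have "real (2 * m choose m) \<le> real (2 ^ (2 * m))"
      by (simp only: of_nat_le_iff binomial_le_pow2)
    moreover have "0 \<le> real (2 * m choose m)" by simp
    ultimately have "1 / 2 * real (2 * m choose m) \<le> real (2 ^ (2 * m))" by linarith
    then show "a_seq (2 * m) \<le> 2 ^ (2 * m)" by (simp add: a_seq_def)
  qed (simp add: a_seq_def)
  have alpha0: "mult_ext (sup_norm_seq g) \<sigma> \<ge> 0" if "\<sigma> \<in> partitions k" for \<sigma>
    unfolding mult_ext_def using that partition_finite[of k \<sigma>]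
    by (intro prod_nonneg M0') (auto simp del: One_nat_def simp: partitions_def Suc_leI)
  have term_le: "mult_ext a_seq \<sigma> * mult_ext C \<sigma> \<le>
      2 ^ k * mult_ext (sup_norm_seq g) \<sigma>" if s: "\<sigma> \<in> even_partitions k" for \<sigma>
  proof -
    have p: "finite \<sigma>" "k = (\<Sum>V\<in>\<sigma>. card V)" "\<And>V. V \<in> \<sigma> \<Longrightarrow>
        \<exists>m\<ge>1. card V = 2 * m"
    proof -
      show "\<exists>m\<ge>1. card V = 2 * m" if "V \<in> \<sigma>" for V
      proof -
        have "card V > 0" "even (card V)" using s that partition_finite[of k \<sigma>]
          by (auto simp del: One_nat_def simp: even_partitions_def partitions_def)
        then show ?thesis by (auto elim!: evenE)
      qed
    qed (use s partition_finite[of k \<sigma>] in \<open>auto simp del: One_nat_def simp: even_partitions_def partitions_def\<close>)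
    have "mult_ext a_seq \<sigma> * mult_ext C \<sigma> \<le> (\<Prod>V\<in>\<sigma>. \<bar>a_seq (card V) * C (card V)\<bar>)"
      unfolding mult_ext_def prod.distrib[symmetric] abs_prod[symmetric] by (rule abs_ge_self)
    also have "\<dots> \<le> (\<Prod>V\<in>\<sigma>. 2 ^ card V * sup_norm_seq g (card V))"
    proof (rule prod_mono, rule conjI[OF abs_ge_zero])
      fix V assume "V \<in> \<sigma>"
      then obtain m where m: "m \<ge> 1" "card V = 2 * m" using p(3) by blast
      show "\<bar>a_seq (card V) * C (card V)\<bar> \<le> 2 ^ card V * sup_norm_seq g (card V)"
        unfolding m(2) abs_mult using a CM[OF m(1)] by (intro mult_mono) auto
    qed
    also have "\<dots> = 2 ^ k * mult_ext (sup_norm_seq g) \<sigma>"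
      by (simp add: mult_ext_def prod.distrib p(2) power_sum)
    finally show ?thesis .
  qed
  show ?thesis
  proof (cases "even k")
    case True
    have "limit_moment C k \<le> (\<Sum>\<sigma>\<in>even_partitions k. 2 ^ k * mult_ext (sup_norm_seq g) \<sigma>)"
      unfolding limit_moment_def using True by (simp add: sum_mono term_le)
    also have "\<dots> \<le> (\<Sum>\<sigma>\<in>partitions k. 2 ^ k * mult_ext (sup_norm_seq g) \<sigma>)"
      using alpha0 by (intro sum_mono2 finite_partitions) (auto simp: even_partitions_def)
    finally show ?thesis by (simp add: carleman_alpha_def sum_distrib_left)
  next
    case False
    have "0 \<le> carleman_alpha g k" unfolding carleman_alpha_def by (intro sum_nonneg alpha0)
    then show ?thesis using False by (simp add: limit_moment_def)
  qed
qed

lemma carleman_condition_transfer: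
  fixes \<alpha> \<beta> :: "nat \<Rightarrow> real"
  assumes carl: "(\<Sum>k. inverse (ennreal (\<alpha> (2 * Suc k) powr (1 / real (2 * Suc k))))) = \<infinity>"
    and le: "\<And>k. \<beta> (2 * Suc k) \<le> 2 ^ (2 * Suc k) * \<alpha> (2 * Suc k)"
    and pos: "\<And>k. \<beta> (2 * Suc k) > 0"
  shows "\<not> summable (carleman_terms \<beta>)"
proof
  assume sm: "summable (carleman_terms \<beta>)"
  let ?a = "\<lambda>k. \<alpha> (2 * Suc k) powr (1 / real (2 * Suc k))"
    and ?b = "\<lambda>k. \<beta> (2 * Suc k) powr (1 / real (2 * Suc k))"
  have apos: "\<alpha> (2 * Suc k) > 0" for k
  proof -
    have "0 < 2 ^ (2 * Suc k) * \<alpha> (2 * Suc k)" using le[of k] pos[of k] by linarith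
    then show ?thesis by (simp add: zero_less_mult_iff)
  qed
  have ab: "?b k \<le> 2 * ?a k" for k
  proof -
    have "?b k \<le> (2 ^ (2 * Suc k) * \<alpha> (2 * Suc k)) powr (1 / real (2 * Suc k))"
      using le[of k] pos[of k] by (intro powr_mono2) auto
    also have "\<dots> = (2 ^ (2 * Suc k)) powr (1 / real (2 * Suc k)) * ?a k"
      by (rule powr_mult)
    also have "(2 ^ (2 * Suc k)) powr (1 / real (2 * Suc k)) = (2 :: real)"
    proof -
      have "((2 :: real) ^ (2 * Suc k)) powr (1 / real (2 * Suc k)) = (2 powr real (2 * Suc k)) powr (1 / real (2 * Suc k))"
        by (subst powr_realpow) auto
      moreover have "real (2 * Suc k) * (1 / real (2 * Suc k)) = 1" by simp
      ultimately show ?thesis by (simp only: powr_powr) simp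
    qed
    finally show ?thesis .
  qed
  have a0: "?a k > 0" "?b k > 0" for k using apos[of k] pos[of k] by auto
  have "summable (\<lambda>k. 1 / ?a k)"
  proof (rule summable_comparison_test'[OF summable_mult[OF sm, of 2]])
    fix k
    show "norm (1 / ?a k) \<le> 2 * (1 / ?b k)"
      using ab[of k] a0[of k] by (simp add: field_simps)
  qed
  then have "(\<Sum>k. ennreal (1 / ?a k)) = ennreal (\<Sum>k. 1 / ?a k)"
    using a0 by (intro suminf_ennreal2) (auto intro: less_imp_le)
  moreover have "inverse (ennreal (?a k)) = ennreal (1 / ?a k)" for k
    using a0[of k] by (simp add: inverse_ennreal divide_inverse)
  ultimately show False using carl by simp
qed

section \<open>Perturbation of the entries\<close>

text \<open>Shifts away from index \<open>0\<close>, where nothing is assumed about the array.\<close>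

lemma weak_conv_m_Suc: "weak_conv_m (\<lambda>n. F (Suc n)) \<mu> \<Longrightarrow> weak_conv_m F \<mu>"
  unfolding weak_conv_m_def weak_conv_def by (auto intro: LIMSEQ_imp_Suc)

lemma eesd_weak_conv_of_char:
  assumes M: "\<And>n. n \<ge> 1 \<Longrightarrow> prob_space (M n)"
    and x: "\<And>n i. n \<ge> 1 \<Longrightarrow> i < n \<Longrightarrow> x n i \<in> borel_measurable (M n)"
    and \<mu>: "real_distribution \<mu>"
    and char: "\<And>t. (\<lambda>n. (\<Sum>j<n. \<integral>\<omega>. iexp (t * circ_eigenvalue n (\<lambda>i. x n i \<omega>) j) \<partial>M n) / of_nat n) \<longlonglongrightarrow> char \<mu> t"
  shows "weak_conv_m (\<lambda>n. eesd (M n) (\<lambda>\<omega>. sym_circulant n (\<lambda>i. x n i \<omega>))) \<mu>"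
proof (rule weak_conv_m_Suc, rule levy_continuity[OF _ \<mu>])
  have x': "x (Suc n) l \<in> borel_measurable (M (Suc n))" if "l \<le> Suc n div 2" for n l
    using that by (intro x) auto
  note e = eesd_sym_circulant_char[OF zero_less_Suc M x']
  show "real_distribution (eesd (M (Suc n)) (\<lambda>\<omega>. sym_circulant (Suc n) (\<lambda>i. x (Suc n) i \<omega>)))" for n
    by (rule e(1)) auto
  show "(\<lambda>n. char (eesd (M (Suc n)) (\<lambda>\<omega>. sym_circulant (Suc n) (\<lambda>i. x (Suc n) i \<omega>))) t) \<longlonglongrightarrow> char \<mu> t" for t
  proof -
    have "char (eesd (M (Suc n)) (\<lambda>\<omega>. sym_circulant (Suc n) (\<lambda>i. x (Suc n) i \<omega>))) t =
      (\<Sum>j<Suc n. \<integral>\<omega>. iexp (t * circ_eigenvalue (Suc n) (\<lambda>i. x (Suc n) i \<omega>) j) \<partial>M (Suc n)) / of_nat (Suc n)" for n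
      by (rule e(2)) auto
    then show ?thesis using LIMSEQ_Suc[OF char[of t]] by (simp only:)
  qed
qed

lemma cmod_iexp_diff_le: "cmod (iexp a - iexp b) \<le> \<bar>a - b\<bar>"
proof -
  have "iexp a - iexp b = iexp b * (iexp (a - b) - (\<Sum>k\<le>0. (\<i> * complex_of_real (a - b)) ^ k / fact k))"
    by (simp add: algebra_simps exp_diff exp_minus)
  then have "cmod (iexp a - iexp b) = cmod (iexp (a - b) - (\<Sum>k\<le>0. (\<i> * complex_of_real (a - b)) ^ k / fact k))"
    by (simp add: norm_mult)
  also have "\<dots> \<le> \<bar>a - b\<bar> ^ Suc 0 / fact (Suc 0)" by (rule iexp_approx1)
  finally show ?thesis by simp
qed

lemma circ_eigenvalue_diff:
  "circ_eigenvalue n x j - circ_eigenvalue n y j = circ_eigenvalue n (\<lambda>i. x i - y i) j"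
  by (simp add: circ_eigenvalue_def sum_subtractf right_diff_distrib)

text \<open>For a linear form in the entries, the average over \<open>j\<close> of \<open>\<bar>e\<^bsup>i s u\<^esup> - e\<^bsup>i s v\<^esup>\<bar>\<close> is bounded by the
average of \<open>\<bar>s (u - v)\<bar>\<close>. The inequality \<open>\<bar>a\<bar> \<le> \<epsilon> + a\<^sup>2 / \<epsilon>\<close> replaces the first moment by a second
moment, to which the bound for cosine sums over the frequencies applies.\<close>

lemma (in prob_space) char_average_perturbation:
  assumes n: "n \<ge> 1" and x: "\<And>i. i < n \<Longrightarrow> x i \<in> borel_measurable M"
    and y: "\<And>i. i < n \<Longrightarrow> y i \<in> borel_measurable M"
    and r: "\<And>i. i < n \<Longrightarrow> integrable M (\<lambda>\<omega>. (x i \<omega> - y i \<omega>)\<^sup>2)"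
    and \<epsilon>: "\<epsilon> > 0"
  shows "cmod ((\<Sum>j<n. \<integral>\<omega>. iexp (t * circ_eigenvalue n (\<lambda>i. x i \<omega>) j) \<partial>M) / of_nat n
      - (\<Sum>j<n. \<integral>\<omega>. iexp (t * circ_eigenvalue n (\<lambda>i. y i \<omega>) j) \<partial>M) / of_nat n)
    \<le> \<epsilon> + 4 * t\<^sup>2 / \<epsilon> * (\<Sum>i<n. expectation (\<lambda>\<omega>. (x i \<omega> - y i \<omega>)\<^sup>2))"
proof -
  have n0: "n > 0" using n by simp
  have L: "{..n div 2} \<subseteq> {..<n}" using n0 by auto
  let ?l = "\<lambda>x j \<omega>. circ_eigenvalue n (\<lambda>i. x i \<omega>) j"
  let ?r = "\<lambda>i \<omega>. x i \<omega> - y i \<omega>"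
  have meas: "(\<lambda>\<omega>. ?l z j \<omega>) \<in> borel_measurable M" if "\<And>i. i < n \<Longrightarrow>
      z i \<in> borel_measurable M" for z j
    unfolding circ_eigenvalue_def using that L by (intro borel_measurable_sum borel_measurable_times) auto
  have int: "integrable M (\<lambda>\<omega>. iexp (t * ?l z j \<omega>))" if "\<And>i. i < n \<Longrightarrow>
      z i \<in> borel_measurable M" for z j
    using meas[OF that] by (intro integrable_iexp) auto
  have intx: "integrable M (\<lambda>\<omega>. iexp (t * ?l x j \<omega>))" for j by (rule int) (rule x)
  have inty: "integrable M (\<lambda>\<omega>. iexp (t * ?l y j \<omega>))" for j by (rule int) (rule y)
  have rm: "?r i \<in> borel_measurable M" if "i < n" for i using x y that by auto
  have bound: "(\<Sum>j<n. (?l ?r j \<omega>)\<^sup>2) / real n \<le> 4 * (\<Sum>i<n. (?r i \<omega>)\<^sup>2)" for \<omega>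
  proof -
    have "(\<Sum>j<n. (?l ?r j \<omega>)\<^sup>2) / real n \<le> 4 * (\<Sum>l\<le>n div 2. (?r l \<omega>)\<^sup>2)"
      by (rule circ_eigenvalue_mean_square[OF n0])
    also have "\<dots> \<le> 4 * (\<Sum>i<n. (?r i \<omega>)\<^sup>2)" using L by (intro mult_left_mono sum_mono2) auto
    finally show ?thesis .
  qed
  have isum: "integrable M (\<lambda>\<omega>. 4 * (\<Sum>i<n. (?r i \<omega>)\<^sup>2))" using r by auto
  let ?g = "\<lambda>\<omega>. (\<Sum>j<n. (?l ?r j \<omega>)\<^sup>2) / real n"
  have ig: "integrable M ?g"
  proof (rule Bochner_Integration.integrable_bound[OF isum])
    show "?g \<in> borel_measurable M" using meas[of ?r] rm
        by (intro borel_measurable_divide borel_measurable_sum borel_measurable_power) auto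
    show "AE \<omega> in M. norm (?g \<omega>) \<le> norm (4 * (\<Sum>i<n. (?r i \<omega>)\<^sup>2))"
    proof (rule AE_I2)
      fix \<omega>
      have "0 \<le> ?g \<omega>" by (intro divide_nonneg_nonneg sum_nonneg) auto
      then show "norm (?g \<omega>) \<le> norm (4 * (\<Sum>i<n. (?r i \<omega>)\<^sup>2))" using bound[of \<omega>] by simp
    qed
  qed
  have pt: "cmod ((\<Sum>j<n. iexp (t * ?l x j \<omega>) - iexp (t * ?l y j \<omega>)) / of_nat n) \<le>
      \<epsilon> + t\<^sup>2 / \<epsilon> * ?g \<omega>" for \<omega>
  proof -
    have "cmod (iexp (t * ?l x j \<omega>) - iexp (t * ?l y j \<omega>)) \<le>
        \<epsilon> + t\<^sup>2 / \<epsilon> * (?l ?r j \<omega>)\<^sup>2" for j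
    proof -
      let ?u = "t * ?l ?r j \<omega>"
      have "cmod (iexp (t * ?l x j \<omega>) - iexp (t * ?l y j \<omega>)) \<le> \<bar>?u\<bar>"
        using cmod_iexp_diff_le[of "t * ?l x j \<omega>" "t * ?l y j \<omega>"]
        unfolding right_diff_distrib[symmetric] circ_eigenvalue_diff .
      also have "\<bar>?u\<bar> \<le> \<epsilon> + ?u\<^sup>2 / \<epsilon>"
      proof -
        have "\<epsilon> * u \<le> \<epsilon> * \<epsilon> + u * u" if "u \<ge> 0" for u
        proof -
          have "0 \<le> (u - \<epsilon>) * (u - \<epsilon>)" by simp
          moreover have "0 \<le> \<epsilon> * u" using that \<epsilon> by (intro mult_nonneg_nonneg) auto
          moreover have "(u - \<epsilon>) * (u - \<epsilon>) =
              u * u + \<epsilon> * \<epsilon> - 2 * (\<epsilon> * u)" by (simp add: algebra_simps)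
          ultimately show ?thesis by linarith
        qed
        from this[of "\<bar>?u\<bar>"] have "\<epsilon> * \<bar>?u\<bar> \<le> \<epsilon> * \<epsilon> + ?u\<^sup>2"
          by (simp add: power2_eq_square)
        then show ?thesis using \<epsilon> by (simp add: field_simps)
      qed
      finally show ?thesis by (simp add: power_mult_distrib)
    qed
    then have "cmod (\<Sum>j<n. iexp (t * ?l x j \<omega>) - iexp (t * ?l y j \<omega>)) \<le>
        (\<Sum>j<n. \<epsilon> + t\<^sup>2 / \<epsilon> * (?l ?r j \<omega>)\<^sup>2)"
      by (intro sum_norm_le) auto
    also have "\<dots> = real n * (\<epsilon> + t\<^sup>2 / \<epsilon> * ?g \<omega>)"
    proof -
      have "real n * \<epsilon> + c * S = real n * (\<epsilon> + c * (S / real n))" for c S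
        using n0 by (simp add: field_simps)
      then show ?thesis by (simp only: sum.distrib sum_distrib_left[symmetric] sum_constant card_lessThan)
    qed
    finally show ?thesis using n0 by (simp add: norm_divide divide_le_eq mult.commute)
  qed
  have "(\<Sum>j<n. \<integral>\<omega>. iexp (t * ?l x j \<omega>) \<partial>M) / of_nat n - (\<Sum>j<n. \<integral>\<omega>. iexp (t * ?l y j \<omega>) \<partial>M) / of_nat n =
      (\<integral>\<omega>. (\<Sum>j<n. iexp (t * ?l x j \<omega>) - iexp (t * ?l y j \<omega>)) / of_nat n \<partial>M)"
    using intx inty
    by (simp add: Bochner_Integration.integral_sum Bochner_Integration.integral_diff sum_subtractf diff_divide_distrib)
  also have "cmod \<dots> \<le> (\<integral>\<omega>. cmod ((\<Sum>j<n. iexp (t * ?l x j \<omega>) - iexp (t * ?l y j \<omega>)) / of_nat n) \<partial>M)"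
    by (rule integral_norm_bound)
  also have "\<dots> \<le> (\<integral>\<omega>. \<epsilon> + t\<^sup>2 / \<epsilon> * ?g \<omega> \<partial>M)"
  proof (rule integral_mono[OF integrable_norm _ pt])
    show "integrable M (\<lambda>\<omega>. (\<Sum>j<n. iexp (t * ?l x j \<omega>) - iexp (t * ?l y j \<omega>)) / of_nat n)"
      by (intro integrable_divide Bochner_Integration.integrable_sum Bochner_Integration.integrable_diff intx inty)
    show "integrable M (\<lambda>\<omega>. \<epsilon> + t\<^sup>2 / \<epsilon> * ?g \<omega>)"
      by (intro Bochner_Integration.integrable_add integrable_mult_right ig) simp
  qed
  also have "\<dots> = \<epsilon> + t\<^sup>2 / \<epsilon> * (\<integral>\<omega>. ?g \<omega> \<partial>M)"
  proof -
    have "(\<integral>\<omega>. \<epsilon> + t\<^sup>2 / \<epsilon> * ?g \<omega> \<partial>M) =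
        (\<integral>\<omega>. \<epsilon> \<partial>M) + (\<integral>\<omega>. t\<^sup>2 / \<epsilon> * ?g \<omega> \<partial>M)"
      using ig by (intro Bochner_Integration.integral_add integrable_mult_right) auto
    then show ?thesis using prob_space by (simp only: integral_mult_right_zero lebesgue_integral_const) simp
  qed
  also have "\<dots> \<le> \<epsilon> +
      t\<^sup>2 / \<epsilon> * (\<integral>\<omega>. 4 * (\<Sum>i<n. (?r i \<omega>)\<^sup>2) \<partial>M)"
    using \<epsilon> by (intro add_left_mono mult_left_mono integral_mono[OF ig isum] bound) auto
  also have "(\<integral>\<omega>. 4 * (\<Sum>i<n. (?r i \<omega>)\<^sup>2) \<partial>M) =
      4 * (\<Sum>i<n. expectation (\<lambda>\<omega>. (?r i \<omega>)\<^sup>2))"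
    using r by simp
  finally show ?thesis by (simp add: mult_ac)
qed

section \<open>Truncated entries and the limit theorem\<close>

text \<open>The exponent \<open>\<alpha> = 1/2\<close> in the assumption makes \<open>n\<close> times the square of the largest odd moment tend
to \<open>0\<close>.\<close>

lemma assumption_A_odd_moments_l2_null:
  assumes A: "assumption_A M x t gn g" and k: "k \<ge> 1"
  shows "(\<lambda>n. \<Sum>l\<le>n div 2. (\<integral>\<omega>. x n l \<omega> ^ (2 * k - 1) * of_bool (ennreal \<bar>x n l \<omega>\<bar> \<le> t n) \<partial>M n)\<^sup>2) \<longlonglongrightarrow> 0"
proof -
  let ?m = "\<lambda>n l. \<integral>\<omega>. x n l \<omega> ^ (2 * k - 1) * of_bool (ennreal \<bar>x n l \<omega>\<bar> \<le> t n) \<partial>M n"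
  let ?s = "\<lambda>n. SUP i\<in>{..<n}. \<bar>?m n i\<bar>"
  have "(\<lambda>n. real n powr (1/2) * ?s n) \<longlonglongrightarrow> 0"
    using A k unfolding assumption_A_def by (auto dest!: spec[of _ k] spec[of _ "1/2 :: real"])
  then have lim: "(\<lambda>n. (real n powr (1/2) * ?s n)\<^sup>2) \<longlonglongrightarrow>
      0" using tendsto_power[of _ 0 _ 2] by simp
  show ?thesis
  proof (rule Lim_null_comparison[OF _ lim])
    show "\<forall>\<^sub>F n in sequentially. norm (\<Sum>l\<le>n div 2. (?m n l)\<^sup>2) \<le>
        (real n powr (1/2) * ?s n)\<^sup>2"
    proof (rule eventually_sequentiallyI[of 1])
      fix n :: nat assume n: "n \<ge> 1"
      have "(\<Sum>l\<le>n div 2. (?m n l)\<^sup>2) \<le> (\<Sum>l\<le>n div 2. (?s n)\<^sup>2)"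
      proof (rule sum_mono)
        fix l assume "l \<in> {..n div 2}"
        then have "l < n" using n by auto
        then have "\<bar>?m n l\<bar> \<le> ?s n" by (intro cSUP_upper) auto
        from power_mono[OF this abs_ge_zero, of 2] show "(?m n l)\<^sup>2 \<le> (?s n)\<^sup>2" by simp
      qed
      also have "\<dots> = real (Suc (n div 2)) * (?s n)\<^sup>2" by simp
      also have "\<dots> \<le> real n * (?s n)\<^sup>2" using Suc_half_le[OF n]
          by (intro mult_right_mono) (auto simp del: of_nat_Suc)
      also have "\<dots> = (real n powr (1/2) * ?s n)\<^sup>2"
      proof -
        have "(real n powr (1/2))\<^sup>2 = real n" using n by (simp add: powr_half_sqrt)
        then show ?thesis by (simp only: power_mult_distrib)
      qed
      finally show "norm (\<Sum>l\<le>n div 2. (?m n l)\<^sup>2) \<le>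
          (real n powr (1/2) * ?s n)\<^sup>2" by (simp add: sum_nonneg)
    qed
  qed
qed

lemma assumption_A_circulant_array:
  assumes P: "\<And>n. n \<ge> 1 \<Longrightarrow> prob_space (M n)"
    and I: "\<And>n. n \<ge> 1 \<Longrightarrow> prob_space.indep_vars (M n) (\<lambda>_. borel) (x n) {..<n}"
    and A: "assumption_A M x t gn g"
  shows "circulant_array M (\<lambda>n i \<omega>. trunc (t n) (x n i \<omega>)) (limit_cumulant (\<lambda>j. 2 * integral {0..1/2} (g j)))"
proof (rule circulant_array.intro)
  let ?y = "\<lambda>n i \<omega>. trunc (t n) (x n i \<omega>)"
  have gR: "Riemann_integrable_on (gn (2 * k) n) 0 1" "bounded (gn (2 * k) n ` {0..1})" if "k \<ge> 1" "n \<ge> 1" for k n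
    using A that unfolding assumption_A_def by auto
  have gU: "uniform_limit {0..1} (gn (2 * k)) (g (2 * k)) sequentially" if "k \<ge> 1" for k
    using A that unfolding assumption_A_def by auto
  have even: "integrable (M n) (\<lambda>\<omega>. ?y n i \<omega> ^ (2 * k))"
    "real n * (\<integral>\<omega>. ?y n i \<omega> ^ (2 * k) \<partial>M n) = gn (2 * k) n (real i / real n)"
    if "k \<ge> 1" "n \<ge> 1" "i < n" for k n i
    using A that unfolding assumption_A_def by (auto simp: trunc_power)
  have meas: "?y n i \<in> borel_measurable (M n)" if n: "n \<ge> 1" and i: "i < n" for n i
  proof -
    interpret prob_space "M n" by (rule P[OF n])
    have "x n i \<in> borel_measurable (M n)" using indep_vars_borel_measurable[OF I[OF n]] i by auto
    then show ?thesis by (rule measurable_compose) (rule trunc_measurable)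
  qed
  show "prob_space (M n)" if "1 \<le> n" for n by (rule P[OF that])
  show "prob_space.indep_vars (M n) (\<lambda>_. borel) (?y n) {..<n}" if n: "1 \<le> n" for n
  proof -
    interpret prob_space "M n" by (rule P[OF n])
    show ?thesis using indep_vars_compose2[OF I[OF n], of "\<lambda>_. trunc (t n)" "\<lambda>_. borel"] trunc_measurable
        by simp
  qed
  show "integrable (M n) (\<lambda>\<omega>. ?y n i \<omega> ^ k)" if n: "1 \<le> n" and i: "i < n" for n i k
  proof (cases "k = 0")
    case True
    interpret prob_space "M n" by (rule P[OF n])
    show ?thesis using True by simp
  next
    case False
    interpret prob_space "M n" by (rule P[OF n])
    show ?thesis
    proof (rule Bochner_Integration.integrable_bound)
      show "integrable (M n) (\<lambda>\<omega>. 1 + ?y n i \<omega> ^ (2 * k))" using even(1)[of k n i] False n i by simp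
      show "(\<lambda>\<omega>. ?y n i \<omega> ^ k) \<in> borel_measurable (M n)" using meas[OF n i] by simp
      show "AE \<omega> in M n. norm (?y n i \<omega> ^ k) \<le> norm (1 + ?y n i \<omega> ^ (2 * k))"
      proof (rule AE_I2)
        fix \<omega>
        let ?a = "?y n i \<omega>"
        have e: "?a ^ (2 * k) = (?a ^ k)\<^sup>2" by (simp add: power_mult[symmetric] mult.commute)
        have "0 \<le> (\<bar>?a ^ k\<bar> - 1)\<^sup>2" by simp
        then have "2 * \<bar>?a ^ k\<bar> \<le> 1 + (?a ^ k)\<^sup>2" by (simp add: power2_diff)
        then have "\<bar>?a ^ k\<bar> \<le> 1 + (?a ^ k)\<^sup>2" using abs_ge_zero[of "?a ^ k"] by linarith
        then show "norm (?a ^ k) \<le> norm (1 + ?a ^ (2 * k))" unfolding e by simp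
      qed
    qed
  qed
  fix p :: nat assume p: "1 \<le> p"
  show "(\<lambda>n. \<Sum>l\<le>n div 2. (\<integral>\<omega>. ?y n l \<omega> ^ p \<partial>M n)\<^sup>2) \<longlonglongrightarrow> 0"
  proof (cases "even p")
    case True
    then obtain k where k: "p = 2 * k" "k \<ge> 1" using p by (auto elim!: evenE)
    show ?thesis unfolding k(1)
      by (rule grid_mean_limits(1)[OF gR(1)[OF k(2)] gR(2)[OF k(2)] gU[OF k(2)] even(2)[OF k(2)]])
  next
    case False
    then obtain k where k: "p = 2 * k - 1" "k \<ge> 1" using p by (auto elim!: oddE intro: that[of "Suc _"])
    have "2 * k - 1 \<ge> 1" using k by simp
    then show ?thesis using assumption_A_odd_moments_l2_null[OF A k(2)]
      unfolding k(1) by (simp only: trunc_power)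
  qed
  show "(\<lambda>n. central_coeff p * (\<Sum>l\<le>n div 2. (\<integral>\<omega>. ?y n l \<omega> ^ p \<partial>M n) * half_weight n l ^ p))
    \<longlonglongrightarrow> limit_cumulant (\<lambda>j. 2 * integral {0..1/2} (g j)) p"
  proof (cases "even p")
    case True
    then obtain k where k: "p = 2 * k" "k \<ge> 1" using p by (auto elim!: evenE)
    have "(\<lambda>n. \<Sum>l\<le>n div 2. (\<integral>\<omega>. ?y n l \<omega> ^ p \<partial>M n) * half_weight n l ^ p) \<longlonglongrightarrow> integral {0..1/2} (g p)"
      unfolding k(1)
      by (rule grid_mean_limits(2)[OF gR(1)[OF k(2)] gR(2)[OF k(2)] gU[OF k(2)] even(2)[OF k(2)]])
    from tendsto_mult_left[OF this, of "central_coeff p"] show ?thesis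
      using True by (simp add: limit_cumulant_def central_coeff_eq_a_seq)
  next
    case False
    then show ?thesis by (simp add: limit_cumulant_def central_coeff_def)
  qed
qed

text \<open>Carleman's condition is assumed for the numbers \<open>\<alpha>\<^sub>2\<^sub>k\<close>, which dominate the limiting moments up to
\<open>4\<^sup>k\<close>. A nonzero second moment makes all even moments positive, so the infinite terms that a
vanishing \<open>\<alpha>\<^sub>2\<^sub>k\<close> would contribute to the assumed series do not arise.\<close>

lemma limit_moments_carleman:
  fixes g :: "nat \<Rightarrow> real \<Rightarrow> real"
  defines "\<beta> \<equiv> limit_moment (\<lambda>j. 2 * integral {0..1/2} (g j))"
  assumes A: "assumption_A M x t gn g"
    and \<mu>: "real_distribution \<mu>" and mom: "has_moments \<mu> \<beta>"
    and nz: "\<beta> 2 \<noteq> 0"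
  shows "\<not> summable (carleman_terms \<beta>)"
proof (rule carleman_condition_transfer)
  interpret real_distribution \<mu> by fact
  have int: "integrable \<mu> (\<lambda>u. u ^ k)" and eq: "(\<integral>u. u ^ k \<partial>\<mu>) = \<beta> k" for k
    using mom by (auto simp: has_moments_def)
  have gR: "Riemann_integrable_on (gn (2 * k) n) 0 1" "bounded (gn (2 * k) n ` {0..1})" if "k \<ge> 1" "n \<ge> 1" for k n
    using A that unfolding assumption_A_def by auto
  have gU: "uniform_limit {0..1} (gn (2 * k)) (g (2 * k)) sequentially" if "k \<ge> 1" for k
    using A that unfolding assumption_A_def by auto
  note reg = half_riemann_sum_uniform_limit[OF gR gU]
  show "(\<Sum>k. inverse (ennreal (carleman_alpha g (2 * Suc k) powr (1 / real (2 * Suc k))))) = \<infinity>"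
    using A unfolding assumption_A_def by blast
  fix k
  show "\<beta> (2 * Suc k) \<le> 2 ^ (2 * Suc k) * carleman_alpha g (2 * Suc k)"
    unfolding \<beta>_def by (rule limit_moment_le_carleman_alpha) (use reg in auto)
  have "0 < (\<integral>u. \<bar>u\<bar> ^ (2 * Suc k) \<partial>\<mu>)" using nz
      by (intro abs_moment_pos int) (simp only: eq not_False_eq_True)
  moreover have "\<bar>u\<bar> ^ (2 * Suc k) = u ^ (2 * Suc k)" for u :: real by (rule power_even_abs) simp
  ultimately show "0 < \<beta> (2 * Suc k)" by (simp only: eq)
qed

lemma truncation_error_square: "(u - trunc t u)\<^sup>2 = u\<^sup>2 * of_bool (t < ennreal \<bar>u\<bar>)"
  by (auto simp: trunc_def not_le)

theorem theorem3p2: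
  fixes M :: "nat \<Rightarrow> 'a measure"
    and x :: "nat \<Rightarrow> nat \<Rightarrow> 'a \<Rightarrow> real"
    and t :: "nat \<Rightarrow> ennreal"
    and gn :: "nat \<Rightarrow> nat \<Rightarrow> real \<Rightarrow> real"
    and g :: "nat \<Rightarrow> real \<Rightarrow> real"
  assumes "\<And>n. n \<ge> 1 \<Longrightarrow> prob_space (M n)"
    and "\<And>n. n \<ge> 1 \<Longrightarrow> prob_space.indep_vars (M n) (\<lambda>_. borel) (x n) {..<n}"
    and "assumption_A M x t gn g"
  shows "\<exists>\<mu>. real_distribution \<mu> \<and> symmetric_measure \<mu> \<and>
      has_moments \<mu> (limit_moment (\<lambda>j. 2 * integral {0..1/2} (g j))) \<and>
      weak_conv_m (\<lambda>n. eesd (M n) (\<lambda>\<omega>. sym_circulant n (\<lambda>i. trunc (t n) (x n i \<omega>)))) \<mu> \<and>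
      ((\<forall>n\<ge>1. \<forall>i<n. distr (M n) borel (x n i) = distr (M n) borel (x n 0)) \<longrightarrow>
        (\<exists>c C. (\<forall>m\<ge>1. \<forall>n\<ge>1. \<forall>i<n. gn (2 * m) n (real i / real n) = c (2 * m) n) \<and>
               (\<forall>m\<ge>1. c (2 * m) \<longlonglongrightarrow> C (2 * m)) \<and>
               has_moments \<mu> (limit_moment C))) \<and>
      ((\<lambda>n. \<Sum>i<n. \<integral>\<^sup>+\<omega>. ennreal ((x n i \<omega>)\<^sup>2 * of_bool (t n < ennreal \<bar>x n i \<omega>\<bar>)) \<partial>M n)
          \<longlonglongrightarrow> 0 \<longrightarrow>
        weak_conv_m (\<lambda>n. eesd (M n) (\<lambda>\<omega>. sym_circulant n (\<lambda>i. x n i \<omega>))) \<mu>)"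
proof -
  note P = assms(1) and I = assms(2) and A = assms(3)
  let ?C = "\<lambda>j. 2 * integral {0..1/2} (g j)"
  let ?y = "\<lambda>n i \<omega>. trunc (t n) (x n i \<omega>)"
  let ?avg = "\<lambda>z s n. (\<Sum>j<n. \<integral>\<omega>. iexp (s * circ_eigenvalue n (\<lambda>i. z n i \<omega>) j) \<partial>M n) / of_nat n"
  interpret circulant_array M ?y "limit_cumulant ?C" by (rule assumption_A_circulant_array[OF assms])
  have meas: "x n i \<in> borel_measurable (M n)" if "n \<ge> 1" "i < n" for n i
    using prob_space.indep_vars_borel_measurable[OF P I] that by auto
  have measy: "?y n i \<in> borel_measurable (M n)" if "n \<ge> 1" "i < n" for n i
    by (rule measurable_compose[OF meas[OF that] trunc_measurable])
  have cm: "cumulant_moment (limit_cumulant ?C) = limit_moment ?C"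
    by (rule ext) (rule cumulant_moment_eq_limit_moment)
  obtain \<mu> where \<mu>: "real_distribution \<mu>" and mom: "has_moments \<mu> (limit_moment ?C)"
    using limit_distribution_exists unfolding cm .
  interpret \<mu>: real_distribution \<mu> by (rule \<mu>)
  have int\<mu>: "integrable \<mu> (\<lambda>u. u ^ k)" and eq\<mu>: "(\<integral>u. u ^ k \<partial>\<mu>) =
      limit_moment ?C k" for k
    using mom by (auto simp: has_moments_def)
  have carl: "\<not> summable (carleman_terms (limit_moment ?C))"
    if "limit_moment ?C 2 \<noteq> 0"
    by (rule limit_moments_carleman[OF A \<mu> mom that])
  have sym: "symmetric_measure \<mu>"
    unfolding symmetric_measure_def
  proof (rule carleman_determinacy[symmetric, OF \<mu>])
    show "real_distribution (distr \<mu> borel uminus)" by (rule \<mu>.real_distribution_distr) simp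
    show "integrable \<mu> (\<lambda>x. x ^ k)" for k by (rule int\<mu>)
    show "integrable (distr \<mu> borel uminus) (\<lambda>x. x ^ k)" for k
    proof (subst integrable_distr_eq)
      show "integrable \<mu> (\<lambda>x. (- x) ^ k)" using int\<mu>[of k] by (cases "even k") auto
    qed auto
    show "(\<integral>x. x ^ k \<partial>\<mu>) = (\<integral>x. x ^ k \<partial>distr \<mu> borel uminus)" for k
    proof -
      have "(\<integral>x. x ^ k \<partial>distr \<mu> borel uminus) =
          (\<integral>x. (- x) ^ k \<partial>\<mu>)" by (subst integral_distr) auto
      also have "\<dots> = (\<integral>x. x ^ k \<partial>\<mu>)"
        using eq\<mu>[of k] by (cases "even k") (auto simp: limit_moment_def)
      finally show ?thesis ..
    qed
    show "\<not> summable (carleman_terms (\<lambda>n. \<integral>x. x ^ n \<partial>\<mu>))" if "(\<integral>x. x\<^sup>2 \<partial>\<mu>) \<noteq> 0"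
      using carl that unfolding eq\<mu> .
  qed
  have avgy: "(\<lambda>n. ?avg ?y s n) \<longlonglongrightarrow> char \<mu> s" for s
  proof (rule Lim_transform_eventually[OF char_average_tendsto[OF \<mu>, unfolded cm, OF mom carl]])
    show "\<forall>\<^sub>F n in sequentially. (\<Sum>j<n. char (circ_law (M n) n (?y n) j) s) / of_nat n = ?avg ?y s n"
      by (rule eventually_sequentiallyI[of 1]) (simp only: law_props(4))
  qed
  have weak: "weak_conv_m (\<lambda>n. eesd (M n) (\<lambda>\<omega>. sym_circulant n (\<lambda>i. ?y n i \<omega>))) \<mu>"
    by (rule eesd_weak_conv_of_char[OF P measy \<mu> avgy])
  have iid: "\<exists>c C. (\<forall>m\<ge>1. \<forall>n\<ge>1. \<forall>i<n. gn (2 * m) n (real i / real n) =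
      c (2 * m) n) \<and>
               (\<forall>m\<ge>1. c (2 * m) \<longlonglongrightarrow> C (2 * m)) \<and> has_moments \<mu> (limit_moment C)"
    if D: "\<forall>n\<ge>1. \<forall>i<n. distr (M n) borel (x n i) = distr (M n) borel (x n 0)"
  proof (intro exI conjI allI impI)
    have gnm: "real n * (\<integral>\<omega>. ?y n i \<omega> ^ (2 * m) \<partial>M n) = gn (2 * m) n (real i / real n)"
      if "m \<ge> 1" "n \<ge> 1" "i < n" for m n i
      using A that unfolding assumption_A_def by (auto simp: trunc_power)
    have const: "gn (2 * m) n (real i / real n) = gn (2 * m) n 0" if m: "m \<ge> 1" and n: "n \<ge> 1" and i: "i < n" for m n i
    proof -
      have "(\<integral>\<omega>. ?y n i \<omega> ^ (2 * m) \<partial>M n) =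
          (\<integral>u. trunc (t n) u ^ (2 * m) \<partial>distr (M n) borel (x n i))" if "i < n" for i
        using meas[OF n that] trunc_measurable by (subst integral_distr) auto
      from this[OF i] this[of 0] have "(\<integral>\<omega>. ?y n i \<omega> ^ (2 * m) \<partial>M n) =
          (\<integral>\<omega>. ?y n 0 \<omega> ^ (2 * m) \<partial>M n)"
        using D n i by (metis gr_zeroI less_nat_zero_code)
      then show ?thesis using gnm[OF m n i] gnm[OF m n, of 0] n by simp
    qed
    then show "gn (2 * m) n (real i / real n) = (\<lambda>p n. gn p n 0) (2 * m) n" if "m \<ge> 1" "n \<ge> 1" "i < n" for m n i
      using that by simp
    have gU: "uniform_limit {0..1} (gn (2 * k)) (g (2 * k)) sequentially" if "k \<ge> 1" for k
      using A that unfolding assumption_A_def by auto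
    have lim0: "(\<lambda>n. gn (2 * m) n 0) \<longlonglongrightarrow> g (2 * m) 0" if "m \<ge> 1" for m
      by (rule tendsto_uniform_limitI[OF gU[OF that]]) simp
    then show "(\<lambda>p n. gn p n 0) (2 * m) \<longlonglongrightarrow> (\<lambda>p. g p 0) (2 * m)" if "m \<ge> 1" for m
      using that by simp
    \<comment> \<open>Constant grid values make the half Riemann sum converge to half of their limit.\<close>
    have "?C (2 * m) = g (2 * m) 0" if m: "m \<ge> 1" for m
    proof -
      have gR: "Riemann_integrable_on (gn (2 * m) n) 0 1" "bounded (gn (2 * m) n ` {0..1})" if "n \<ge> 1" for n
        using A that m unfolding assumption_A_def by auto
      have "(\<lambda>n. (\<Sum>l\<le>n div 2. gn (2 * m) n (real l / real n)) / real n) \<longlonglongrightarrow>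
          integral {0..1/2} (g (2 * m))"
        by (rule half_riemann_sum_uniform_limit(3)[OF gR gU[OF m]])
      moreover have "(\<lambda>n. (\<Sum>l\<le>n div 2. gn (2 * m) n (real l / real n)) / real n) \<longlonglongrightarrow>
          1 / 2 * g (2 * m) 0"
      proof (rule Lim_transform_eventually)
        have "(\<lambda>n. real (Suc (n div 2)) / real n) \<longlonglongrightarrow> 1 / 2" by real_asymp
        then show "(\<lambda>n. real (Suc (n div 2)) / real n * gn (2 * m) n 0) \<longlonglongrightarrow> 1 / 2 * g (2 * m) 0"
          by (intro tendsto_mult lim0 m)
        show "\<forall>\<^sub>F n in sequentially. real (Suc (n div 2)) / real n * gn (2 * m) n 0 =
            (\<Sum>l\<le>n div 2. gn (2 * m) n (real l / real n)) / real n"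
        proof (rule eventually_sequentiallyI[of 1])
          fix n :: nat assume n: "n \<ge> 1"
          have "(\<Sum>l\<le>n div 2. gn (2 * m) n (real l / real n)) = (\<Sum>l\<le>n div 2. gn (2 * m) n 0)"
            using n by (intro sum.cong refl const m) auto
          then show "real (Suc (n div 2)) / real n * gn (2 * m) n 0 =
            (\<Sum>l\<le>n div 2. gn (2 * m) n (real l / real n)) / real n" by simp
        qed
      qed
      ultimately have "integral {0..1/2} (g (2 * m)) = 1 / 2 * g (2 * m) 0" by (rule LIMSEQ_unique)
      then show ?thesis by simp
    qed
    then have "limit_moment (\<lambda>p. g p 0) = limit_moment ?C"
      by (intro ext limit_moment_cong) simp
    then show "has_moments \<mu> (limit_moment (\<lambda>p. g p 0))" using mom by (simp only:)
  qed
  have partb: "weak_conv_m (\<lambda>n. eesd (M n) (\<lambda>\<omega>. sym_circulant n (\<lambda>i. x n i \<omega>))) \<mu>"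
    if T: "(\<lambda>n. \<Sum>i<n. \<integral>\<^sup>+\<omega>. ennreal ((x n i \<omega>)\<^sup>2 * of_bool (t n < ennreal \<bar>x n i \<omega>\<bar>)) \<partial>M n) \<longlonglongrightarrow> 0"
  proof (rule eesd_weak_conv_of_char[OF P meas \<mu>])
    fix s
    let ?N = "\<lambda>n i. \<integral>\<^sup>+\<omega>. ennreal ((x n i \<omega> - ?y n i \<omega>)\<^sup>2) \<partial>M n"
    let ?e = "\<lambda>n i. \<integral>\<omega>. (x n i \<omega> - ?y n i \<omega>)\<^sup>2 \<partial>M n"
    have T': "(\<lambda>n. \<Sum>i<n. ?N n i) \<longlonglongrightarrow> 0" using T by (simp only: truncation_error_square)
    \<comment> \<open>The hypothesis makes the truncation errors square integrable from some order on.\<close>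
    have fin: "\<forall>\<^sub>F n in sequentially. (\<Sum>i<n. ?N n i) < \<infinity>"
      by (rule order_tendstoD(2)[OF T']) simp
    have intr: "integrable (M n) (\<lambda>\<omega>. (x n i \<omega> - ?y n i \<omega>)\<^sup>2)"
      if "n \<ge> 1" "(\<Sum>i<n. ?N n i) < \<infinity>" "i < n" for n i
    proof (rule integrableI_nonneg)
      show "(\<lambda>\<omega>. (x n i \<omega> - ?y n i \<omega>)\<^sup>2) \<in> borel_measurable (M n)"
        using meas[OF that(1,3)] measy[OF that(1,3)] by simp
      have "?N n i \<le> (\<Sum>i<n. ?N n i)" using that(3) by (intro member_le_sum) auto
      then show "?N n i < \<infinity>" using that(2) by (rule le_less_trans)
    qed auto
    have sume: "(\<Sum>i<n. ?e n i) = enn2real (\<Sum>i<n. ?N n i)" if "n \<ge> 1" "(\<Sum>i<n. ?N n i) < \<infinity>" for n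
    proof -
      have "?N n i = ennreal (?e n i)" if "i < n" for i
        using intr[OF \<open>n \<ge> 1\<close> \<open>(\<Sum>i<n. ?N n i) < \<infinity>\<close> that]
            by (intro nn_integral_eq_integral) auto
      then have "(\<Sum>i<n. ?N n i) = (\<Sum>i<n. ennreal (?e n i))" by (intro sum.cong) auto
      also have "\<dots> = ennreal (\<Sum>i<n. ?e n i)" by (rule sum_ennreal) (auto intro: integral_nonneg_AE)
      finally show ?thesis by (simp add: sum_nonneg integral_nonneg_AE)
    qed
    have elim: "(\<lambda>n. \<Sum>i<n. ?e n i) \<longlonglongrightarrow> 0"
    proof (rule Lim_transform_eventually)
      show "(\<lambda>n. enn2real (\<Sum>i<n. ?N n i)) \<longlonglongrightarrow>
          0" using tendsto_enn2real[of "\<lambda>n. \<Sum>i<n. ?N n i" 0] T' by simp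
      show "\<forall>\<^sub>F n in sequentially. enn2real (\<Sum>i<n. ?N n i) = (\<Sum>i<n. ?e n i)"
        using fin eventually_ge_at_top[of 1] by eventually_elim (simp only: sume)
    qed
    have "(\<lambda>n. ?avg x s n - ?avg ?y s n) \<longlonglongrightarrow> 0"
    proof (rule LIMSEQ_I)
      fix \<epsilon> :: real assume \<epsilon>: "\<epsilon> > 0"
      have e2: "\<epsilon> / 2 > 0" using \<epsilon> by simp
      have "(\<lambda>n. \<epsilon> / 2 + 4 * s\<^sup>2 / (\<epsilon> / 2) * (\<Sum>i<n. ?e n i)) \<longlonglongrightarrow>
          \<epsilon> / 2 + 4 * s\<^sup>2 / (\<epsilon> / 2) * 0"
        by (intro tendsto_intros elim)
      then have "\<forall>\<^sub>F n in sequentially. \<epsilon> / 2 +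
          4 * s\<^sup>2 / (\<epsilon> / 2) * (\<Sum>i<n. ?e n i) < \<epsilon>"
        by (rule order_tendstoD(2)) (use \<epsilon> in simp)
      then have "\<forall>\<^sub>F n in sequentially. norm (?avg x s n - ?avg ?y s n - 0) < \<epsilon>"
        using fin eventually_ge_at_top[of 1]
      proof eventually_elim
        case (elim n)
        interpret prob_space "M n" by (rule P) (use elim in simp)
        have "norm (?avg x s n - ?avg ?y s n) \<le> \<epsilon> / 2 + 4 * s\<^sup>2 / (\<epsilon> / 2) * (\<Sum>i<n. ?e n i)"
          by (rule char_average_perturbation[OF _ meas measy intr e2]) (use elim in auto)
        then show ?case using elim(1) by simp
      qed
      then show "\<exists>no. \<forall>n\<ge>no. norm (?avg x s n - ?avg ?y s n - 0) < \<epsilon>"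
        by (simp only: eventually_sequentially)
    qed
    from tendsto_add[OF this avgy[of s]] show "(\<lambda>n. ?avg x s n) \<longlonglongrightarrow> char \<mu> s" by simp
  qed
  show ?thesis
    using \<mu> sym mom weak iid partb by blast
qed

end
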